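(* Let $\phi:\mathbf{SU}(2)\to\mathbf{SU}(2)/\mathbf{S}(\mathbf{U}(1)\times\mathbf{U}(1))$ be the homogeneous projection (the Hopf map $S^3\to S^2$), and for a coupling constant $\alpha\ge0$ consider the Faddeev-Hopf energy functional $$E(\phi)=\frac12\int_{\mathbf{SU}(2)}\big(|d\phi|^2+\alpha|\phi^*\omega|^2\big)\,{\ast 1}$$ on smooth maps $\mathbf{SU}(2)\to\mathbf{SU}(2)/\mathbf{S}(\mathbf{U}(1)\times\mathbf{U}(1))$. The Hopf map is an unstable critical point of this functional if $\alpha<1$ and a stable critical point if $\alpha\geq1$.
   Context: Normalization: $\mathbf{SU}(2)$ carries the bi-invariant metric for which the left-invariant fields given by $$\vartheta_1=\frac{i}{2}\begin{pmatrix}0&1\\1&0\end{pmatrix},\quad\vartheta_2=\frac12\begin{pmatrix}0&1\\-1&0\end{pmatrix},\quad\vartheta_3=\frac{i}{2}\begin{pmatrix}1&0\\0&-1\end{pmatrix}$$ in $\mathfrak{su}(2)$ are orthonormal. The isotropy algebra is $\mathfrak{k}=\mathrm{span}\{\vartheta_3\}$ and $\mathfrak{p}=\mathrm{span}\{\vartheta_1,\vartheta_2\}$. The quotient $N=\mathbf{SU}(2)/\mathbf{S}(\mathbf{U}(1)\times\mathbf{U}(1))\cong\mathbb{C}P^1$ carries the metric $h$ making the homogeneous projection a Riemannian submersion, and the complex structure $J$ induced by the adjoint action of $\vartheta_3$ on $\mathfrak{p}$; $\omega=h(J\cdot,\cdot)$ is the Kähler form. $\ast 1$ is the volume form on $\mathbf{SU}(2)$;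 for an orthonormal frame $e_i$, $|d\phi|^2=\sum_i h(d\phi(e_i),d\phi(e_i))$ and, for $2$-forms $\beta$, $|\beta|^2=\frac12\sum_{i,j}\beta(e_i,e_j)^2$. The Hessian of $E$ at a critical point $\phi$ is $H_\phi(X,Y)=\frac{\partial^2}{\partial s\,\partial t}|_{s=t=0}E(\phi_{s,t})$ for a smooth 2-parameter variation $\phi_{s,t}$ of $\phi=\phi_{0,0}$ with $X=\partial_t\phi_{s,t}|_{s=t=0}$ and $Y=\partial_s\phi_{s,t}|_{s=t=0}$ in $\Gamma(\phi^{-1}TN)$. A critical point is stable if $H_\phi(X,X)\ge0$ for all $X\in\Gamma(\phi^{-1}TN)$, and unstable otherwise. *)

theory Defs
  imports "HOL-Analysis.Analysis"
begin

section \<open>The group SU(2) and its bi-invariant metric\<close>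

type_synonym cmat2 = "complex^2^2"

definition ctransp :: "cmat2 \<Rightarrow> cmat2" where
  "ctransp A = (\<chi> i j. cnj (A $ j $ i))"

definition SU2 :: "cmat2 set" where
  "SU2 = {A. A ** ctransp A = mat 1 \<and> det A = 1}"

text \<open>The subgroup S(U(1) x U(1)).\<close>
definition SU1U1 :: "cmat2 set" where
  "SU1U1 = {A \<in> SU2. A $ 1 $ 2 = 0 \<and> A $ 2 $ 1 = 0}"

definition theta :: "3 \<Rightarrow> cmat2" where
  "theta i =
     (if i = 1 then vector [vector [0, \<i> / 2], vector [\<i> / 2, 0]]
      else if i = 2 then vector [vector [0, 1 / 2], vector [- 1 / 2, 0]]
      else vector [vector [\<i> / 2, 0], vector [0, - \<i> / 2]])"

definition p_space :: "cmat2 set" where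
  "p_space = span {theta 1, theta 2}"

definition ad :: "cmat2 \<Rightarrow> cmat2 \<Rightarrow> cmat2" where
  "ad A B = A ** B - B ** A"

text \<open>
  The real inner product of \<^typ>\<open>cmat2\<close> is the real part of the trace of \<open>u ** ctransp v\<close>, hence
  invariant under left and right multiplication by unitary matrices; the factor 2 makes the
  \<^const>\<open>theta\<close> orthonormal.  The tangent space of SU(2) at \<open>g\<close> is \<open>{g ** X | X \<in> su(2)}\<close>, and
  restricted to it this is the bi-invariant metric.
\<close>
definition metric_SU2 :: "cmat2 \<Rightarrow> cmat2 \<Rightarrow> real" where
  "metric_SU2 u v = 2 * (u \<bullet> v)"

lemma metric_SU2_theta: "metric_SU2 (theta i) (theta j) = (if i = j then 1 else 0)"
  using exhaust_3[of i] exhaust_3[of j]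
  by (auto simp: metric_SU2_def theta_def inner_vec_def inner_complex_def sum_2)

definition frame :: "3 \<Rightarrow> cmat2 \<Rightarrow> cmat2" where
  "frame i g = g ** theta i"

section \<open>Smooth maps\<close>

primrec Ck_on :: "nat \<Rightarrow> 'a::real_normed_vector set \<Rightarrow> ('a \<Rightarrow> 'b::real_normed_vector) \<Rightarrow> bool" where
  "Ck_on 0 U f \<longleftrightarrow> continuous_on U f"
| "Ck_on (Suc k) U f \<longleftrightarrow>
     (\<forall>x\<in>U. f differentiable (at x)) \<and> (\<forall>v. Ck_on k U (\<lambda>x. frechet_derivative f (at x) v))"

text \<open>Smoothness on a submanifold of a Euclidean space: existence of a smooth extension.\<close>
definition smooth_on :: "'a::real_normed_vector set \<Rightarrow> ('a \<Rightarrow> 'b::real_normed_vector) \<Rightarrow> bool" where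
  "smooth_on S f \<longleftrightarrow>
     (\<exists>U f'. open U \<and> S \<subseteq> U \<and> (\<forall>x\<in>S. f' x = f x) \<and> (\<forall>k. Ck_on k U f'))"

section \<open>Integration over SU(2)\<close>

text \<open>
  Inverse stereographic projection, a diffeomorphism from R^3 onto SU(2) without the point
  \<open>- mat 1\<close> (a null set).  The pullback of the volume form, which is the wedge product of the
  coframe dual to \<^const>\<open>frame\<close>, is the determinant of the components of the coordinate
  vector fields in that frame.
\<close>
definition stereo :: "real^3 \<Rightarrow> cmat2" where
  "stereo u = (1 / (1 + (norm u)\<^sup>2)) *\<^sub>R
     ((1 - (norm u)\<^sup>2) *\<^sub>R mat 1 + 4 *\<^sub>R (\<Sum>i\<in>UNIV. (u $ i) *\<^sub>R theta i))"

definition vol_density :: "real^3 \<Rightarrow> real" where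
  "vol_density u = \<bar>det (\<chi> i j.
     metric_SU2 (frame i (stereo u)) (frechet_derivative stereo (at u) (axis j 1)) :: real^3^3)\<bar>"

definition integral_SU2 :: "(cmat2 \<Rightarrow> real) \<Rightarrow> real" where
  "integral_SU2 f = (LINT u|lborel. f (stereo u) * vol_density u)"

section \<open>The homogeneous space N = SU(2)/S(U(1) x U(1))\<close>

definition hopf :: "cmat2 \<Rightarrow> cmat2 set" where
  "hopf g = (\<lambda>k. g ** k) ` SU1U1"

definition quot_N :: "cmat2 set set" where
  "quot_N = hopf ` SU2"

definition rep :: "cmat2 set \<Rightarrow> cmat2" where
  "rep p = (SOME g. g \<in> p)"

text \<open>
  The stabilizer of \<open>theta 3\<close> under the adjoint action is S(U(1) x U(1)), so the orbit map
  \<open>g SU1U1 \<mapsto> g (theta 3) g\<^sup>-\<^sup>1\<close> is an embedding of the quotient manifold \<^const>\<open>quot_N\<close> into the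
  2x2 matrices.  It is used only to express the smooth structure of \<^const>\<open>quot_N\<close> and to write
  down its tangent vectors as matrices; the metric and the complex structure below are
  transported from SU(2) by the projection \<^const>\<open>hopf\<close>.
\<close>
definition emb :: "cmat2 set \<Rightarrow> cmat2" where
  "emb p = rep p ** theta 3 ** ctransp (rep p)"

definition smooth_map :: "(cmat2 \<Rightarrow> cmat2 set) \<Rightarrow> bool" where
  "smooth_map \<phi> \<longleftrightarrow> \<phi> ` SU2 \<subseteq> quot_N \<and> smooth_on SU2 (\<lambda>x. emb (\<phi> x))"

text \<open>
  The differential of \<open>\<phi> : SU(2) \<rightarrow> quot_N\<close> at \<open>x \<in> SU2\<close>.  Only its values at vectors \<open>v\<close> tangent to
  SU(2) are meaningful; there they do not depend on the choice of derivative within \<^term>\<open>SU2\<close>.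
\<close>
definition diff_map :: "(cmat2 \<Rightarrow> cmat2 set) \<Rightarrow> cmat2 \<Rightarrow> cmat2 \<Rightarrow> cmat2" where
  "diff_map \<phi> x v = frechet_derivative (\<lambda>y. emb (\<phi> y)) (at x within SU2) v"

definition tangent_N :: "cmat2 set \<Rightarrow> cmat2 set" where
  "tangent_N p = {diff_map hopf g (g ** X) | g X. g \<in> p \<and> X \<in> p_space}"

text \<open>
  \<open>g ** X\<close> with \<open>X = hor_lift g v\<close> is the horizontal lift to \<open>g\<close> of a tangent vector \<open>v\<close> of \<^const>\<open>quot_N\<close>.
\<close>
definition hor_lift :: "cmat2 \<Rightarrow> cmat2 \<Rightarrow> cmat2" where
  "hor_lift g v = (THE X. X \<in> p_space \<and> diff_map hopf g (g ** X) = v)"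

text \<open>
  In the next two definitions the choice of the representative of \<open>p\<close> is immaterial, since both
  the inner product and \<open>ad (theta 3)\<close> on \<^const>\<open>p_space\<close> are invariant under the adjoint action of
  S(U(1) x U(1)).
\<close>
definition metric_N :: "cmat2 set \<Rightarrow> cmat2 \<Rightarrow> cmat2 \<Rightarrow> real" where
  "metric_N p v w = metric_SU2 (rep p ** hor_lift (rep p) v) (rep p ** hor_lift (rep p) w)"

definition J_N :: "cmat2 set \<Rightarrow> cmat2 \<Rightarrow> cmat2" where
  "J_N p v = diff_map hopf (rep p) (rep p ** ad (theta 3) (hor_lift (rep p) v))"

definition kaehler_N :: "cmat2 set \<Rightarrow> cmat2 \<Rightarrow> cmat2 \<Rightarrow> real" where
  "kaehler_N p v w = metric_N p (J_N p v) w"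

section \<open>The Faddeev-Hopf energy\<close>

definition norm_diff_sq :: "(cmat2 \<Rightarrow> cmat2 set) \<Rightarrow> cmat2 \<Rightarrow> real" where
  "norm_diff_sq \<phi> x =
     (\<Sum>i\<in>UNIV. metric_N (\<phi> x) (diff_map \<phi> x (frame i x)) (diff_map \<phi> x (frame i x)))"

definition norm_pullback_sq :: "(cmat2 \<Rightarrow> cmat2 set) \<Rightarrow> cmat2 \<Rightarrow> real" where
  "norm_pullback_sq \<phi> x =
     1 / 2 * (\<Sum>i\<in>UNIV. \<Sum>j\<in>UNIV.
       (kaehler_N (\<phi> x) (diff_map \<phi> x (frame i x)) (diff_map \<phi> x (frame j x)))\<^sup>2)"

definition energy :: "real \<Rightarrow> (cmat2 \<Rightarrow> cmat2 set) \<Rightarrow> real" where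
  "energy \<alpha> \<phi> = 1 / 2 * integral_SU2 (\<lambda>x. norm_diff_sq \<phi> x + \<alpha> * norm_pullback_sq \<phi> x)"

section \<open>Variations, Hessian and stability\<close>

text \<open>A smooth variation with parameter in \<open>'p\<close>: \<open>real\<close>, or \<open>real \<times> real\<close> for the pairs \<open>(s, t)\<close>.\<close>
definition variation ::
  "(cmat2 \<Rightarrow> cmat2 set) \<Rightarrow> ('p::euclidean_space \<Rightarrow> cmat2 \<Rightarrow> cmat2 set) \<Rightarrow> bool" where
  "variation \<phi> \<Phi> \<longleftrightarrow>
     (\<forall>x\<in>SU2. \<Phi> 0 x = \<phi> x) \<and>
     (\<exists>\<epsilon>>0. (\<forall>q\<in>ball 0 \<epsilon>. \<Phi> q ` SU2 \<subseteq> quot_N) \<and>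
            smooth_on (ball 0 \<epsilon> \<times> SU2) (\<lambda>(q, x). emb (\<Phi> q x)))"

definition critical_point :: "real \<Rightarrow> (cmat2 \<Rightarrow> cmat2 set) \<Rightarrow> bool" where
  "critical_point \<alpha> \<phi> \<longleftrightarrow> smooth_map \<phi> \<and>
     (\<forall>\<Phi> :: real \<Rightarrow> cmat2 \<Rightarrow> cmat2 set. variation \<phi> \<Phi> \<longrightarrow>
        ((\<lambda>t. energy \<alpha> (\<Phi> t)) has_real_derivative 0) (at 0))"

text \<open>Smooth sections of the pullback of the tangent bundle of \<^const>\<open>quot_N\<close> by \<open>\<phi>\<close>.\<close>
definition sections :: "(cmat2 \<Rightarrow> cmat2 set) \<Rightarrow> (cmat2 \<Rightarrow> cmat2) set" where
  "sections \<phi> = {X. smooth_on SU2 X \<and> (\<forall>x\<in>SU2. X x \<in> tangent_N (\<phi> x))}"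

definition hessian ::
  "real \<Rightarrow> (cmat2 \<Rightarrow> cmat2 set) \<Rightarrow> (cmat2 \<Rightarrow> cmat2) \<Rightarrow> (cmat2 \<Rightarrow> cmat2) \<Rightarrow> real" where
  "hessian \<alpha> \<phi> X Y = (THE r.
     \<exists>(\<Phi> :: real \<times> real \<Rightarrow> cmat2 \<Rightarrow> cmat2 set) D.
       variation \<phi> \<Phi> \<and>
       (\<forall>x\<in>SU2. ((\<lambda>t. emb (\<Phi> (0, t) x)) has_vector_derivative X x) (at 0)) \<and>
       (\<forall>x\<in>SU2. ((\<lambda>s. emb (\<Phi> (s, 0) x)) has_vector_derivative Y x) (at 0)) \<and>
       (\<forall>\<^sub>F s in nhds 0. ((\<lambda>t. energy \<alpha> (\<Phi> (s, t))) has_real_derivative D s) (at 0)) \<and>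
       (D has_real_derivative r) (at 0))"

definition stable_map :: "real \<Rightarrow> (cmat2 \<Rightarrow> cmat2 set) \<Rightarrow> bool" where
  "stable_map \<alpha> \<phi> \<longleftrightarrow> (\<forall>X\<in>sections \<phi>. hessian \<alpha> \<phi> X X \<ge> 0)"

end

(*
  The orbit map identifies the quotient with the unit sphere of su(2), so a map is a unit vector
  field n : SU(2) -> R^3, and the energy density is the sum of |e_i n|^2 plus alpha times the sum of
  (n . e_i n x e_j n)^2.  The Hopf map is the third vector of the frame m_j(g) = g theta_j g^-1, and
  e_i m_j = - eps_ijk m_k.  Left-invariant fields have vanishing integral; since the variation of
  the pulled back area form is exact up to the bracket [e_1, e_2] = - e_3, this gives criticality
  and, for a variation field a m_1 + b m_2 encoded as f = a + ib, the second variation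

    |R f|^2 + (1 + alpha) (|e_3 f|^2 - Im <f, e_3 f>) + alpha |Im (L f)|^2     (L2 norms)

  with the raising and lowering operators R = e_1 + i e_2 and L = e_1 - i e_2.  A function of weight
  mu (e_3 f = i mu f, mu a half-integer) contributes mu (mu - 1) |f|^2 to the middle term, which is
  negative only for mu = 1/2.  There the matrix entry g_11 gives (alpha - 1)/4 |g_11|^2, whence the
  instability for alpha < 1.  For alpha >= 1, the weight 1/2 part u interacts in the last term only
  with the weight 3/2 part v.  Writing u = R psi, which is possible for polynomials because they are
  spanned by the functions L^k (g_11^a g_21^b), turns the contribution of u and v into a sum of
  squares.  Smooth f are reached by orthogonal projection onto polynomials of bounded degree, which
  commutes with the skew-adjoint operators e_i and hence approximates f together with e_i f.
*)
theory Submission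
  imports Defs
begin

section \<open>The adjoint representation of SU(2)\<close>

text \<open>The Hessian is a definite description over all two-parameter variations, so a variation
  with the prescribed velocity must exist and the mixed derivative must depend on the velocity
  alone. The acceleration of the variation drops out because the Hopf map is critical: the Dirichlet
  term retains its normal part only, which unit length fixes as - X . X, and the area term loses it
  when the integrated first variation, valid for every map of the family, is differentiated.

  For stability the tight case is \<alpha> = 1, where g_11 yields zero. On u and v the integral of
  |Im (L f)|^2 is half of |L u - R w|^2, with w the conjugate of v. Put u = R psi: the commutator
  [L, R] psi = - psi gives L u - R w = - (psi + R (w - L psi)) and |u|^2 = |psi|^2 + |L psi|^2. The
  mixed terms are absorbed by |w|^2, and |psi|^2 and |L psi|^2 keep the coefficient (\<alpha> -
  1)/4. On polynomials psi is explicit, since R L acts on a weight 1/2 generator L^k (g_11^a g_21^b)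
  as - (k + 1)^2; no elliptic equation has to be solved.\<close>

definition mat3 :: "real^3 \<Rightarrow> cmat2" where
  "mat3 c = (\<Sum>i\<in>UNIV. (c $ i) *\<^sub>R theta i)"

definition coord :: "cmat2 \<Rightarrow> real^3" where
  "coord A = (\<chi> i. metric_SU2 A (theta i))"

lemma theta_nth:
  "theta 1 $ 1 $ 1 = 0" "theta 1 $ 1 $ 2 = \<i> / 2" "theta 1 $ 2 $ 1 = \<i> / 2" "theta 1 $ 2 $ 2 = 0"
  "theta 2 $ 1 $ 1 = 0" "theta 2 $ 1 $ 2 = 1 / 2" "theta 2 $ 2 $ 1 = - 1 / 2" "theta 2 $ 2 $ 2 = 0"
  "theta 3 $ 1 $ 1 = \<i> / 2" "theta 3 $ 1 $ 2 = 0" "theta 3 $ 2 $ 1 = 0" "theta 3 $ 2 $ 2 = - \<i> / 2"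
  by (simp_all add: theta_def)

lemma matmul_nth: "(A ** B) $ i $ j = A $ i $ 1 * B $ 1 $ j + A $ i $ 2 * B $ 2 $ j" for A B :: cmat2
  by (simp add: matrix_matrix_mult_def sum_2)

lemma ctransp_nth [simp]: "ctransp A $ i $ j = cnj (A $ j $ i)"
  by (simp add: ctransp_def)

lemma cmat2_eq_iff: "A = B \<longleftrightarrow> A$1$1 = B$1$1 \<and> A$1$2 = B$1$2 \<and> A$2$1 = B$2$1 \<and> A$2$2 = B$2$2" for A B :: cmat2
  by (auto simp: vec_eq_iff forall_2)

lemma mat3_nth:
  "mat3 c $ 1 $ 1 = Complex 0 (c$3 / 2)" "mat3 c $ 1 $ 2 = Complex (c$2 / 2) (c$1 / 2)"
  "mat3 c $ 2 $ 1 = Complex (- c$2 / 2) (c$1 / 2)" "mat3 c $ 2 $ 2 = Complex 0 (- c$3 / 2)"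
  by (simp_all add: mat3_def sum_3 theta_nth complex_eq_iff)

lemma inner_cmat2: "A \<bullet> B = A$1$1 \<bullet> B$1$1 + A$1$2 \<bullet> B$1$2 + A$2$1 \<bullet> B$2$1 + A$2$2 \<bullet> B$2$2" for A B :: cmat2
  by (simp add: inner_vec_def sum_2)

lemma coord_nth:
  "coord A $ 1 = Im (A$1$2) + Im (A$2$1)" "coord A $ 2 = Re (A$1$2) - Re (A$2$1)"
  "coord A $ 3 = Im (A$1$1) - Im (A$2$2)"
  by (simp_all add: coord_def metric_SU2_def inner_cmat2 theta_nth inner_complex_def)

lemma vec3_eq_iff: "a = b \<longleftrightarrow> a$1 = b$1 \<and> a$2 = b$2 \<and> a$3 = b$3" for a b :: "real^3"
  by (auto simp: vec_eq_iff forall_3)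

lemma coord_mat3 [simp]: "coord (mat3 c) = c"
  by (simp add: vec3_eq_iff coord_nth mat3_nth)

lemma metric_mat3: "metric_SU2 (mat3 a) (mat3 b) = a \<bullet> b"
  by (simp add: metric_SU2_def inner_cmat2 mat3_nth inner_vec_def[of a b] sum_3 inner_complex_def)

lemma linear_coord: "bounded_linear coord"
  unfolding linear_conv_bounded_linear[symmetric]
  by (rule linearI) (simp_all add: vec3_eq_iff coord_nth algebra_simps)

lemma linear_mat3: "bounded_linear mat3"
  unfolding linear_conv_bounded_linear[symmetric]
  by (rule linearI) (simp_all add: cmat2_eq_iff mat3_nth complex_eq_iff field_simps)

text \<open>The minus sign belongs to the chosen basis, in which [theta 1, theta 2] = - theta 3. It
  is the source of the signs in \<open>lie_commutator\<close>, in \<open>lie_mframe\<close> and of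
  the Kaehler form.\<close>

lemma ad_mat3: "ad (mat3 a) (mat3 b) = mat3 (- cross3 a b)"
  by (simp add: ad_def cmat2_eq_iff mat3_nth matmul_nth complex_eq_iff cross3_simps)

lemma mat3_axis: "mat3 (axis i 1) = theta i"
  using exhaust_3[of i]
  by (auto simp: cmat2_eq_iff mat3_nth theta_nth complex_eq_iff axis_def)

section \<open>Entrywise description of su(2) and SU(2)\<close>

definition su2 :: "cmat2 set" where "su2 = range mat3"

lemma mat3_coord: "A \<in> su2 \<Longrightarrow> mat3 (coord A) = A"
  by (auto simp: su2_def)

lemma su2_iff: "A \<in> su2 \<longleftrightarrow> ctransp A = - A \<and> A$1$1 + A$2$2 = 0"
proof
  assume "ctransp A = - A \<and> A$1$1 + A$2$2 = 0"
  hence *: "cnj (A$1$1) = - A$1$1" "cnj (A$2$1) = - A$1$2" "cnj (A$2$2) = - A$2$2" "A$2$2 = - A$1$1"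
    by (simp_all add: cmat2_eq_iff add_eq_0_iff)
  have "mat3 (coord A) = A"
    unfolding cmat2_eq_iff mat3_nth coord_nth complex_eq_iff complex.sel
    using *[THEN arg_cong[of _ _ Re]] *[THEN arg_cong[of _ _ Im]] by auto
  thus "A \<in> su2" by (metis su2_def rangeI)
qed (auto simp: su2_def cmat2_eq_iff mat3_nth complex_eq_iff)

text \<open>Unitarity and determinant 1 determine the second column from the first, which is a point
  of the unit sphere of C^2. Compactness and the membership of explicit matrices are read off from
  this form.\<close>

lemma SU2_iff: "x \<in> SU2 \<longleftrightarrow>
   x$2$2 = cnj (x$1$1) \<and> x$1$2 = - cnj (x$2$1) \<and> (cmod (x$1$1))\<^sup>2 + (cmod (x$2$1))\<^sup>2 = 1"
proof
  assume "x \<in> SU2"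
  hence e: "x ** ctransp x = mat 1" and d: "x$1$1 * x$2$2 - x$1$2 * x$2$1 = 1"
    by (auto simp: SU2_def det_2)
  have e': "ctransp x ** x = mat 1"
    using e matrix_left_right_inverse by blast
  have 1: "x$1$1 * cnj (x$1$1) + x$1$2 * cnj (x$1$2) = 1" "x$1$1 * cnj (x$2$1) + x$1$2 * cnj (x$2$2) = 0"
     "x$2$1 * cnj (x$1$1) + x$2$2 * cnj (x$1$2) = 0"
    using e by (auto simp: cmat2_eq_iff matmul_nth mat_def)
  have 2: "cnj (x$1$1) * x$1$1 + cnj (x$2$1) * x$2$1 = 1"
    using e' by (auto simp: cmat2_eq_iff matmul_nth mat_def)
  have "x$2$2 = cnj (x$1$1)" using 1 d by algebra
  moreover have "x$2$1 = - cnj (x$1$2)" using 1 d by algebra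
  moreover have "of_real ((cmod (x$1$1))\<^sup>2 + (cmod (x$2$1))\<^sup>2) = (1::complex)"
    using 2 by (simp only: of_real_add complex_norm_square) (simp add: mult.commute)
  hence "(cmod (x$1$1))\<^sup>2 + (cmod (x$2$1))\<^sup>2 = 1" by (metis of_real_eq_1_iff)
  ultimately show "x$2$2 = cnj (x$1$1) \<and> x$1$2 = - cnj (x$2$1) \<and> (cmod (x$1$1))\<^sup>2 + (cmod (x$2$1))\<^sup>2 = 1"
    by simp
next
  assume a: "x$2$2 = cnj (x$1$1) \<and> x$1$2 = - cnj (x$2$1) \<and> (cmod (x$1$1))\<^sup>2 + (cmod (x$2$1))\<^sup>2 = 1"
  hence "of_real ((cmod (x$1$1))\<^sup>2 + (cmod (x$2$1))\<^sup>2) = (1::complex)" by simp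
  hence b: "x$1$1 * cnj (x$1$1) + x$2$1 * cnj (x$2$1) = 1"
    by (simp only: of_real_add complex_norm_square)
  show "x \<in> SU2" unfolding SU2_def using a b
    by (simp add: cmat2_eq_iff matmul_nth mat_def det_2 algebra_simps)
qed

lemma SU2_entries:
  assumes "x \<in> SU2"
  shows "x$2$2 = cnj (x$1$1)" "x$1$2 = - cnj (x$2$1)"
    "x$1$1 * cnj (x$1$1) + x$2$1 * cnj (x$2$1) = 1"
proof -
  show "x$2$2 = cnj (x$1$1)" "x$1$2 = - cnj (x$2$1)" using assms by (auto simp: SU2_iff)
  have "of_real ((cmod (x$1$1))\<^sup>2 + (cmod (x$2$1))\<^sup>2) = (1::complex)"
    using assms by (simp add: SU2_iff)
  thus "x$1$1 * cnj (x$1$1) + x$2$1 * cnj (x$2$1) = 1"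
    by (simp only: of_real_add complex_norm_square)
qed

lemma SU2_inverse:
  assumes "x \<in> SU2" shows "x ** ctransp x = mat 1" "ctransp x ** x = mat 1"
  using assms matrix_left_right_inverse by (auto simp: SU2_def)

lemma ctransp_mult: "ctransp (A ** B) = ctransp B ** ctransp A"
  by (simp add: cmat2_eq_iff matmul_nth mult.commute)

lemma ctransp_ctransp [simp]: "ctransp (ctransp A) = A"
  by (simp add: cmat2_eq_iff)

lemma ctransp_mat1 [simp]: "ctransp (mat 1) = mat 1"
  by (simp add: cmat2_eq_iff mat_def)

lemma SU2_mult: assumes "x \<in> SU2" "y \<in> SU2" shows "x ** y \<in> SU2"
proof -
  have "(x ** y) ** ctransp (x ** y) = x ** (y ** ctransp y) ** ctransp x"
    by (simp add: ctransp_mult matrix_mul_assoc)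
  thus ?thesis using assms by (simp add: SU2_def det_mul)
qed

lemma SU2_ctransp: "x \<in> SU2 \<Longrightarrow> ctransp x \<in> SU2"
  by (simp add: SU2_iff)

lemma SU2_mat1: "mat 1 \<in> SU2"
  by (simp add: SU2_iff mat_def)

lemma bounded_linear_nth2: "bounded_linear (\<lambda>x::cmat2. x $ i $ j)"
  by (intro bounded_linear_compose[OF bounded_linear_vec_nth] bounded_linear_vec_nth)

lemma compact_SU2: "compact SU2"
proof -
  have eq: "SU2 = {x. x$2$2 = cnj (x$1$1) \<and> x$1$2 = - cnj (x$2$1) \<and> (cmod (x$1$1))\<^sup>2 + (cmod (x$2$1))\<^sup>2 = 1}"
    using SU2_iff by blast
  have "closed SU2" unfolding eq
    by (intro closed_Collect_conj closed_Collect_eq continuous_intros)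
  moreover have "norm x = sqrt 2" if "x \<in> SU2" for x
    using SU2_iff[of x] that
    by (simp add: norm_eq_sqrt_inner inner_cmat2 power2_norm_eq_inner inner_complex_def cmod_power2)
  hence "bounded SU2" by (metis boundedI order_refl)
  ultimately show ?thesis by (simp add: compact_eq_bounded_closed)
qed

lemma inner_SU2_right:
  fixes A B x :: cmat2
  assumes "x \<in> SU2" shows "(A ** x) \<bullet> (B ** x) = A \<bullet> B"
proof -
  have *: "A \<bullet> B = Re ((A ** ctransp B)$1$1 + (A ** ctransp B)$2$2)" for A B :: cmat2
    by (simp add: inner_cmat2 matmul_nth inner_complex_def)
  have "(A ** x) ** ctransp (B ** x) = A ** (x ** ctransp x) ** ctransp B"
    by (simp add: ctransp_mult matrix_mul_assoc)
  hence "(A ** x) ** ctransp (B ** x) = A ** ctransp B" by (simp add: SU2_inverse assms)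
  thus ?thesis by (simp only: *)
qed

lemma inner_SU2_left:
  fixes A B x :: cmat2
  assumes "x \<in> SU2" shows "(x ** A) \<bullet> (x ** B) = A \<bullet> B"
proof -
  have *: "A \<bullet> B = Re ((ctransp A ** B)$1$1 + (ctransp A ** B)$2$2)" for A B :: cmat2
    by (simp add: inner_cmat2 matmul_nth inner_complex_def)
  have "ctransp (x ** A) ** (x ** B) = ctransp A ** (ctransp x ** x) ** B"
    by (simp add: ctransp_mult matrix_mul_assoc)
  hence "ctransp (x ** A) ** (x ** B) = ctransp A ** B" by (simp add: SU2_inverse assms)
  thus ?thesis by (simp only: *)
qed

definition conj_by :: "cmat2 \<Rightarrow> cmat2 \<Rightarrow> cmat2" where
  "conj_by x A = x ** A ** ctransp x"

lemma metric_conj_by: "x \<in> SU2 \<Longrightarrow> metric_SU2 (conj_by x A) (conj_by x B) = metric_SU2 A B"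
  by (simp add: metric_SU2_def conj_by_def inner_SU2_left inner_SU2_right SU2_ctransp)

lemma conj_by_su2: assumes "x \<in> SU2" "A \<in> su2" shows "conj_by x A \<in> su2"
proof -
  have "ctransp (conj_by x A) = conj_by x (ctransp A)"
    by (simp add: conj_by_def ctransp_mult matrix_mul_assoc)
  moreover have "conj_by x (- A) = - conj_by x A"
    by (simp add: cmat2_eq_iff matmul_nth conj_by_def algebra_simps)
  moreover have "conj_by x A $1$1 + conj_by x A $2$2 = A$1$1 + A$2$2"
  proof -
    have "trace (conj_by x A) = trace (ctransp x ** x ** A)"
      by (metis conj_by_def matrix_mul_assoc trace_mul_sym)
    thus ?thesis using SU2_inverse(2)[OF assms(1)] by (simp add: trace_def sum_2)
  qed
  ultimately show ?thesis using assms(2) by (simp add: su2_iff)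
qed

lemma conj_by_inverse:
  assumes "x \<in> SU2"
  shows "conj_by (ctransp x) (conj_by x A) = A" "conj_by x (conj_by (ctransp x) A) = A"
proof -
  have "conj_by (ctransp x) (conj_by x A) = (ctransp x ** x) ** A ** (ctransp x ** x)"
    "conj_by x (conj_by (ctransp x) A) = (x ** ctransp x) ** A ** (x ** ctransp x)"
    by (simp_all add: conj_by_def matrix_mul_assoc)
  thus "conj_by (ctransp x) (conj_by x A) = A" "conj_by x (conj_by (ctransp x) A) = A"
    by (simp_all add: SU2_inverse assms)
qed

lemma conj_by_mult: "conj_by (x ** y) A = conj_by x (conj_by y A)"
  by (simp add: conj_by_def ctransp_mult matrix_mul_assoc)

lemma conj_by_mul: assumes "x \<in> SU2" shows "conj_by x (A ** B) = conj_by x A ** conj_by x B"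
proof -
  have "conj_by x A ** conj_by x B = x ** A ** (ctransp x ** x) ** B ** ctransp x"
    by (simp add: conj_by_def matrix_mul_assoc)
  thus ?thesis by (simp add: SU2_inverse assms conj_by_def matrix_mul_assoc)
qed

lemma linear_conj_by: "linear (conj_by x)"
  by (rule linearI) (simp_all add: conj_by_def cmat2_eq_iff matmul_nth algebra_simps)

lemma conj_by_ad: "x \<in> SU2 \<Longrightarrow> conj_by x (ad A B) = ad (conj_by x A) (conj_by x B)"
  by (simp add: ad_def conj_by_mul[symmetric] linear_diff[OF linear_conj_by])

text \<open>The double cover SU(2) -> SO(3): the adjoint action in the basis
  \<open>theta\<close>.\<close>

definition rot :: "cmat2 \<Rightarrow> real^3 \<Rightarrow> real^3" where
  "rot x c = coord (conj_by x (mat3 c))"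

lemma mat3_rot: "x \<in> SU2 \<Longrightarrow> mat3 (rot x c) = conj_by x (mat3 c)"
  unfolding rot_def by (intro mat3_coord conj_by_su2) (auto simp: su2_def)

lemma rot_inner: "x \<in> SU2 \<Longrightarrow> rot x a \<bullet> rot x b = a \<bullet> b"
  by (simp add: metric_mat3[symmetric] mat3_rot metric_conj_by)

text \<open>Conjugation is an automorphism of the bracket, and by \<open>ad_mat3\<close> the bracket
  is minus the cross product.\<close>

lemma rot_cross: assumes "x \<in> SU2" shows "cross3 (rot x a) (rot x b) = rot x (cross3 a b)"
proof -
  have "mat3 (- cross3 (rot x a) (rot x b)) = mat3 (- rot x (cross3 a b))"
    using assms
    by (simp add: ad_mat3[symmetric] mat3_rot conj_by_ad[symmetric])
       (simp add: ad_mat3 bounded_linear.linear[OF linear_mat3, THEN linear_neg] linear_neg[OF linear_conj_by] mat3_rot)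
  thus ?thesis by (metis coord_mat3 neg_equal_iff_equal)
qed


section \<open>Smooth functions near SU(2) and left-invariant derivatives\<close>

definition Cinf :: "'a::real_normed_vector set \<Rightarrow> ('a \<Rightarrow> 'b::real_normed_vector) \<Rightarrow> bool" where
  "Cinf U f \<longleftrightarrow> (\<forall>k. Ck_on k U f)"

lemma frechet_derivative_cong_open:
  assumes "open U" "x \<in> U" "\<And>y. y \<in> U \<Longrightarrow> f y = g y"
  shows "frechet_derivative f (at x) = frechet_derivative g (at x)"
proof -
  have "(f has_derivative D) (at x) \<longleftrightarrow> (g has_derivative D) (at x)" for D
    using assms by (metis has_derivative_transform_within_open)
  thus ?thesis by (simp add: frechet_derivative_def)
qed

lemma differentiable_cong_open:
  assumes "open U" "x \<in> U" "\<And>y. y \<in> U \<Longrightarrow> f y = g y"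
  shows "f differentiable (at x) \<longleftrightarrow> g differentiable (at x)"
  using assms unfolding differentiable_def by (metis has_derivative_transform_within_open)

lemma Ck_on_cong:
  assumes "open U" "\<And>y. y \<in> U \<Longrightarrow> f y = g y"
  shows "Ck_on k U f \<longleftrightarrow> Ck_on k U g"
  using assms(2)
proof (induction k arbitrary: f g)
  case 0
  thus ?case by (auto cong: continuous_on_cong)
next
  case (Suc k)
  have "Ck_on k U (\<lambda>x. frechet_derivative f (at x) v) = Ck_on k U (\<lambda>x. frechet_derivative g (at x) v)" for v
    by (rule Suc.IH) (metis assms(1) frechet_derivative_cong_open Suc.prems)
  moreover have "f differentiable (at x) \<longleftrightarrow> g differentiable (at x)" if "x \<in> U" for x
    using differentiable_cong_open[OF assms(1) that, of f g] Suc.prems by blast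
  ultimately show ?case by simp
qed

lemma Ck_on_Suc_imp: "Ck_on (Suc k) U f \<Longrightarrow> Ck_on k U f"
proof (induction k arbitrary: f)
  case 0
  thus ?case
    by (auto intro!: differentiable_imp_continuous_on differentiable_at_imp_differentiable_on)
qed auto

lemma frechet_eq: "(f has_derivative D) (at x) \<Longrightarrow> frechet_derivative f (at x) = D"
  using frechet_derivative_at by metis

text \<open>Lets an explicit derivative replace the chosen one on the open set; the closure rules
  below are inductions with this as their step.\<close>

lemma Ck_on_SucI:
  assumes "open U" "\<And>x. x \<in> U \<Longrightarrow> (f has_derivative D x) (at x)" "\<And>v. Ck_on k U (\<lambda>x. D x v)"
  shows "Ck_on (Suc k) U f"
proof -
  have "Ck_on k U (\<lambda>x. frechet_derivative f (at x) v) = Ck_on k U (\<lambda>x. D x v)" for v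
    by (rule Ck_on_cong[OF assms(1)]) (metis assms(2) frechet_eq)
  thus ?thesis using assms by (auto simp: differentiable_def)
qed

lemma Ck_on_SucD:
  assumes "Ck_on (Suc k) U f" "x \<in> U"
  shows "(f has_derivative frechet_derivative f (at x)) (at x)"
  using assms by (simp add: frechet_derivative_works)

lemma Ck_on_const: "open U \<Longrightarrow> Ck_on k U (\<lambda>x. c)"
proof (induction k arbitrary: c)
  case (Suc k)
  thus ?case by (intro Ck_on_SucI[where D="\<lambda>_ _. 0"]) auto
qed simp

lemma Ck_on_linear: assumes "open U" "bounded_linear L" shows "Ck_on k U L"
proof (cases k)
  case 0
  thus ?thesis using assms by (simp add: linear_continuous_on)
next
  case (Suc k)
  show ?thesis unfolding Suc
    using assms by (intro Ck_on_SucI[where D="\<lambda>_. L"] Ck_on_const bounded_linear_imp_has_derivative)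
qed

lemma Ck_on_add:
  assumes "open U" "Ck_on k U f" "Ck_on k U g" shows "Ck_on k U (\<lambda>x. f x + g x)"
  using assms(2,3)
proof (induction k arbitrary: f g)
  case (Suc k)
  show ?case
    by (rule Ck_on_SucI[OF assms(1), OF has_derivative_add[OF Suc.prems[THEN Ck_on_SucD]]])
       (use Suc in auto)
qed (auto intro: continuous_intros)

lemma Ck_on_bilinear:
  assumes "open U" "bounded_bilinear B" "Ck_on k U f" "Ck_on k U g"
  shows "Ck_on k U (\<lambda>x. B (f x) (g x))"
  using assms(3,4)
proof (induction k arbitrary: f g)
  case 0
  thus ?case using bounded_bilinear.continuous_on[OF assms(2)] by auto
next
  case (Suc k)
  show ?case
    by (rule Ck_on_SucI[OF assms(1), OF bounded_bilinear.FDERIV[OF assms(2) Suc.prems[THEN Ck_on_SucD]]])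
       (use Suc Suc.prems[THEN Ck_on_Suc_imp] in \<open>auto intro!: Ck_on_add assms Suc.IH\<close>)
qed

text \<open>Affine inner maps have a constant derivative, so the induction stays within the same
  form. They cover what is composed later: the slices of a family at a fixed parameter and the
  projection to the SU(2) factor.\<close>

lemma Ck_on_compose_affine:
  assumes "open U" "bounded_linear L" "Ck_on k U f"
  shows "Ck_on k ((\<lambda>x. c + L x) -` U) (\<lambda>x. f (c + L x))"
  using assms(3)
proof (induction k arbitrary: f)
  case 0
  have "continuous_on ((\<lambda>x. c + L x) -` U) (f \<circ> (\<lambda>x. c + L x))"
    using 0 by (intro continuous_on_compose continuous_on_add continuous_on_const linear_continuous_on[OF assms(2)])
      (auto elim: continuous_on_subset)
  thus ?case by (simp add: o_def)
next
  case (Suc k)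
  have o: "open ((\<lambda>x. c + L x) -` U)"
    by (intro open_vimage[OF assms(1)] continuous_on_add continuous_on_const linear_continuous_on[OF assms(2)])
  show ?case
  proof (rule Ck_on_SucI[OF o])
    fix x assume "x \<in> (\<lambda>x. c + L x) -` U"
    hence f: "(f has_derivative frechet_derivative f (at (c + L x))) (at (c + L x))"
      using Suc.prems Ck_on_SucD by auto
    have "((\<lambda>x. c + L x) has_derivative L) (at x)"
      using has_derivative_add[OF has_derivative_const[of c] bounded_linear_imp_has_derivative[OF assms(2)]] by simp
    from has_derivative_compose[OF this f]
    show "((\<lambda>x. f (c + L x)) has_derivative (\<lambda>v. frechet_derivative f (at (c + L x)) (L v))) (at x)" .
  next
    fix v show "Ck_on k ((\<lambda>x. c + L x) -` U) (\<lambda>x. frechet_derivative f (at (c + L x)) (L v))"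
      using Suc by auto
  qed
qed

lemma Ck_on_subset: "Ck_on k U f \<Longrightarrow> V \<subseteq> U \<Longrightarrow> Ck_on k V f"
  by (induction k arbitrary: f) (auto elim: continuous_on_subset)

text \<open>The derivative of 1/f is built from 1/f and the derivative of f by products, so the
  induction closes. Reciprocals occur as normalising factor in
  \<open>hopf_variation_exists\<close>.\<close>

lemma Ck_on_inverse:
  fixes f :: "'a::real_normed_vector \<Rightarrow> real"
  assumes "open U" "\<And>x. x \<in> U \<Longrightarrow> f x \<noteq> 0" "Ck_on k U f"
  shows "Ck_on k U (\<lambda>x. inverse (f x))"
  using assms(3)
proof (induction k)
  case 0
  thus ?case using assms(2) by (auto intro: continuous_intros)
next
  case (Suc k)
  have d: "((\<lambda>x. inverse (f x)) has_derivative (\<lambda>h. - (inverse (f x) * frechet_derivative f (at x) h * inverse (f x)))) (at x)"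
    if "x \<in> U" for x
    by (rule Deriv.has_derivative_inverse[OF assms(2)[OF that] Ck_on_SucD[OF Suc.prems that]])
  have c: "Ck_on k U (\<lambda>x. (- 1) * ((inverse (f x) * frechet_derivative f (at x) h) * inverse (f x)))" for h
    by (intro Ck_on_bilinear[OF assms(1) bounded_bilinear_mult] Ck_on_const assms Suc.IH)
       (use Suc.prems Ck_on_Suc_imp in auto)
  show ?case using c by (intro Ck_on_SucI[OF assms(1) d]) auto
qed

lemma Cinf_const: "open U \<Longrightarrow> Cinf U (\<lambda>x. c)"
  and Cinf_linear: "open U \<Longrightarrow> bounded_linear L \<Longrightarrow> Cinf U L"
  and Cinf_add: "open U \<Longrightarrow> Cinf U f \<Longrightarrow> Cinf U g \<Longrightarrow> Cinf U (\<lambda>x. f x + g x)"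
  and Cinf_bilinear: "open U \<Longrightarrow> bounded_bilinear B \<Longrightarrow> Cinf U f \<Longrightarrow> Cinf U g' \<Longrightarrow> Cinf U (\<lambda>x. B (f x) (g' x))"
  and Cinf_compose_affine: "open V \<Longrightarrow> bounded_linear L' \<Longrightarrow> Cinf V h \<Longrightarrow> Cinf ((\<lambda>x. c' + L' x) -` V) (\<lambda>x. h (c' + L' x))"
  and Cinf_subset: "Cinf U f \<Longrightarrow> W \<subseteq> U \<Longrightarrow> Cinf W f"
  and Cinf_inverse: "open U \<Longrightarrow> (\<And>x. x \<in> U \<Longrightarrow> r x \<noteq> (0::real)) \<Longrightarrow> Cinf U r \<Longrightarrow> Cinf U (\<lambda>x. inverse (r x))"
  by (simp_all add: Cinf_def Ck_on_const Ck_on_linear Ck_on_add Ck_on_bilinear Ck_on_compose_affine Ck_on_inverse)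
     (metis Ck_on_subset)

lemma Cinf_cong: "open U \<Longrightarrow> (\<And>y. y \<in> U \<Longrightarrow> f y = g y) \<Longrightarrow> Cinf U f \<longleftrightarrow> Cinf U g"
  unfolding Cinf_def using Ck_on_cong[of U f g] by blast

lemma Cinf_sum:
  assumes "open U" "\<And>i. i \<in> I \<Longrightarrow> Cinf U (f i)" shows "Cinf U (\<lambda>x. \<Sum>i\<in>I. f i x)"
  using assms by (induction I rule: infinite_finite_induct) (auto intro: Cinf_const Cinf_add)

lemma Cinf_apply_linear: "open U \<Longrightarrow> bounded_linear L \<Longrightarrow> Cinf U f \<Longrightarrow> Cinf U (\<lambda>x. L (f x))"
proof -
  assume U: "open U" and L: "bounded_linear L" and f: "Cinf U f"
  have "Ck_on k U (\<lambda>x. L (f x))" for k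
    using f[unfolded Cinf_def, rule_format, of k]
  proof (induction k arbitrary: f)
    case 0
    thus ?case using bounded_linear.continuous_on[OF L] by auto
  next
    case (Suc k)
    show ?case
      by (rule Ck_on_SucI[OF U, OF bounded_linear.has_derivative[OF L Ck_on_SucD[OF Suc.prems]]])
         (use Suc in auto)
  qed
  thus ?thesis by (simp add: Cinf_def)
qed

lemma Cinf_has_derivative:
  "Cinf U f \<Longrightarrow> x \<in> U \<Longrightarrow> (f has_derivative frechet_derivative f (at x)) (at x)"
  unfolding Cinf_def using Ck_on_SucD by blast

lemma Cinf_continuous_on: "Cinf U f \<Longrightarrow> continuous_on U f"
  unfolding Cinf_def using Ck_on.simps(1) by blast

lemma Cinf_frechet: "Cinf U f \<Longrightarrow> Cinf U (\<lambda>x. frechet_derivative f (at x) v)"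
  unfolding Cinf_def using Ck_on.simps(2)[of _ U f] by blast

lemma frechet_basis_sum:
  fixes f :: "'a::euclidean_space \<Rightarrow> 'b::real_normed_vector"
  assumes "(f has_derivative D) (at x)" shows "D v = (\<Sum>b\<in>Basis. (v \<bullet> b) *\<^sub>R D b)"
proof -
  have l: "linear D" using assms has_derivative_linear by blast
  have "D v = D (\<Sum>b\<in>Basis. (v \<bullet> b) *\<^sub>R b)" by (simp add: euclidean_representation)
  thus ?thesis by (simp add: linear_sum[OF l] linear_scale[OF l])
qed

text \<open>\<open>Ck_on\<close> speaks about derivatives in fixed directions. Expanding the moving
  direction in a basis reduces to those, with smooth coefficients.\<close>

lemma Cinf_frechet_field:
  fixes f :: "'a::euclidean_space \<Rightarrow> 'b::real_normed_vector"
  assumes U: "open U" and f: "Cinf U f" and L: "Cinf U L"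
  shows "Cinf U (\<lambda>x. frechet_derivative f (at x) (L x))"
proof -
  have "frechet_derivative f (at x) (L x) = (\<Sum>b\<in>Basis. (L x \<bullet> b) *\<^sub>R frechet_derivative f (at x) b)"
    if "x \<in> U" for x
    by (rule frechet_basis_sum[OF Cinf_has_derivative[OF f that]])
  moreover have "Cinf U (\<lambda>x. (\<Sum>b\<in>Basis. (L x \<bullet> b) *\<^sub>R frechet_derivative f (at x) b))"
    by (intro Cinf_sum U Cinf_bilinear[OF U bounded_bilinear_scaleR] Cinf_bilinear[OF U bounded_bilinear_inner]
        Cinf_const Cinf_frechet f L)
  ultimately show ?thesis by (subst Cinf_cong[OF U])
qed

section \<open>Symmetry of second derivatives\<close>

lemma second_difference_mvt:
  fixes f :: "'a::real_normed_vector \<Rightarrow> real"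
  assumes U: "open U" and f: "Cinf U f" and h: "h > 0"
    and box: "\<And>a b. a \<in> {0..h} \<Longrightarrow> b \<in> {0..h} \<Longrightarrow> x + a *\<^sub>R v + b *\<^sub>R w \<in> U"
  obtains a b where "a \<in> {0..h}" "b \<in> {0..h}"
    "f (x + h *\<^sub>R v + h *\<^sub>R w) - f (x + h *\<^sub>R v) - f (x + h *\<^sub>R w) + f x
     = h * h * frechet_derivative (\<lambda>y. frechet_derivative f (at y) v) (at (x + a *\<^sub>R v + b *\<^sub>R w)) w"
proof -
  have d: "((\<lambda>a. g (x + a *\<^sub>R v + b *\<^sub>R w)) has_real_derivative frechet_derivative g (at (x + a *\<^sub>R v + b *\<^sub>R w)) v) (at a)"
   and d': "((\<lambda>b. g (x + a *\<^sub>R v + b *\<^sub>R w)) has_real_derivative frechet_derivative g (at (x + a *\<^sub>R v + b *\<^sub>R w)) w) (at b)"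
    if "Cinf U g" "a \<in> {0..h}" "b \<in> {0..h}" for g :: "'a \<Rightarrow> real" and a b
  proof -
    let ?p = "x + a *\<^sub>R v + b *\<^sub>R w"
    have D: "(g has_derivative frechet_derivative g (at ?p)) (at ?p)"
      using Cinf_has_derivative that box by blast
    have l: "linear (frechet_derivative g (at ?p))" using D has_derivative_linear by blast
    have "((\<lambda>a. x + a *\<^sub>R v + b *\<^sub>R w) has_derivative (\<lambda>t. t *\<^sub>R v)) (at a)"
      "((\<lambda>b. x + a *\<^sub>R v + b *\<^sub>R w) has_derivative (\<lambda>t. t *\<^sub>R w)) (at b)"
      by (auto intro!: derivative_eq_intros)
    from this[THEN has_derivative_compose, OF D]
    show "((\<lambda>a. g (x + a *\<^sub>R v + b *\<^sub>R w)) has_real_derivative frechet_derivative g (at ?p) v) (at a)"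
     "((\<lambda>b. g (x + a *\<^sub>R v + b *\<^sub>R w)) has_real_derivative frechet_derivative g (at ?p) w) (at b)"
      by (simp_all add: has_field_derivative_def linear_scale[OF l] mult_commute_abs)
  qed
  define \<phi> where "\<phi> a = f (x + a *\<^sub>R v + h *\<^sub>R w) - f (x + a *\<^sub>R v + 0 *\<^sub>R w)" for a
  define f' where "f' y = frechet_derivative f (at y) v" for y
  have f': "Cinf U f'" unfolding f'_def by (rule Cinf_frechet[OF f])
  have "\<exists>a. 0 < a \<and> a < h \<and> \<phi> h - \<phi> 0 = (h - 0) * (f' (x + a *\<^sub>R v + h *\<^sub>R w) - f' (x + a *\<^sub>R v + 0 *\<^sub>R w))"
    unfolding \<phi>_def f'_def
    by (rule MVT2[OF h]) (intro DERIV_diff d f; use h in auto)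
  then obtain a where a: "0 < a" "a < h"
    "\<phi> h - \<phi> 0 = h * (f' (x + a *\<^sub>R v + h *\<^sub>R w) - f' (x + a *\<^sub>R v + 0 *\<^sub>R w))" by auto
  have "\<exists>b. 0 < b \<and> b < h \<and> f' (x + a *\<^sub>R v + h *\<^sub>R w) - f' (x + a *\<^sub>R v + 0 *\<^sub>R w)
      = (h - 0) * frechet_derivative f' (at (x + a *\<^sub>R v + b *\<^sub>R w)) w"
    by (rule MVT2[OF h]) (rule d'[OF f']; use a in auto)
  then obtain b where b: "0 < b" "b < h" "f' (x + a *\<^sub>R v + h *\<^sub>R w) - f' (x + a *\<^sub>R v + 0 *\<^sub>R w)
      = h * frechet_derivative f' (at (x + a *\<^sub>R v + b *\<^sub>R w)) w" by auto
  show ?thesis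
    by (rule that[of a b]) (use a b in \<open>auto simp: \<phi>_def f'_def[abs_def]\<close>)
qed

lemma second_frechet_symmetric_real:
  fixes f :: "'a::real_normed_vector \<Rightarrow> real"
  assumes U: "open U" and f: "Cinf U f" and x: "x \<in> U"
  shows "frechet_derivative (\<lambda>y. frechet_derivative f (at y) v) (at x) w
       = frechet_derivative (\<lambda>y. frechet_derivative f (at y) w) (at x) v"
proof -
  define F where "F v w y = frechet_derivative (\<lambda>y. frechet_derivative f (at y) v) (at y) w" for v w y
  have cF: "continuous_on U (F v w)" for v w
    unfolding F_def by (intro Cinf_continuous_on Cinf_frechet f)
  \<comment> \<open>The second difference over the parallelogram with sides \<open>h v\<close> and
    \<open>h w\<close> is symmetric in \<open>v\<close> and \<open>w\<close>. Expressed by the mean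
    value theorem in both orders, it equals either mixed derivative at some point close to
    \<open>x\<close>.\<close>
  have "\<bar>F v w x - F w v x\<bar> \<le> e" if e: "e > 0" for e
  proof -
    have "\<exists>d>0. \<forall>y. dist y x < d \<longrightarrow> y \<in> U \<and> dist (F p q y) (F p q x) < e / 2" for p q
    proof -
      have "isCont (F p q) x" using cF U x by (simp add: continuous_on_eq_continuous_at)
      then obtain d where d: "d > 0" "\<And>y. dist y x < d \<Longrightarrow> dist (F p q y) (F p q x) < e / 2"
        using e unfolding continuous_at_eps_delta by (metis half_gt_zero)
      obtain d' where "d' > 0" "\<And>y. dist y x < d' \<Longrightarrow> y \<in> U" using U x by (metis open_dist)
      with d show ?thesis by (intro exI[of _ "min d d'"]) auto
    qed
    then obtain d1 d2 where d: "d1 > 0" "d2 > 0"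
      "\<And>y. dist y x < d1 \<Longrightarrow> y \<in> U \<and> dist (F v w y) (F v w x) < e / 2"
      "\<And>y. dist y x < d2 \<Longrightarrow> dist (F w v y) (F w v x) < e / 2" by metis
    define d where "d = min d1 d2"
    \<comment> \<open>Keeps the whole parallelogram within distance d/2 of \<open>x\<close>; the
      summand 1 guards against \<open>v = w = 0\<close>.\<close>
    define h where "h = d / (2 * (norm v + norm w + 1))"
    have dpos: "d > 0" using d by (simp add: d_def)
    have np: "norm v + norm w + 1 > 0" by (smt (verit) norm_ge_zero)
    have h: "h > 0" using dpos np by (simp add: h_def)
    have near: "dist (x + a *\<^sub>R v + b *\<^sub>R w) x < d" if "a \<in> {0..h}" "b \<in> {0..h}" for a b
    proof -
      have "dist (x + a *\<^sub>R v + b *\<^sub>R w) x = norm (a *\<^sub>R v + b *\<^sub>R w)" by (simp add: dist_norm algebra_simps)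
      also have "\<dots> \<le> a * norm v + b * norm w"
        using that norm_triangle_ineq[of "a *\<^sub>R v" "b *\<^sub>R w"] by simp
      also have "\<dots> \<le> h * norm v + h * norm w" using that by (intro add_mono mult_right_mono) auto
      also have "\<dots> \<le> h * (norm v + norm w + 1)" using h by (simp add: algebra_simps)
      also have "\<dots> = d / 2" using np unfolding h_def by (simp add: divide_simps)
      finally show ?thesis using dpos by simp
    qed
    have box: "x + a *\<^sub>R v + b *\<^sub>R w \<in> U" if "a \<in> {0..h}" "b \<in> {0..h}" for a b
      using near[OF that] d(3) by (simp add: d_def)
    have box': "x + a *\<^sub>R w + b *\<^sub>R v \<in> U" if "a \<in> {0..h}" "b \<in> {0..h}" for a b
      using box[OF that(2,1)] by (simp add: add_ac)
    obtain a b where 1: "a \<in> {0..h}" "b \<in> {0..h}"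
      "f (x + h *\<^sub>R v + h *\<^sub>R w) - f (x + h *\<^sub>R v) - f (x + h *\<^sub>R w) + f x = h * h * F v w (x + a *\<^sub>R v + b *\<^sub>R w)"
      unfolding F_def using second_difference_mvt[OF U f h box] by blast
    obtain a' b' where 2: "a' \<in> {0..h}" "b' \<in> {0..h}"
      "f (x + h *\<^sub>R w + h *\<^sub>R v) - f (x + h *\<^sub>R w) - f (x + h *\<^sub>R v) + f x = h * h * F w v (x + a' *\<^sub>R w + b' *\<^sub>R v)"
      unfolding F_def using second_difference_mvt[OF U f h box'] by blast
    have eq: "x + s *\<^sub>R w + t *\<^sub>R v = x + t *\<^sub>R v + s *\<^sub>R w" for s t by (simp add: add_ac)
    have "h * h * F v w (x + a *\<^sub>R v + b *\<^sub>R w) = h * h * F w v (x + a' *\<^sub>R w + b' *\<^sub>R v)"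
      using 1(3) 2(3) unfolding eq[of h h] by linarith
    hence "F v w (x + a *\<^sub>R v + b *\<^sub>R w) = F w v (x + b' *\<^sub>R v + a' *\<^sub>R w)"
      using h unfolding eq[of a' b'] by simp
    moreover have "dist (F v w (x + a *\<^sub>R v + b *\<^sub>R w)) (F v w x) < e / 2"
      using near[OF 1(1,2)] d(3) by (simp add: d_def)
    moreover have "dist (F w v (x + b' *\<^sub>R v + a' *\<^sub>R w)) (F w v x) < e / 2"
      using near[OF 2(2,1)] d(4) by (simp add: d_def)
    ultimately show ?thesis by (simp only: dist_real_def)
  qed
  hence "\<bar>F v w x - F w v x\<bar> \<le> 0" by (rule field_le_epsilon) simp
  thus ?thesis by (simp add: F_def)
qed

lemma frechet_apply_linear:
  assumes "bounded_linear L" "(f has_derivative D) (at x)"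
  shows "frechet_derivative (\<lambda>y. L (f y)) (at x) v = L (D v)"
  by (metis assms bounded_linear.has_derivative frechet_eq)

text \<open>Pairing with fixed vectors reduces this to real values, for which the mean value theorem
  is available.\<close>

lemma second_frechet_symmetric:
  fixes f :: "'a::real_normed_vector \<Rightarrow> 'b::real_inner"
  assumes U: "open U" and f: "Cinf U f" and x: "x \<in> U"
  shows "frechet_derivative (\<lambda>y. frechet_derivative f (at y) v) (at x) w
       = frechet_derivative (\<lambda>y. frechet_derivative f (at y) w) (at x) v"
proof -
  have "frechet_derivative (\<lambda>y. frechet_derivative f (at y) v) (at x) w \<bullet> b
       = frechet_derivative (\<lambda>y. frechet_derivative f (at y) w) (at x) v \<bullet> b" for b
  proof -
    note L = bounded_linear_inner_left[of b]
    have 1: "frechet_derivative (\<lambda>y. f y \<bullet> b) (at y) p = frechet_derivative f (at y) p \<bullet> b" if "y \<in> U" for y p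
      using frechet_apply_linear[OF L Cinf_has_derivative[OF f that]] .
    have "frechet_derivative (\<lambda>y. frechet_derivative (\<lambda>y. f y \<bullet> b) (at y) p) (at x) q
        = frechet_derivative (\<lambda>y. frechet_derivative f (at y) p) (at x) q \<bullet> b" for p q
      by (subst frechet_derivative_cong_open[OF U x 1])
         (auto intro!: frechet_apply_linear[OF L] Cinf_has_derivative[OF Cinf_frechet[OF f] x])
    with second_frechet_symmetric_real[OF U Cinf_apply_linear[OF U L f] x] show ?thesis by metis
  qed
  thus ?thesis by (metis vector_eq_rdot)
qed

text \<open>Product rule for the direction \<open>L y\<close>. By symmetry the second-order part
  depends on \<open>L x\<close> and \<open>w\<close> symmetrically, so in a commutator of two fields
  only the terms with a derivative of the direction survive.\<close>

lemma frechet_frechet_field: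
  fixes f :: "'a::euclidean_space \<Rightarrow> 'b::real_inner"
  assumes U: "open U" and f: "Cinf U f" and x: "x \<in> U" and L: "bounded_linear L"
  shows "frechet_derivative (\<lambda>y. frechet_derivative f (at y) (L y)) (at x) w
       = frechet_derivative f (at x) (L w) + frechet_derivative (\<lambda>y. frechet_derivative f (at y) w) (at x) (L x)"
proof -
  note rep = frechet_basis_sum
  note D = Cinf_has_derivative[OF f] and D2 = Cinf_has_derivative[OF Cinf_frechet[OF f]]
  have "((\<lambda>y. \<Sum>b\<in>Basis. (L y \<bullet> b) *\<^sub>R frechet_derivative f (at y) b) has_derivative
      (\<lambda>w. \<Sum>b\<in>Basis. (L x \<bullet> b) *\<^sub>R frechet_derivative (\<lambda>y. frechet_derivative f (at y) b) (at x) w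
         + (L w \<bullet> b) *\<^sub>R frechet_derivative f (at x) b)) (at x)"
    by (intro has_derivative_sum has_derivative_scaleR has_derivative_inner_left D2 x
        bounded_linear_imp_has_derivative L)
  hence "frechet_derivative (\<lambda>y. \<Sum>b\<in>Basis. (L y \<bullet> b) *\<^sub>R frechet_derivative f (at y) b) (at x) w
     = (\<Sum>b\<in>Basis. (L x \<bullet> b) *\<^sub>R frechet_derivative (\<lambda>y. frechet_derivative f (at y) b) (at x) w
         + (L w \<bullet> b) *\<^sub>R frechet_derivative f (at x) b)"
    by (simp add: frechet_eq)
  also have "\<dots> = (\<Sum>b\<in>Basis. (L x \<bullet> b) *\<^sub>R frechet_derivative (\<lambda>y. frechet_derivative f (at y) w) (at x) b)
      + (\<Sum>b\<in>Basis. (L w \<bullet> b) *\<^sub>R frechet_derivative f (at x) b)"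
    by (simp add: sum.distrib second_frechet_symmetric[OF U f x, of _ w])
  also have "\<dots> = frechet_derivative (\<lambda>y. frechet_derivative f (at y) w) (at x) (L x) + frechet_derivative f (at x) (L w)"
    by (simp add: rep[OF D2[OF x], symmetric] rep[OF D[OF x], symmetric])
  finally show ?thesis
    by (subst frechet_derivative_cong_open[OF U x rep[OF D]]) (simp_all add: add.commute)
qed

section \<open>Left-invariant derivatives of functions smooth near SU(2)\<close>

definition smooth_near :: "(cmat2 \<Rightarrow> 'b::real_normed_vector) \<Rightarrow> bool" where
  "smooth_near f \<longleftrightarrow> (\<exists>U. open U \<and> SU2 \<subseteq> U \<and> Cinf U f)"

text \<open>An ordinary derivative in the ambient matrix space, taken of an extension. Since
  \<open>frame i x\<close> is tangent to SU(2), its values on SU(2) do not depend on the extension,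
  see \<open>lie_cong\<close>.\<close>

definition lie :: "3 \<Rightarrow> (cmat2 \<Rightarrow> 'b::real_normed_vector) \<Rightarrow> cmat2 \<Rightarrow> 'b" where
  "lie i f x = frechet_derivative f (at x) (frame i x)"

lemma smooth_near_const [simp]: "smooth_near (\<lambda>x. c)"
  unfolding smooth_near_def using Cinf_const[of UNIV] by blast

lemma smooth_near_linear: "bounded_linear L \<Longrightarrow> smooth_near L"
  unfolding smooth_near_def using Cinf_linear[of UNIV] by blast

lemma smooth_near_2:
  assumes "smooth_near f" "smooth_near g"
    "\<And>U. open U \<Longrightarrow> SU2 \<subseteq> U \<Longrightarrow> Cinf U f \<Longrightarrow> Cinf U g \<Longrightarrow> Cinf U h"
  shows "smooth_near h"
proof -
  obtain U V where "open U" "SU2 \<subseteq> U" "Cinf U f" "open V" "SU2 \<subseteq> V" "Cinf V g"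
    using assms(1,2) unfolding smooth_near_def by blast
  hence "open (U \<inter> V)" "SU2 \<subseteq> U \<inter> V" "Cinf (U \<inter> V) f" "Cinf (U \<inter> V) g"
    by (auto elim: Cinf_subset)
  with assms(3) show ?thesis unfolding smooth_near_def by blast
qed

lemma smooth_near_add: "smooth_near f \<Longrightarrow> smooth_near g \<Longrightarrow> smooth_near (\<lambda>x. f x + g x)"
  by (rule smooth_near_2[of f g]) (auto intro: Cinf_add)

lemma smooth_near_bilinear:
  "bounded_bilinear B \<Longrightarrow> smooth_near f \<Longrightarrow> smooth_near g \<Longrightarrow> smooth_near (\<lambda>x. B (f x) (g x))"
  by (rule smooth_near_2[of f g]) (auto intro: Cinf_bilinear)

lemma smooth_near_apply_linear: "bounded_linear L \<Longrightarrow> smooth_near f \<Longrightarrow> smooth_near (\<lambda>x. L (f x))"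
  by (rule smooth_near_2[of f f]) (auto intro: Cinf_apply_linear)

lemma smooth_near_sum:
  assumes "\<And>i. i \<in> I \<Longrightarrow> smooth_near (f i)" shows "smooth_near (\<lambda>x. \<Sum>i\<in>I. f i x)"
  using assms by (induction I rule: infinite_finite_induct) (auto intro: smooth_near_add)

lemma bounded_linear_frame: "bounded_linear (frame i)"
  unfolding linear_conv_bounded_linear[symmetric] frame_def
  by (rule linearI) (simp_all add: cmat2_eq_iff matmul_nth algebra_simps)

lemma smooth_near_lie: "smooth_near f \<Longrightarrow> smooth_near (lie i f)"
  unfolding lie_def[abs_def]
  by (rule smooth_near_2[of f f]) (auto intro: Cinf_frechet_field[OF _ _ Cinf_linear[OF _ bounded_linear_frame]])

lemma smooth_near_has_derivative:
  "smooth_near f \<Longrightarrow> x \<in> SU2 \<Longrightarrow> (f has_derivative frechet_derivative f (at x)) (at x)"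
  unfolding smooth_near_def using Cinf_has_derivative by blast

lemma smooth_near_continuous_on: "smooth_near f \<Longrightarrow> continuous_on SU2 f"
  unfolding smooth_near_def using Cinf_continuous_on continuous_on_subset by blast

lemma lie_eqI: "(f has_derivative D) (at x) \<Longrightarrow> lie i f x = D (frame i x)"
  by (simp add: lie_def frechet_eq)

lemma lie_const [simp]: "lie i (\<lambda>x. c) x = 0"
  using lie_eqI[OF has_derivative_const] by blast

lemma lie_linear: "bounded_linear L \<Longrightarrow> lie i L x = L (frame i x)"
  by (rule lie_eqI[OF bounded_linear_imp_has_derivative])

lemma lie_add:
  "smooth_near f \<Longrightarrow> smooth_near g \<Longrightarrow> x \<in> SU2 \<Longrightarrow> lie i (\<lambda>x. f x + g x) x = lie i f x + lie i g x"
  by (subst lie_eqI[OF has_derivative_add]) (auto intro: smooth_near_has_derivative simp: lie_def)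

lemma lie_bilinear:
  "bounded_bilinear B \<Longrightarrow> smooth_near f \<Longrightarrow> smooth_near g \<Longrightarrow> x \<in> SU2 \<Longrightarrow>
   lie i (\<lambda>x. B (f x) (g x)) x = B (f x) (lie i g x) + B (lie i f x) (g x)"
  by (subst lie_eqI[OF bounded_bilinear.FDERIV]) (auto intro: smooth_near_has_derivative simp: lie_def)

lemma lie_apply_linear:
  "bounded_linear L \<Longrightarrow> smooth_near f \<Longrightarrow> x \<in> SU2 \<Longrightarrow> lie i (\<lambda>x. L (f x)) x = L (lie i f x)"
  by (subst lie_eqI[OF bounded_linear.has_derivative]) (auto intro: smooth_near_has_derivative simp: lie_def)

lemma lie_sum:
  assumes "\<And>j. j \<in> I \<Longrightarrow> smooth_near (f j)" "x \<in> SU2"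
  shows "lie i (\<lambda>x. \<Sum>j\<in>I. f j x) x = (\<Sum>j\<in>I. lie i (f j) x)"
  using assms by (induction I rule: infinite_finite_induct) (auto simp: lie_add smooth_near_sum)

text \<open>The curve is \<open>x\<close> times exp (t theta i): each \<open>theta i\<close> squares
  to - 1/4, so the exponential is cos (t/2) + 2 sin (t/2) theta i.\<close>

lemma frame_curve:
  "((\<lambda>t. cos (t/2) *\<^sub>R x + (2 * sin (t/2)) *\<^sub>R frame i x) has_vector_derivative frame i x) (at 0)"
  by (auto intro!: derivative_eq_intros simp: has_vector_derivative_def)


lemma frame_curve_SU2:
  assumes "x \<in> SU2" shows "cos s *\<^sub>R x + (2 * sin s) *\<^sub>R frame i x \<in> SU2"
proof -
  have "cos s *\<^sub>R mat 1 + (2 * sin s) *\<^sub>R theta i \<in> SU2"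
    using exhaust_3[of i] sin_cos_squared_add[of s]
    by (auto simp: SU2_iff theta_nth mat_def complex_eq_iff cmod_power2 power_divide power_mult_distrib)
  hence "x ** (cos s *\<^sub>R mat 1 + (2 * sin s) *\<^sub>R theta i) \<in> SU2" by (rule SU2_mult[OF assms])
  moreover have "x ** (cos s *\<^sub>R mat 1 + (2 * sin s) *\<^sub>R theta i) = cos s *\<^sub>R x + (2 * sin s) *\<^sub>R frame i x"
    by (simp add: frame_def cmat2_eq_iff matmul_nth mat_def algebra_simps)
  ultimately show ?thesis by simp
qed

text \<open>Both derivatives yield the velocity of \<open>f\<close> along the curve of \<open>frame_curve\<close>.\<close>
lemma tangential_derivative_unique:
  assumes "x \<in> SU2" "(f has_derivative D) (at x within SU2)" "(f has_derivative D') (at x within SU2)"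
  shows "D (frame i x) = D' (frame i x)"
proof -
  let ?c = "\<lambda>t. cos (t/2) *\<^sub>R x + (2 * sin (t/2)) *\<^sub>R frame i x"
  have *: "((f \<circ> ?c) has_vector_derivative D (frame i x)) (at 0)"
    if "(f has_derivative D) (at x within SU2)" for D
  proof -
    have "range ?c \<subseteq> SU2" using frame_curve_SU2[OF assms(1)] by auto
    hence "(f has_derivative D) (at (?c 0) within range ?c)"
      using has_derivative_subset[OF that, of "range ?c"] by simp
    from diff_chain_within[OF frame_curve[unfolded has_vector_derivative_def] this]
    have "((f \<circ> ?c) has_derivative D \<circ> (\<lambda>t. t *\<^sub>R frame i x)) (at 0)" by simp
    moreover have "linear D" using that has_derivative_linear by blast
    ultimately show ?thesis by (simp add: has_vector_derivative_def o_def linear_scale)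
  qed
  show ?thesis using vector_derivative_unique_at[OF *[OF assms(2)] *[OF assms(3)]] .
qed

text \<open>Both extensions have the same velocity along a curve inside SU(2) through
  \<open>x\<close> with tangent \<open>frame i x\<close>.\<close>

lemma lie_cong:
  assumes "smooth_near f" "smooth_near g" "\<And>y. y \<in> SU2 \<Longrightarrow> f y = g y" "x \<in> SU2"
  shows "lie i f x = lie i g x"
proof -
  have "(f has_derivative frechet_derivative f (at x)) (at x within SU2)"
    "(g has_derivative frechet_derivative g (at x)) (at x within SU2)"
    using assms(1,2,4) by (auto intro: has_derivative_at_withinI smooth_near_has_derivative)
  moreover have "(f has_derivative frechet_derivative g (at x)) (at x within SU2)"
    by (rule has_derivative_transform[OF assms(4) _ calculation(2)]) (use assms in auto)
  ultimately show ?thesis unfolding lie_def using tangential_derivative_unique[OF assms(4)] by blast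
qed

lemma theta_bracket:
  "theta 1 ** theta 2 - theta 2 ** theta 1 = - theta 3"
  "theta 2 ** theta 3 - theta 3 ** theta 2 = - theta 1"
  "theta 3 ** theta 1 - theta 1 ** theta 3 = - theta 2"
  by (simp_all add: cmat2_eq_iff matmul_nth theta_nth)

text \<open>Right multiplication by \<open>theta i\<close> is a linear field, so by
  \<open>frechet_frechet_field\<close> the commutator is the derivative along \<open>x\<close> times
  the matrix commutator of the \<open>theta\<close>.\<close>

lemma lie_commutator:
  fixes f :: "cmat2 \<Rightarrow> 'b::real_inner"
  assumes f: "smooth_near f" and x: "x \<in> SU2"
  shows "lie 1 (lie 2 f) x - lie 2 (lie 1 f) x = - lie 3 f x"
    "lie 2 (lie 3 f) x - lie 3 (lie 2 f) x = - lie 1 f x"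
    "lie 3 (lie 1 f) x - lie 1 (lie 3 f) x = - lie 2 f x"
proof -
  obtain U where U: "open U" "SU2 \<subseteq> U" "Cinf U f" using f smooth_near_def by metis
  hence xU: "x \<in> U" using x by blast
  let ?D = "frechet_derivative f (at x)"
  have l: "linear ?D" using Cinf_has_derivative[OF U(3) xU] has_derivative_linear by blast
  have *: "lie i (lie j f) x - lie j (lie i f) x = ?D (x ** (theta i ** theta j - theta j ** theta i))" for i j
  proof -
    have "lie i (lie j f) x = ?D (frame j (frame i x)) +
       frechet_derivative (\<lambda>y. frechet_derivative f (at y) (frame i x)) (at x) (frame j x)" for i j
      unfolding lie_def[of i] lie_def[of j, abs_def]
      by (rule frechet_frechet_field[OF U(1,3) xU bounded_linear_frame])
    hence "lie i (lie j f) x - lie j (lie i f) x = ?D (frame j (frame i x)) - ?D (frame i (frame j x))"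
      by (simp add: second_frechet_symmetric[OF U(1,3) xU, of "frame i x" "frame j x"])
    also have "\<dots> = ?D (x ** (theta i ** theta j - theta j ** theta i))"
    proof -
      have "frame j (frame i x) - frame i (frame j x) = x ** (theta i ** theta j - theta j ** theta i)"
        by (simp add: frame_def cmat2_eq_iff matmul_nth algebra_simps)
      thus ?thesis by (simp add: linear_diff[OF l, symmetric])
    qed
    finally show ?thesis .
  qed
  have **: "?D (x ** - theta i) = - lie i f x" for i
  proof -
    have "x ** - theta i = - frame i x" by (simp add: frame_def cmat2_eq_iff matmul_nth)
    thus ?thesis by (simp add: lie_def linear_neg[OF l])
  qed
  show "lie 1 (lie 2 f) x - lie 2 (lie 1 f) x = - lie 3 f x"
    "lie 2 (lie 3 f) x - lie 3 (lie 2 f) x = - lie 1 f x"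
    "lie 3 (lie 1 f) x - lie 1 (lie 3 f) x = - lie 2 f x"
    by (simp_all only: * ** theta_bracket)
qed


section \<open>Integration in stereographic coordinates\<close>

abbreviation qq :: "real^3 \<Rightarrow> real" where "qq u \<equiv> 1 + (norm u)\<^sup>2"

lemma qq_pos [simp]: "qq u > 0" "qq u \<noteq> 0" "qq u \<ge> 1"
  by (auto simp: add_pos_nonneg add_nonneg_eq_0_iff)

lemma qq_nth: "(norm u)\<^sup>2 = (u$1)\<^sup>2 + (u$2)\<^sup>2 + (u$3)\<^sup>2" for u :: "real^3"
  by (simp only: power2_norm_eq_inner inner_vec_def sum_3) (simp add: power2_eq_square)

text \<open>Clears the denominator of \<open>stereo\<close>, which turns the identities below into
  polynomial ones.\<close>

definition stereo_num :: "real^3 \<Rightarrow> cmat2" where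
  "stereo_num u = (1 - (norm u)\<^sup>2) *\<^sub>R mat 1 + 4 *\<^sub>R mat3 u"

lemma stereo_eq: "stereo u = inverse (qq u) *\<^sub>R stereo_num u"
  by (simp add: stereo_def stereo_num_def mat3_def divide_inverse)

lemma stereo_num_nth:
  "stereo_num u $ 1 $ 1 = Complex (1 - (norm u)\<^sup>2) (2 * u$3)" "stereo_num u $ 1 $ 2 = Complex (2 * u$2) (2 * u$1)"
  "stereo_num u $ 2 $ 1 = Complex (- 2 * u$2) (2 * u$1)" "stereo_num u $ 2 $ 2 = Complex (1 - (norm u)\<^sup>2) (- 2 * u$3)"
  by (simp_all add: stereo_num_def mat3_nth mat_def complex_eq_iff)

lemma stereo_SU2: "stereo u \<in> SU2"
proof -
  have "(1 - (norm u)\<^sup>2)\<^sup>2 + (2 * u$3)\<^sup>2 + ((2 * u$2)\<^sup>2 + (2 * u$1)\<^sup>2) = (qq u)\<^sup>2"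
    unfolding qq_nth by algebra
  hence "((cmod (stereo_num u $ 1 $ 1))\<^sup>2 + (cmod (stereo_num u $ 2 $ 1))\<^sup>2) = (qq u)\<^sup>2"
    by (simp add: stereo_num_nth cmod_power2)
  hence "(inverse (qq u))\<^sup>2 * ((cmod (stereo_num u $ 1 $ 1))\<^sup>2 + (cmod (stereo_num u $ 2 $ 1))\<^sup>2) = 1"
    by (simp add: power_inverse)
  hence "(cmod (stereo u $ 1 $ 1))\<^sup>2 + (cmod (stereo u $ 2 $ 1))\<^sup>2 = 1"
    by (simp add: stereo_eq norm_mult power_mult_distrib algebra_simps)
  thus ?thesis by (simp add: SU2_iff stereo_eq stereo_num_nth complex_eq_iff)
qed

lemma norm_SU2: "x \<in> SU2 \<Longrightarrow> norm x = sqrt 2"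
  using SU2_iff[of x]
  by (simp add: norm_eq_sqrt_inner inner_cmat2 power2_norm_eq_inner inner_complex_def cmod_power2)

definition stereo_deriv :: "real^3 \<Rightarrow> real^3 \<Rightarrow> cmat2" where
  "stereo_deriv u v = inverse (qq u) *\<^sub>R (4 *\<^sub>R mat3 v - (2 * (u \<bullet> v)) *\<^sub>R mat 1) - ((2 * (u \<bullet> v)) / (qq u)) *\<^sub>R stereo u"

lemma stereo_has_derivative: "(stereo has_derivative stereo_deriv u) (at u)"
proof -
  have n: "((\<lambda>u. (norm u)\<^sup>2) has_derivative (\<lambda>v. 2 * (u \<bullet> v))) (at u)" for u :: "real^3"
    unfolding power2_norm_eq_inner by (auto intro!: derivative_eq_intros simp: inner_commute)
  have i: "((\<lambda>u. inverse (qq u)) has_derivative (\<lambda>v. - (inverse (qq u) * (0 + 2 * (u \<bullet> v)) * inverse (qq u)))) (at u)"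
    by (intro Deriv.has_derivative_inverse has_derivative_add has_derivative_const n) simp
  have "((\<lambda>u. inverse (qq u) *\<^sub>R stereo_num u) has_derivative
     (\<lambda>v. inverse (qq u) *\<^sub>R ((0 - 2 * (u \<bullet> v)) *\<^sub>R mat 1 + 4 *\<^sub>R mat3 v) + (- (inverse (qq u) * (0 + 2 * (u \<bullet> v)) * inverse (qq u))) *\<^sub>R stereo_num u)) (at u)"
    unfolding stereo_num_def
    by (rule has_derivative_scaleR[OF i])
      (intro has_derivative_add has_derivative_scaleR_left has_derivative_diff has_derivative_const n has_derivative_scaleR_right
        bounded_linear_imp_has_derivative linear_mat3)
  thus ?thesis unfolding stereo_eq[abs_def, symmetric]
    by (rule has_derivative_eq_rhs)
       (auto simp: fun_eq_iff stereo_deriv_def stereo_eq algebra_simps divide_inverse)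
qed

text \<open>The field \<open>frame i\<close> in stereographic coordinates, as
  \<open>stereo_deriv_field\<close> confirms: a quadratic vector field on R^3.\<close>

definition stereo_field :: "3 \<Rightarrow> real^3 \<Rightarrow> real^3" where
  "stereo_field i u = (1/4) *\<^sub>R ((1 - (norm u)\<^sup>2) *\<^sub>R axis i 1 + (2 * u $ i) *\<^sub>R u - 2 *\<^sub>R cross3 u (axis i 1))"

lemma stereo_field_nth:
  "stereo_field i u $ j = (1/4) * ((1 - ((u$1)\<^sup>2 + (u$2)\<^sup>2 + (u$3)\<^sup>2)) * axis i 1 $ j + 2 * u $ i * u $ j - 2 * cross3 u (axis i 1) $ j)"
  by (simp add: stereo_field_def qq_nth)

lemma inner_stereo_field: "u \<bullet> stereo_field i u = u $ i * qq u / 4"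
  by (simp add: stereo_field_def inner_add_right inner_diff_right inner_axis dot_cross_self power2_norm_eq_inner[symmetric] algebra_simps)

lemma stereo_deriv_field: "stereo_deriv u (stereo_field i u) = frame i (stereo u)"
proof -
  have "stereo_deriv u (stereo_field i u) = inverse (qq u) *\<^sub>R (4 *\<^sub>R mat3 (stereo_field i u) - (u $ i * qq u / 2) *\<^sub>R mat 1 - (u $ i / 2) *\<^sub>R stereo_num u)"
  proof -
    have "2 * (u $ i * Q / 4) = u $ i * Q / 2" "2 * (u $ i * Q / 4) / Q = u $ i / 2" if "Q \<noteq> 0" for Q :: real
      using that by simp_all
    from this[OF qq_pos(2)] show ?thesis
      unfolding stereo_deriv_def inner_stereo_field stereo_eq
      by (simp only:) (simp add: scaleR_diff_right mult.commute[of "inverse _"])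
  qed
  also have "4 *\<^sub>R mat3 (stereo_field i u) - (u $ i * qq u / 2) *\<^sub>R mat 1 - (u $ i / 2) *\<^sub>R stereo_num u = frame i (stereo_num u)"
    using exhaust_3[of i]
    by (auto simp: cmat2_eq_iff frame_def matmul_nth theta_nth mat3_nth mat_def stereo_num_nth complex_eq_iff
        stereo_field_nth cross3_def axis_def qq_nth[unfolded power2_eq_square] power2_eq_square field_simps)
  also have "inverse (qq u) *\<^sub>R frame i (stereo_num u) = frame i (stereo u)"
    by (simp add: stereo_eq frame_def cmat2_eq_iff matmul_nth algebra_simps)
  finally show ?thesis .
qed


text \<open>In this metric SU(2) is a 3-sphere of radius 2, and \<open>stereo\<close> is conformal
  with factor 4/qq. The pairing is thus the Euclidean one with the coordinate field, scaled by
  (4/qq)^2.\<close>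

lemma vol_matrix: "metric_SU2 (frame i (stereo u)) (stereo_deriv u v) = 16 / (qq u)\<^sup>2 * (stereo_field i u \<bullet> v)"
proof -
  have h: "2 / Q * (8 * X) = 16 / Q * X" for Q X :: real by simp
  have 1: "frame i (stereo u) \<bullet> stereo u = 0"
    using exhaust_3[of i] SU2_entries[OF stereo_SU2[of u]]
    by (auto simp: frame_def inner_cmat2 matmul_nth theta_nth inner_complex_def)
  have e1: "metric_SU2 (frame i (stereo u)) (stereo_deriv u v)
     = (2 / qq u) * (frame i (stereo u) \<bullet> (4 *\<^sub>R mat3 v - (2 * (u \<bullet> v)) *\<^sub>R mat 1))"
    by (simp add: metric_SU2_def stereo_deriv_def inner_diff_right 1 divide_inverse)
  have e2: "frame i (stereo u) = inverse (qq u) *\<^sub>R frame i (stereo_num u)"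
    by (simp add: stereo_eq frame_def cmat2_eq_iff matmul_nth algebra_simps)
  have e3: "(2 / qq u) * (inverse (qq u) *\<^sub>R frame i (stereo_num u) \<bullet> (4 *\<^sub>R mat3 v - (2 * (u \<bullet> v)) *\<^sub>R mat 1))
     = (2 / (qq u)\<^sup>2) * (frame i (stereo_num u) \<bullet> (4 *\<^sub>R mat3 v - (2 * (u \<bullet> v)) *\<^sub>R mat 1))"
    by (simp add: divide_inverse power2_eq_square)
  have e4: "frame i (stereo_num u) \<bullet> (4 *\<^sub>R mat3 v - (2 * (u \<bullet> v)) *\<^sub>R mat 1) = 8 * (stereo_field i u \<bullet> v)"
    using exhaust_3[of i] unfolding inner_vec_def[of u v] inner_vec_def[of "stereo_field i u" v] sum_3
    by (auto simp: inner_cmat2 inner_complex_def frame_def matmul_nth theta_nth mat3_nth mat_def stereo_num_nth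
        stereo_field_nth cross3_def axis_def qq_nth[unfolded power2_eq_square] power2_eq_square algebra_simps)
  show ?thesis by (subst e1, subst e2, subst e3, subst e4, rule h)
qed

text \<open>The cube of the conformal factor. The coordinate fields are orthogonal of Euclidean
  length qq/4, whence the determinant qq^3/64.\<close>

lemma vol_density_eq: "vol_density u = 64 / (qq u)^3"
proof -
  have "vol_density u = \<bar>det (\<chi> i j. 16 / (qq u)\<^sup>2 * (stereo_field i u $ j) :: real^3^3)\<bar>"
    unfolding vol_density_def frechet_eq[OF stereo_has_derivative] vol_matrix by (simp add: inner_axis)
  also have "det (\<chi> i j. 16 / (qq u)\<^sup>2 * (stereo_field i u $ j) :: real^3^3) = (16 / (qq u)\<^sup>2)^3 * det (\<chi> i j. stereo_field i u $ j :: real^3^3)"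
    by (simp add: det_3 algebra_simps power3_eq_cube)
  also have "det (\<chi> i j. stereo_field i u $ j :: real^3^3) = (qq u)^3 / 64"
    unfolding det_3 qq_nth by (simp add: stereo_field_nth cross3_def axis_def) algebra
  also have "(16 / (qq u)\<^sup>2)^3 * ((qq u)^3 / 64) = 64 / (qq u)^3"
  proof -
    have "(16 / Q\<^sup>2)^3 * (Q^3 / 64) = 64 / Q^3" if "Q \<noteq> 0" for Q :: real
      using that by (simp add: field_simps eval_nat_numeral)
    thus ?thesis using qq_pos(2) .
  qed
  finally show ?thesis by simp
qed


section \<open>Integrability and vanishing integrals of derivatives on R^3\<close>

lemma integrable_qq: "integrable lborel (\<lambda>u. 1 / (qq u)\<^sup>2)"
proof (rule integrableI_nonneg)
  show "(\<lambda>u. 1 / (qq u)\<^sup>2) \<in> borel_measurable lborel"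
    by (auto intro!: borel_measurable_continuous_onI continuous_intros)
  define B where "B k = ball (0::real^3) (2^k)" for k :: nat
  \<comment> \<open>Take the smallest \<open>k\<close> with |u| < 2^k. For \<open>k > 0\<close> this
    gives |u| >= 2^(k-1), hence qq^2 >= 16^(k-1), which is the bound 16/16^k. Balls of volume 8^k
    vol(B) then leave a geometric series of ratio 1/2.\<close>
  have le: "ennreal (1 / (qq u)\<^sup>2) \<le> (\<Sum>k. ennreal (16 / 16^k) * indicator (B k) u)" for u
  proof -
    obtain k0 where "norm u < 2 ^ k0" using real_arch_pow[of 2 "norm u"] by auto
    then obtain k where k: "norm u < 2 ^ k" "\<And>j. j < k \<Longrightarrow> \<not> norm u < 2 ^ j"
      using exists_least_iff[of "\<lambda>k. norm u < 2 ^ k"] by auto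
    have "1 / (qq u)\<^sup>2 \<le> 16 / 16 ^ k"
    proof (cases k)
      case 0
      have "1 \<le> (qq u)\<^sup>2" by (intro one_le_power) simp
      hence "1 / (qq u)\<^sup>2 \<le> 1" using qq_pos(1)[of u] by (subst divide_le_eq_1_pos) auto
      thus ?thesis using 0 by (simp only: power_0 div_by_1)
    next
      case (Suc j)
      hence "2 ^ j \<le> norm u" using k(2)[of j] by simp
      hence "(2^j)^4 \<le> norm u ^ 4" by (intro power_mono) auto
      also have "\<dots> \<le> (qq u)\<^sup>2" by (simp add: power2_eq_square eval_nat_numeral algebra_simps)
      also have "((2::real)^j)^4 = 16^j"
      proof -
        have "((2::real)^j)^4 = (2^4)^j" by (simp only: power_mult[symmetric] mult.commute)
        thus ?thesis by simp
      qed
      finally have "16 ^ j \<le> (qq u)\<^sup>2" .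
      thus ?thesis using Suc by (simp add: field_simps)
    qed
    moreover have "u \<in> B k" using k by (simp add: B_def)
    ultimately have "ennreal (1 / (qq u)\<^sup>2) \<le> ennreal (16 / 16^k) * indicator (B k) u"
      by (simp add: ennreal_leI)
    also have "\<dots> \<le> (\<Sum>k. ennreal (16 / 16^k) * indicator (B k) u)"
    proof -
      have "f k \<le> suminf f" for f :: "nat \<Rightarrow> ennreal"
        using sum_le_suminf[OF summableI, of "{k}" f] by simp
      thus ?thesis .
    qed
    finally show ?thesis .
  qed
  have "(\<integral>\<^sup>+ u. ennreal (1 / (qq u)\<^sup>2) \<partial>lborel) \<le> (\<integral>\<^sup>+ u. (\<Sum>k. ennreal (16 / 16^k) * indicator (B k) u) \<partial>lborel)"
    by (intro nn_integral_mono le)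
  also have "\<dots> = (\<Sum>k. \<integral>\<^sup>+ u. ennreal (16 / 16^k) * indicator (B k) u \<partial>lborel)"
  proof (intro nn_integral_suminf)
    have [measurable]: "B k \<in> sets borel" for k by (simp add: B_def)
    show "(\<lambda>u. ennreal (16 / 16^k) * indicator (B k) u) \<in> borel_measurable lborel" for k by measurable
  qed
  also have "\<dots> = (\<Sum>k. ennreal (16 * measure lborel (ball (0::real^3) 1) * (1/2)^k))"
  proof (intro suminf_cong)
    fix k :: nat
    have "emeasure lborel (B k) = ennreal (8^k * measure lborel (ball (0::real^3) 1))"
    proof -
      have "measure lborel (B k) = 8^k * measure lborel (ball (0::real^3) 1)"
        using content_ball_conv_unit_ball[of "2^k" "0::real^3"]
        using power_mult[of "2::real" k 3] power_mult[of "2::real" 3 k] by (simp add: B_def mult.commute)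
      moreover have "emeasure lborel (B k) < \<infinity>" unfolding B_def by (rule emeasure_bounded_finite) simp
      ultimately show ?thesis by (simp add: emeasure_eq_ennreal_measure)
    qed
    hence "(\<integral>\<^sup>+ u. ennreal (16 / 16^k) * indicator (B k) u \<partial>lborel) = ennreal (16 / 16^k) * ennreal (8^k * measure lborel (ball (0::real^3) 1))"
      by (simp add: nn_integral_cmult_indicator B_def)
    also have "\<dots> = ennreal (16 * measure lborel (ball (0::real^3) 1) * (1/2)^k)"
    proof -
      have "(16::real) ^ k = 8 ^ k * 2 ^ k" by (simp add: power_mult_distrib[symmetric])
      thus ?thesis by (simp add: ennreal_mult'[symmetric] field_simps power_divide)
    qed
    finally show "(\<integral>\<^sup>+ u. ennreal (16 / 16^k) * indicator (B k) u \<partial>lborel) = ennreal (16 * measure lborel (ball (0::real^3) 1) * (1/2)^k)" .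
  qed
  also have "\<dots> < \<infinity>"
    unfolding infinity_ennreal_def less_top[symmetric]
    by (intro ennreal_suminf_neq_top summable_mult summable_geometric mult_nonneg_nonneg measure_nonneg) simp_all
  finally show "(\<integral>\<^sup>+ u. ennreal (1 / (qq u)\<^sup>2) \<partial>lborel) < \<infinity>" .
qed auto

lemma integrable_bound_qq:
  assumes "\<And>u. \<bar>f u\<bar> \<le> C / (qq u)\<^sup>2" "f \<in> borel_measurable borel"
  shows "integrable lborel f"
proof (rule Bochner_Integration.integrable_bound)
  show "integrable lborel (\<lambda>u. C * (1 / (qq u)\<^sup>2))" by (intro integrable_mult_right integrable_qq)
  show "AE u in lborel. norm (f u) \<le> norm (C * (1 / (qq u)\<^sup>2))"
    using order_trans[OF assms(1) abs_ge_self] by (intro AE_I2) simp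
qed (use assms in simp)

text \<open>By translation invariance of the Lebesgue measure.\<close>
lemma integral_partial_derivative_zero:
  fixes F F' :: "real^3 \<Rightarrow> real"
  assumes e: "norm e = 1"
    and d: "\<And>u. ((\<lambda>s. F (u + s *\<^sub>R e)) has_real_derivative F' u) (at 0)"
    and F: "continuous_on UNIV F" "\<And>u. \<bar>F u\<bar> \<le> C / (qq u)\<^sup>2"
    and F': "F' \<in> borel_measurable borel" "\<And>u. \<bar>F' u\<bar> \<le> C / (qq u)\<^sup>2"
  shows "(LINT u|lborel. F' u) = 0"
proof -
  define X where "X n = 1 / real (Suc n)" for n
  have X: "0 < X n" "X n \<le> 1" for n by (auto simp: X_def)
  have X0: "X \<longlonglongrightarrow> 0" unfolding X_def using LIMSEQ_inverse_real_of_nat by (simp add: inverse_eq_divide)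
  define s where "s n u = (F (u + X n *\<^sub>R e) - F u) / X n" for n u
  have mF: "F \<in> borel_measurable borel" using F(1) by (rule borel_measurable_continuous_onI)
  have iF: "integrable lborel F" by (rule integrable_bound_qq[OF F(2) mF])
  have d': "((\<lambda>s. F (u + s *\<^sub>R e)) has_real_derivative F' (u + t *\<^sub>R e)) (at t)" for u t
  proof -
    have "((\<lambda>s. F (u + (t + s) *\<^sub>R e)) has_real_derivative F' (u + t *\<^sub>R e)) (at 0)"
      using d[of "u + t *\<^sub>R e"] by (simp add: algebra_simps)
    thus ?thesis using DERIV_shift[of "\<lambda>s. F (u + s *\<^sub>R e)" _ 0 t] by (simp add: add.commute)
  qed
  \<comment> \<open>By the mean value theorem the difference quotient is \<open>F'\<close> at a
    point shifted by less than 1. Such a shift costs at most a factor 3 in qq, hence 9 in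
    qq^2.\<close>
  have bound: "\<bar>s n u\<bar> \<le> 9 * C / (qq u)\<^sup>2" for n u
  proof -
    have "\<exists>z. 0 < z \<and> z < X n \<and> F (u + X n *\<^sub>R e) - F (u + 0 *\<^sub>R e) = (X n - 0) * F' (u + z *\<^sub>R e)"
      by (rule MVT2) (use X d' in auto)
    then obtain z where z: "0 < z" "z < X n" "s n u = F' (u + z *\<^sub>R e)"
      using X[of n] by (auto simp: s_def)
    let ?w = "u + z *\<^sub>R e"
    have "norm u \<le> norm ?w + z"
      using norm_triangle_ineq4[of ?w "z *\<^sub>R e"] z(1) e by simp
    hence "norm u \<le> norm ?w + 1" using z X[of n] by linarith
    hence "(norm u)\<^sup>2 \<le> (norm ?w + 1)\<^sup>2" by (intro power_mono) auto
    also have "\<dots> \<le> 2 * (norm ?w)\<^sup>2 + 2" using sum_squares_bound[of "norm ?w" 1] by (simp add: power2_sum)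
    finally have le2: "(norm u)\<^sup>2 \<le> 2 * (norm ?w)\<^sup>2 + 2" .
    have "1 + a \<le> 3 * (1 + b)" if "a \<le> 2 * b + 2" "0 \<le> b" for a b :: real using that by simp
    from this[OF le2 zero_le_power2] have "qq u \<le> 3 * qq ?w" .
    hence "(qq u)\<^sup>2 \<le> (3 * qq ?w)\<^sup>2"  by (intro power_mono) (auto simp: less_imp_le)
    also have "(3 * qq ?w)\<^sup>2 = 9 * (qq ?w)\<^sup>2" by (simp only: power_mult_distrib) simp
    finally have le: "(qq u)\<^sup>2 \<le> 9 * (qq ?w)\<^sup>2" .
    have "C / (qq ?w)\<^sup>2 \<ge> 0" using F'(2)[of ?w] abs_ge_zero order_trans by blast
    hence C: "C \<ge> 0" using qq_pos(1)[of ?w] by (simp add: zero_le_divide_iff)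
    have "\<bar>s n u\<bar> \<le> C / (qq ?w)\<^sup>2" using F'(2) z(3) by simp
    also have "\<dots> = 9 * C / (9 * (qq ?w)\<^sup>2)" by simp
    also have "\<dots> \<le> 9 * C / (qq u)\<^sup>2" using le C by (intro divide_left_mono) auto
    finally show ?thesis .
  qed
  have "(\<lambda>n. LINT u|lborel. s n u) \<longlonglongrightarrow> (LINT u|lborel. F' u)"
  proof (rule integral_dominated_convergence)
    show "integrable lborel (\<lambda>u. 9 * C / (qq u)\<^sup>2)"
      using integrable_mult_right[OF integrable_qq, of "9 * C"] by simp
    show "F' \<in> borel_measurable lborel" using F'(1) by simp
    show "s n \<in> borel_measurable lborel" for n
      unfolding s_def[abs_def] using mF by measurable
    show "AE u in lborel. (\<lambda>n. s n u) \<longlonglongrightarrow> F' u"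
    proof (rule AE_I2)
      fix u
      have "((\<lambda>h. (F (u + h *\<^sub>R e) - F u) / h) \<longlongrightarrow> F' u) (at 0)"
        using d[of u] by (simp add: has_field_derivative_iff)
      moreover have "filterlim X (at 0) sequentially"
        using X0 X(1) by (auto simp: filterlim_at less_imp_neq[symmetric])
      ultimately show "(\<lambda>n. s n u) \<longlonglongrightarrow> F' u"
        unfolding s_def by (rule filterlim_compose)
    qed
    show "AE u in lborel. norm (s n u) \<le> 9 * C / (qq u)\<^sup>2" for n using bound by simp
  qed
  \<comment> \<open>Both terms of the difference quotient have the same integral, one being a
    translate of the other.\<close>
  moreover have "(LINT u|lborel. s n u) = 0" for n
  proof -
    have "(LINT u|lborel. F (u + X n *\<^sub>R e)) = (LINT u|lborel. F u)"
      by (subst lborel_distr_plus[of "X n *\<^sub>R e", symmetric], subst integral_distr)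
         (auto simp: mF add.commute)
    moreover have "integrable lborel (\<lambda>u. F (u + X n *\<^sub>R e))"
    proof -
      have "integrable (distr lborel borel ((+) (X n *\<^sub>R e))) F" using iF by (simp add: lborel_distr_plus)
      thus ?thesis by (subst (asm) integrable_distr_eq) (auto simp: mF add.commute)
    qed
    ultimately show ?thesis using iF by (simp add: s_def)
  qed
  ultimately show ?thesis by (simp add: LIMSEQ_const_iff)
qed

section \<open>Elementary properties of the integral over SU(2)\<close>

lemma continuous_on_stereo: "continuous_on UNIV stereo"
  by (meson stereo_has_derivative has_derivative_continuous continuous_at_imp_continuous_on)

lemma continuous_on_stereo_comp: "continuous_on SU2 f \<Longrightarrow> continuous_on UNIV (\<lambda>u. f (stereo u))"
  using continuous_on_compose2[OF _ continuous_on_stereo] stereo_SU2 by blast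

lemma continuous_on_vol: "continuous_on UNIV vol_density"
  unfolding vol_density_eq[abs_def] by (intro continuous_intros) simp

lemma bounded_SU2:
  fixes f :: "cmat2 \<Rightarrow> 'b::real_normed_vector"
  assumes "continuous_on SU2 f" obtains B where "B \<ge> 0" "\<And>x. x \<in> SU2 \<Longrightarrow> norm (f x) \<le> B"
proof -
  have "bounded (f ` SU2)" using compact_continuous_image[OF assms compact_SU2] compact_imp_bounded by blast
  then obtain B where "\<And>x. x \<in> SU2 \<Longrightarrow> norm (f x) \<le> B" unfolding bounded_iff by blast
  moreover have "B \<ge> 0" using calculation[OF SU2_mat1] norm_ge_zero order_trans by blast
  ultimately show ?thesis using that by blast
qed

lemma vol_density_le: "0 \<le> vol_density u" "vol_density u \<le> 64 / (qq u)\<^sup>2" "vol_density u > 0"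
proof -
  have "(qq u)\<^sup>2 \<le> (qq u)^3" by (intro power_increasing) auto
  thus "vol_density u \<le> 64 / (qq u)\<^sup>2"
    unfolding vol_density_eq using qq_pos(1)[of u] by (intro divide_left_mono mult_pos_pos zero_less_power) auto
  show "vol_density u > 0" unfolding vol_density_eq using qq_pos(1)[of u] by (intro divide_pos_pos zero_less_power) auto
  thus "0 \<le> vol_density u" by simp
qed

lemma integrable_SU2:
  assumes "continuous_on SU2 f" shows "integrable lborel (\<lambda>u. f (stereo u) * vol_density u :: real)"
proof -
  obtain B where B: "B \<ge> 0" "\<And>x. x \<in> SU2 \<Longrightarrow> norm (f x) \<le> B" using bounded_SU2[OF assms] by blast
  have "\<bar>f (stereo u) * vol_density u\<bar> \<le> (B * 64) / (qq u)\<^sup>2" for u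
    using mult_mono[OF B(2)[OF stereo_SU2[of u]] vol_density_le(2)[of u]] B(1) vol_density_le(1)[of u]
    by (simp add: abs_mult)
  thus ?thesis
    by (rule integrable_bound_qq)
      (intro borel_measurable_continuous_onI continuous_on_mult continuous_on_stereo_comp assms continuous_on_vol)
qed

lemma integral_SU2_add:
  "continuous_on SU2 f \<Longrightarrow> continuous_on SU2 g \<Longrightarrow> integral_SU2 (\<lambda>x. f x + g x) = integral_SU2 f + integral_SU2 g"
  unfolding integral_SU2_def by (simp add: distrib_right integrable_SU2)

lemma integral_SU2_cmult: "integral_SU2 (\<lambda>x. c * f x) = c * integral_SU2 f"
  unfolding integral_SU2_def by (simp add: mult.assoc)

lemma integral_SU2_minus: "integral_SU2 (\<lambda>x. - f x) = - integral_SU2 f"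
  using integral_SU2_cmult[of "-1" f] by simp

lemma integral_SU2_diff:
  "continuous_on SU2 f \<Longrightarrow> continuous_on SU2 g \<Longrightarrow> integral_SU2 (\<lambda>x. f x - g x) = integral_SU2 f - integral_SU2 g"
  unfolding integral_SU2_def by (simp add: left_diff_distrib integrable_SU2)

lemma integral_SU2_cong: "(\<And>x. x \<in> SU2 \<Longrightarrow> f x = g x) \<Longrightarrow> integral_SU2 f = integral_SU2 g"
  unfolding integral_SU2_def using stereo_SU2 by (intro Bochner_Integration.integral_cong) auto

lemma integral_SU2_zero [simp]: "integral_SU2 (\<lambda>x. 0) = 0"
  by (simp add: integral_SU2_def)

lemma integral_SU2_sum:
  assumes "\<And>i. i \<in> I \<Longrightarrow> continuous_on SU2 (f i)"
  shows "integral_SU2 (\<lambda>x. \<Sum>i\<in>I. f i x) = (\<Sum>i\<in>I. integral_SU2 (f i))"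
  using assms by (induction I rule: infinite_finite_induct) (auto simp: integral_SU2_add continuous_on_sum)

lemma integral_SU2_nonneg: "(\<And>x. x \<in> SU2 \<Longrightarrow> 0 \<le> f x) \<Longrightarrow> 0 \<le> integral_SU2 f"
  unfolding integral_SU2_def using stereo_SU2 vol_density_le(1)
  by (intro Bochner_Integration.integral_nonneg mult_nonneg_nonneg) auto

lemma integral_SU2_one_pos: "integral_SU2 (\<lambda>x. 1) > 0"
proof -
  have i: "integrable lborel vol_density" using integrable_SU2[of "\<lambda>_. 1"] by simp
  have "integral_SU2 (\<lambda>x. 1) \<noteq> 0"
  proof
    assume "integral_SU2 (\<lambda>x. 1) = 0"
    hence "AE u in lborel. vol_density u = 0"
      using integral_nonneg_eq_0_iff_AE[OF i] vol_density_le(1) by (simp add: integral_SU2_def)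
    hence "AE u::real^3 in lborel. False" using vol_density_le(3) by (simp add: less_imp_neq[symmetric])
    thus False by (simp add: ae_filter_eq_bot_iff trivial_limit_def[symmetric] eventually_False)
  qed
  thus ?thesis using integral_SU2_nonneg[of "\<lambda>_. 1"] by simp
qed

lemma smooth_near_frechet: "smooth_near f \<Longrightarrow> smooth_near (\<lambda>x. frechet_derivative f (at x) v)"
  by (rule smooth_near_2[of f f]) (auto intro: Cinf_frechet)

lemma smooth_near_derivative_bound:
  assumes f: "smooth_near f"
  obtains K where "K \<ge> 0" "\<And>x v. x \<in> SU2 \<Longrightarrow> norm (frechet_derivative f (at x) v) \<le> K * norm v"
proof -
  have "\<forall>b. \<exists>B. B \<ge> 0 \<and> (\<forall>x\<in>SU2. norm (frechet_derivative f (at x) b) \<le> B)"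
    using bounded_SU2[OF smooth_near_continuous_on[OF smooth_near_frechet[OF f]]] by metis
  then obtain B where B: "\<And>b. B b \<ge> 0" "\<And>b x. x \<in> SU2 \<Longrightarrow> norm (frechet_derivative f (at x) b) \<le> B b"
    by metis
  have "norm (frechet_derivative f (at x) v) \<le> (\<Sum>b\<in>Basis. B b) * norm v" if x: "x \<in> SU2" for x v
  proof -
    have "norm (frechet_derivative f (at x) v) \<le> (\<Sum>b\<in>Basis. norm ((v \<bullet> b) *\<^sub>R frechet_derivative f (at x) b))"
      by (subst frechet_basis_sum[OF smooth_near_has_derivative[OF f x]]) (rule norm_sum)
    also have "\<dots> \<le> (\<Sum>b\<in>Basis. norm v * B b)"
      by (intro sum_mono) (auto intro!: mult_mono B x simp: Basis_le_norm)
    finally show ?thesis by (simp add: sum_distrib_left mult.commute)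
  qed
  thus ?thesis using that[of "\<Sum>b\<in>Basis. B b"] B(1) by (simp add: sum_nonneg)
qed


section \<open>Left-invariant derivatives integrate to zero\<close>

lemma norm_le_qq: "norm u \<le> qq u" "2 * norm u \<le> qq u" "norm u ^ 2 \<le> qq u"
proof -
  show 2: "2 * norm u \<le> qq u" using sum_squares_bound[of "norm u" 1] by simp
  have "norm u \<le> 2 * norm u" by simp
  thus "norm u \<le> qq u" using 2 by (rule order_trans)
qed simp

lemma stereo_field_le: "\<bar>stereo_field i u $ j\<bar> \<le> qq u"
proof -
  let ?r = "norm u"
  have "norm (cross3 u (axis i 1)) \<le> norm u"
  proof (rule power2_le_imp_le)
    show "(norm (cross3 u (axis i 1)))\<^sup>2 \<le> (norm u)\<^sup>2" unfolding norm_cross by simp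
  qed simp
  moreover have "\<bar>1 - ?r\<^sup>2\<bar> \<le> qq u" by (simp add: abs_le_iff)
  moreover have "norm (stereo_field i u) \<le> (1/4) * (norm ((1 - ?r\<^sup>2) *\<^sub>R (axis i 1 :: real^3)) + norm ((2 * u $ i) *\<^sub>R u) + norm (2 *\<^sub>R cross3 u (axis i 1)))"
  proof -
    have "norm (A + B - C) \<le> norm A + norm B + norm C" for A B C :: "real^3"
      using norm_triangle_ineq4[of "A + B" C] norm_triangle_ineq[of A B] by linarith
    moreover have "norm (stereo_field i u) = (1/4) * norm ((1 - ?r\<^sup>2) *\<^sub>R (axis i 1 :: real^3) + (2 * u $ i) *\<^sub>R u - 2 *\<^sub>R cross3 u (axis i 1))"
      unfolding stereo_field_def norm_scaleR[of "1/4"] by simp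
    ultimately show ?thesis by (simp only: mult_left_mono)
  qed
  moreover have "\<bar>u $ i\<bar> * norm u \<le> norm u * norm u" by (intro mult_right_mono component_le_norm_cart) simp
  ultimately have "norm (stereo_field i u) \<le> (1/4) * (qq u + 2 * ?r\<^sup>2 + 2 * ?r)"
    by (simp add: power2_eq_square)
  also have "\<dots> \<le> qq u" using norm_le_qq(2,3)[of u] by simp
  finally show ?thesis using component_le_norm_cart order_trans by blast
qed

text \<open>Only boundedness matters, not the value 8. Together with the growth of
  \<open>stereo_field\<close> by at most qq and a density of order qq^-3, it leaves integrands of
  order qq^-2, which are integrable.\<close>

lemma stereo_deriv_le: assumes "norm v = 1" shows "norm (stereo_deriv u v) \<le> 8"
proof -
  let ?r = "norm u"
  have m: "norm (mat3 v) \<le> 1"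
  proof (rule power2_le_imp_le)
    have "2 * (norm (mat3 v))\<^sup>2 = 1"
      using metric_mat3[of v v] assms by (simp only: metric_SU2_def power2_norm_eq_inner norm_eq_1)
    thus "(norm (mat3 v))\<^sup>2 \<le> 1\<^sup>2" by simp
  qed simp
  have uv: "\<bar>u \<bullet> v\<bar> \<le> ?r" using Cauchy_Schwarz_ineq2[of u v] assms by simp
  have s2: "sqrt 2 \<le> 2" using real_sqrt_le_mono[of 2 4] by simp
  have n: "norm x \<le> 2" if "x \<in> SU2" for x using norm_SU2[OF that] s2 by simp
  have "norm (stereo_deriv u v) \<le> norm (inverse (qq u) *\<^sub>R (4 *\<^sub>R mat3 v - (2 * (u \<bullet> v)) *\<^sub>R mat 1)) + norm (((2 * (u \<bullet> v)) / (qq u)) *\<^sub>R stereo u)"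
    unfolding stereo_deriv_def by (rule norm_triangle_ineq4)
  also have "\<dots> \<le> inverse (qq u) * (4 * 1 + (2 * ?r) * 2) + (2 * ?r) / qq u * 2"
  proof (intro add_mono)
    have "norm (4 *\<^sub>R mat3 v - (2 * (u \<bullet> v)) *\<^sub>R (mat 1 :: cmat2)) \<le> norm (4 *\<^sub>R mat3 v) + norm ((2 * (u \<bullet> v)) *\<^sub>R (mat 1 :: cmat2))"
      by (rule norm_triangle_ineq4)
    also have "\<dots> \<le> 4 * 1 + (2 * ?r) * 2"
      unfolding norm_scaleR by (intro add_mono mult_mono n[OF SU2_mat1] m) (use uv in \<open>auto simp: abs_mult\<close>)
    finally show "norm (inverse (qq u) *\<^sub>R (4 *\<^sub>R mat3 v - (2 * (u \<bullet> v)) *\<^sub>R (mat 1 :: cmat2))) \<le> inverse (qq u) * (4 * 1 + (2 * ?r) * 2)"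
      using qq_pos(1)[of u] by (simp add: mult_left_mono)
    show "norm (((2 * (u \<bullet> v)) / (qq u)) *\<^sub>R stereo u) \<le> (2 * ?r) / qq u * 2"
      unfolding norm_scaleR
      by (intro mult_mono n[OF stereo_SU2]) (use uv qq_pos(1)[of u] in \<open>auto simp: abs_mult abs_divide intro!: divide_right_mono\<close>)
  qed
  also have "\<dots> = (4 + 8 * ?r) / qq u" by (simp add: divide_inverse algebra_simps)
  also have "\<dots> \<le> 8"
  proof -
    have "4 + 8 * r \<le> 8 * Q" if "2 * r \<le> Q" "1 \<le> Q" for r Q :: real using that by linarith
    from this[OF norm_le_qq(2) qq_pos(3)] have "4 + 8 * ?r \<le> 8 * qq u" .
    thus ?thesis using qq_pos(1)[of u] by (subst pos_divide_le_eq) auto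
  qed
  finally show ?thesis .
qed

text \<open>One summand of the divergence of \<open>vol_density\<close> times
  \<open>stereo_field i\<close>. The \<open>j\<close>-th component has the partial derivative u_i /
  2 in its own direction for every \<open>j\<close>; the other term comes from the density.\<close>

lemma stereo_field_density_deriv:
  fixes u :: "real^3" and i j :: 3
  shows "((\<lambda>s. 64 * (stereo_field i (u + s *\<^sub>R axis j (1::real)) $ j) * inverse (qq (u + s *\<^sub>R axis j (1::real))) ^ 3) has_real_derivative
     64 * (u $ i / 2 * inverse (qq u) ^ 3 - 6 * u $ j * stereo_field i u $ j * inverse (qq u) ^ 4)) (at 0)"
proof -
  define a :: real where "a = axis i 1 $ j"
  have ax: "axis j (1::real) $ i = a" "axis j (1::real) $ j = 1" by (auto simp: a_def axis_def)
  have q: "qq (u + s *\<^sub>R axis j (1::real)) = 1 + (norm u)\<^sup>2 + 2 * s * u $ j + s\<^sup>2" for s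
    unfolding power2_norm_eq_inner by (simp add: inner_add_left inner_add_right inner_axis inner_axis' power2_eq_square algebra_simps)
  have c: "cross3 (u + s *\<^sub>R axis j (1::real)) (axis i 1) $ j = cross3 u (axis i 1) $ j" for s
    using exhaust_3[of j] by (auto simp: cross3_def axis_def)
  have V: "stereo_field i (u + s *\<^sub>R axis j (1::real)) $ j = (1/4) * ((1 - ((norm u)\<^sup>2 + 2 * s * u $ j + s\<^sup>2)) * a + 2 * (u $ i + s * a) * (u $ j + s) - 2 * cross3 u (axis i 1) $ j)" for s
    using q[of s] by (simp add: stereo_field_def c ax(1) a_def[symmetric] ax(2))
  have d1: "((\<lambda>s. stereo_field i (u + s *\<^sub>R axis j (1::real)) $ j) has_real_derivative u $ i / 2) (at 0)"
    unfolding V by (auto intro!: derivative_eq_intros)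
  have d2: "((\<lambda>s. qq (u + s *\<^sub>R axis j (1::real))) has_real_derivative 2 * u $ j) (at 0)"
    unfolding q by (auto intro!: derivative_eq_intros)
  have nz: "qq (u + 0 *\<^sub>R axis j (1::real)) \<noteq> 0" by (rule qq_pos(2))
  have d3: "((\<lambda>s. inverse (qq (u + s *\<^sub>R axis j (1::real))) ^ 3) has_real_derivative - 6 * u $ j * inverse (qq u) ^ 4) (at 0)"
    by (rule derivative_eq_intros DERIV_inverse'[OF d2 nz] refl)+ (simp add: eval_nat_numeral)
  have "((\<lambda>s. 64 * (stereo_field i (u + s *\<^sub>R axis j (1::real)) $ j * inverse (qq (u + s *\<^sub>R axis j (1::real))) ^ 3)) has_real_derivative
     64 * (u $ i / 2 * inverse (qq (u + 0 *\<^sub>R axis j (1::real))) ^ 3 + (- 6 * u $ j * inverse (qq u) ^ 4) * stereo_field i (u + 0 *\<^sub>R axis j (1::real)) $ j)) (at 0)"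
    by (intro DERIV_cmult DERIV_mult d1 d3)
  thus ?thesis by (simp add: algebra_simps)
qed

text \<open>Left-invariant fields preserve the volume form. In coordinates, the field weighted with
  the density is divergence free, so the derivative of \<open>f\<close> times the density is itself
  a divergence, and each of its three partial derivatives integrates to zero.\<close>

lemma integral_lie:
  fixes f :: "cmat2 \<Rightarrow> real"
  assumes f: "smooth_near f" shows "integral_SU2 (lie i f) = 0"
proof -
  define P where "P j u = 64 * (stereo_field i u $ j) * inverse (qq u) ^ 3" for j u
  define P' where "P' j u = 64 * (u $ i / 2 * inverse (qq u) ^ 3 - 6 * u $ j * stereo_field i u $ j * inverse (qq u) ^ 4)" for j u
  define Df where "Df j u = frechet_derivative f (at (stereo u)) (stereo_deriv u (axis j 1))" for j u
  define F where "F j u = f (stereo u) * P j u" for j u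
  define F' where "F' j u = f (stereo u) * P' j u + Df j u * P j u" for j u
  note fD = smooth_near_has_derivative[OF f stereo_SU2]
  have cf: "continuous_on UNIV (\<lambda>u. f (stereo u))"
    by (intro continuous_on_stereo_comp smooth_near_continuous_on f)
  have cV: "continuous_on UNIV (\<lambda>u. stereo_field i u $ j)" for j
    unfolding stereo_field_def by (intro continuous_intros bounded_linear.continuous_on[OF bounded_linear_vec_nth]
      bounded_linear.continuous_on[OF bilinear_conv_bounded_bilinear[THEN iffD1, OF bilinear_cross, THEN bounded_bilinear.bounded_linear_left]])
  have cP: "continuous_on UNIV (P j)" for j
    unfolding P_def[abs_def] by (intro continuous_intros cV) simp
  have cP': "continuous_on UNIV (P' j)" for j
    unfolding P'_def[abs_def] by (intro continuous_intros cV) simp_all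
  have cDf: "continuous_on UNIV (Df j)" for j
  proof -
    have "continuous_on UNIV (\<lambda>u. stereo_deriv u (axis j 1))"
      unfolding stereo_deriv_def by (intro continuous_intros continuous_on_stereo) simp_all
    hence "continuous_on UNIV (\<lambda>u. \<Sum>b\<in>Basis. (stereo_deriv u (axis j 1) \<bullet> b) *\<^sub>R frechet_derivative f (at (stereo u)) b)"
      by (intro continuous_on_sum continuous_on_scaleR continuous_on_inner continuous_on_const continuous_on_stereo_comp
         smooth_near_continuous_on smooth_near_frechet f)
    moreover have "Df j = (\<lambda>u. \<Sum>b\<in>Basis. (stereo_deriv u (axis j 1) \<bullet> b) *\<^sub>R frechet_derivative f (at (stereo u)) b)"
      unfolding Df_def by (rule ext) (rule frechet_basis_sum[OF fD])
    ultimately show ?thesis by (simp only:)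
  qed
  obtain B where B: "B \<ge> 0" "\<And>x. x \<in> SU2 \<Longrightarrow> norm (f x) \<le> B"
    using bounded_SU2[OF smooth_near_continuous_on[OF f]] by blast
  obtain K where K: "K \<ge> 0" "\<And>x v. x \<in> SU2 \<Longrightarrow> norm (frechet_derivative f (at x) v) \<le> K * norm v"
    using smooth_near_derivative_bound[OF f] by blast
  \<comment> \<open>With |V_j|, |u_i|, |u_j| all at most qq, the two parts of \<open>P'\<close>
    contribute 64 * 1 and 64 * 6, in total 448.\<close>
  have Pb: "\<bar>P j u\<bar> \<le> 64 / (qq u)\<^sup>2" and P'b: "\<bar>P' j u\<bar> \<le> 448 / (qq u)\<^sup>2" for j u
  proof -
    define Q where "Q = qq u"
    have Q: "Q > 0" "\<bar>stereo_field i u $ j\<bar> \<le> Q" "\<bar>u $ i\<bar> \<le> Q" "\<bar>u $ j\<bar> \<le> Q"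
      using stereo_field_le norm_le_qq(1) component_le_norm_cart order_trans unfolding Q_def by (simp, blast+)
    have "\<bar>P j u\<bar> \<le> 64 * Q * inverse Q ^ 3"
      unfolding P_def Q_def[symmetric] abs_mult using Q by (intro mult_mono) auto
    thus "\<bar>P j u\<bar> \<le> 64 / (qq u)\<^sup>2" using Q(1) unfolding Q_def[symmetric] by (simp add: field_simps eval_nat_numeral)
    have "\<bar>P' j u\<bar> \<le> 64 * (\<bar>u $ i / 2 * inverse Q ^ 3\<bar> + \<bar>6 * u $ j * stereo_field i u $ j * inverse Q ^ 4\<bar>)"
      unfolding P'_def Q_def[symmetric] abs_mult[of 64] by (intro mult_mono abs_triangle_ineq4) auto
    also have "\<dots> \<le> 64 * (Q * inverse Q ^ 3 + 6 * Q * Q * inverse Q ^ 4)"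
      unfolding abs_mult using Q by (intro mult_mono add_mono) auto
    also have "\<dots> = 448 / Q\<^sup>2" using Q(1) by (simp add: field_simps eval_nat_numeral)
    finally show "\<bar>P' j u\<bar> \<le> 448 / (qq u)\<^sup>2" unfolding Q_def .
  qed
  have Dfb: "\<bar>Df j u\<bar> \<le> K * 8" for j u
    using K(2)[OF stereo_SU2, of u "stereo_deriv u (axis j 1)"]
      mult_left_mono[OF stereo_deriv_le[of "axis j 1" u] K(1)] unfolding Df_def by simp
  have zero: "(LINT u|lborel. F' j u) = 0" and int: "integrable lborel (F' j)" for j
  proof -
    define C where "C = B * 448 + K * 8 * 64"
    have b1: "\<bar>F j u\<bar> \<le> C / (qq u)\<^sup>2" for u
    proof -
      have "\<bar>F j u\<bar> \<le> B * (64 / (qq u)\<^sup>2)"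
        unfolding F_def abs_mult using B(2)[OF stereo_SU2] Pb B(1) by (intro mult_mono) auto
      also have "\<dots> \<le> C / (qq u)\<^sup>2"
        unfolding times_divide_eq_right C_def using B(1) K(1) by (intro divide_right_mono) auto
      finally show ?thesis .
    qed
    have b2: "\<bar>F' j u\<bar> \<le> C / (qq u)\<^sup>2" for u
    proof -
      have "\<bar>F' j u\<bar> \<le> \<bar>f (stereo u) * P' j u\<bar> + \<bar>Df j u * P j u\<bar>"
        unfolding F'_def by (rule abs_triangle_ineq)
      also have "\<dots> \<le> B * (448 / (qq u)\<^sup>2) + K * 8 * (64 / (qq u)\<^sup>2)"
        unfolding abs_mult using B(2)[OF stereo_SU2] Pb P'b B(1) K(1) Dfb
        by (intro add_mono mult_mono) auto
      finally show ?thesis by (simp add: C_def add_divide_distrib)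
    qed
    have cF': "continuous_on UNIV (F' j)" and cF: "continuous_on UNIV (F j)"
      unfolding F'_def[abs_def] F_def[abs_def] by (intro continuous_intros cf cP cP' cDf)+
    show "integrable lborel (F' j)"
      by (rule integrable_bound_qq[OF b2 borel_measurable_continuous_onI[OF cF']])
    show "(LINT u|lborel. F' j u) = 0"
    proof (rule integral_partial_derivative_zero[where e="axis j 1" and F="F j" and C=C])
      fix u :: "real^3"
      have "((\<lambda>s. u + s *\<^sub>R axis j (1::real)) has_derivative (\<lambda>s. s *\<^sub>R axis j (1::real))) (at 0)"
        by (auto intro!: derivative_eq_intros)
      hence "((\<lambda>s. stereo (u + s *\<^sub>R axis j (1::real))) has_derivative (\<lambda>s. stereo_deriv u (s *\<^sub>R axis j (1::real)))) (at 0)"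
        by (rule has_derivative_compose) (simp add: stereo_has_derivative)
      hence "((\<lambda>s. f (stereo (u + s *\<^sub>R axis j (1::real)))) has_derivative (\<lambda>s. frechet_derivative f (at (stereo u)) (stereo_deriv u (s *\<^sub>R axis j (1::real))))) (at 0)"
        by (rule has_derivative_compose) (simp add: fD)
      moreover have "frechet_derivative f (at (stereo u)) (stereo_deriv u (s *\<^sub>R axis j (1::real))) = s * Df j u" for s
        using linear_scale[OF has_derivative_linear[OF stereo_has_derivative], of u s "axis j 1"]
          linear_scale[OF has_derivative_linear[OF fD], of u s "stereo_deriv u (axis j 1)"] by (simp add: Df_def)
      ultimately have "((\<lambda>s. f (stereo (u + s *\<^sub>R axis j (1::real)))) has_real_derivative Df j u) (at 0)"
        by (simp add: has_field_derivative_def mult_commute_abs)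
      from DERIV_mult[OF this stereo_field_density_deriv[of i u j, folded P_def P'_def]]
      show "((\<lambda>s. F j (u + s *\<^sub>R axis j (1::real))) has_real_derivative F' j u) (at 0)"
        unfolding F_def F'_def by (simp add: algebra_simps)
    qed (use b1 b2 cF borel_measurable_continuous_onI[OF cF'] in auto)
  qed
  have "lie i f (stereo u) * vol_density u = (\<Sum>j\<in>UNIV. F' j u)" for u
  proof -
    have "(\<Sum>j\<in>UNIV. Df j u * stereo_field i u $ j) = frechet_derivative f (at (stereo u)) (stereo_deriv u (\<Sum>j\<in>UNIV. stereo_field i u $ j *\<^sub>R axis j (1::real)))"
      using has_derivative_linear[OF stereo_has_derivative[of u]] has_derivative_linear[OF fD[of u]]
      by (simp add: linear_sum linear_scale Df_def mult.commute)
    also have "(\<Sum>j\<in>UNIV. stereo_field i u $ j *\<^sub>R axis j (1::real)) = stereo_field i u"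
      using basis_expansion[of "stereo_field i u"] by (simp add: scalar_mult_eq_scaleR)
    finally have 1: "(\<Sum>j\<in>UNIV. Df j u * stereo_field i u $ j) = lie i f (stereo u)"
      by (simp add: stereo_deriv_field lie_def)
    \<comment> \<open>Vanishing divergence: the field contributes 3 u_i / 2, and the derivative of
      qq^-3 contributes - 6 (u . V)/qq = - 6 u_i / 4 by \<open>inner_stereo_field\<close>.\<close>
    have 2: "(\<Sum>j\<in>UNIV. P' j u) = 0"
    proof -
      define Q where "Q = qq u"
      have Q0: "Q \<noteq> 0" unfolding Q_def by simp
      have s: "u $ 1 * stereo_field i u $ 1 + u $ 2 * stereo_field i u $ 2 + u $ 3 * stereo_field i u $ 3 = u $ i * Q / 4"
        using inner_stereo_field[of u i] unfolding Q_def[symmetric] by (simp add: inner_vec_def sum_3)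
      have "(\<Sum>j\<in>UNIV. P' j u) = 64 * (3 * (u $ i / 2 * inverse Q ^ 3) - 6 * (u $ 1 * stereo_field i u $ 1 + u $ 2 * stereo_field i u $ 2 + u $ 3 * stereo_field i u $ 3) * inverse Q ^ 4)"
        unfolding P'_def Q_def[symmetric] sum_3 by (simp add: algebra_simps)
      also have "\<dots> = 0" unfolding s using Q0 by (simp add: field_simps eval_nat_numeral)
      finally show ?thesis .
    qed
    have "(\<Sum>j\<in>UNIV. F' j u) = f (stereo u) * (\<Sum>j\<in>UNIV. P' j u) + 64 * inverse (qq u) ^ 3 * (\<Sum>j\<in>UNIV. Df j u * stereo_field i u $ j)"
      unfolding F'_def P_def by (simp only: sum.distrib sum_distrib_left) (simp add: mult_ac)
    thus ?thesis unfolding 1 2 vol_density_eq by (simp add: divide_inverse power_inverse)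
  qed
  hence "integral_SU2 (lie i f) = (LINT u|lborel. (\<Sum>j\<in>UNIV. F' j u))" by (simp add: integral_SU2_def)
  also have "\<dots> = (\<Sum>j\<in>UNIV. LINT u|lborel. F' j u)" by (intro Bochner_Integration.integral_sum int)
  finally show ?thesis by (simp add: zero)
qed

text \<open>Dominated convergence: by the mean value theorem the difference quotients are values of
  \<open>G'\<close>, which compactness of SU(2) and of a parameter interval bounds
  uniformly.\<close>

lemma integral_SU2_has_derivative:
  fixes G G' :: "real \<Rightarrow> cmat2 \<Rightarrow> real"
  assumes \<delta>: "\<delta> > 0"
    and d: "\<And>h x. \<bar>h\<bar> < \<delta> \<Longrightarrow> x \<in> SU2 \<Longrightarrow> ((\<lambda>h. G h x) has_real_derivative G' h x) (at h)"
    and G': "continuous_on ({-\<delta><..<\<delta>} \<times> SU2) (\<lambda>(h, x). G' h x)"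
    and G: "\<And>h. \<bar>h\<bar> < \<delta> \<Longrightarrow> continuous_on SU2 (G h)"
  shows "((\<lambda>h. integral_SU2 (G h)) has_real_derivative integral_SU2 (G' 0)) (at 0)"
proof -
  \<comment> \<open>Half the radius, to have a compact interval inside the open one.\<close>
  define \<eta> where "\<eta> = \<delta> / 2"
  have \<eta>: "\<eta> > 0" "\<eta> < \<delta>" using \<delta> by (auto simp: \<eta>_def)
  have "compact ({-\<eta>..\<eta>} \<times> SU2)" by (intro compact_Times compact_SU2) simp
  moreover have "continuous_on ({-\<eta>..\<eta>} \<times> SU2) (\<lambda>(h, x). G' h x)"
    using \<eta> by (intro continuous_on_subset[OF G']) auto
  ultimately have "bounded ((\<lambda>(h, x). G' h x) ` ({-\<eta>..\<eta>} \<times> SU2))"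
    using compact_continuous_image compact_imp_bounded by blast
  then obtain B where B: "\<And>h x. h \<in> {-\<eta>..\<eta>} \<Longrightarrow> x \<in> SU2 \<Longrightarrow> \<bar>G' h x\<bar> \<le> B"
    unfolding bounded_iff by fastforce
  have B0: "B \<ge> 0" using B[of 0 "mat 1"] SU2_mat1 \<eta> abs_ge_zero[of "G' 0 (mat 1)"] by simp
  have q: "\<bar>(G h x - G 0 x) / h\<bar> \<le> B" if h: "\<bar>h\<bar> < \<eta>" "h \<noteq> 0" and x: "x \<in> SU2" for h x
  proof -
    have "\<exists>z. \<bar>z\<bar> < \<eta> \<and> (G h x - G 0 x) / h = G' z x"
    proof (cases "h > 0")
      case True
      have "\<exists>z. 0 < z \<and> z < h \<and> G h x - G 0 x = (h - 0) * G' z x"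
        by (rule MVT2[OF True]) (use h x \<eta> d in auto)
      then obtain z where z: "0 < z" "z < h" "G h x - G 0 x = h * G' z x" by auto
      thus ?thesis using h by (intro exI[of _ z]) auto
    next
      case False
      hence h0: "h < 0" using h by simp
      have "\<exists>z. h < z \<and> z < 0 \<and> G 0 x - G h x = (0 - h) * G' z x"
        by (rule MVT2[OF h0]) (use h x \<eta> d in auto)
      then obtain z where z: "h < z" "z < 0" "G 0 x - G h x = (0 - h) * G' z x" by auto
      hence "G h x - G 0 x = h * G' z x" by simp
      thus ?thesis using z(1,2) h by (intro exI[of _ z]) auto
    qed
    then obtain z where "\<bar>z\<bar> < \<eta>" "(G h x - G 0 x) / h = G' z x" by blast
    thus ?thesis using B[of z x] x by (auto simp: abs_if split: if_splits)
  qed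
  have cG'0: "continuous_on SU2 (G' 0)"
  proof -
    have "continuous_on SU2 (\<lambda>x. (\<lambda>(h, x). G' h x) (0, x))"
      by (rule continuous_on_compose2[OF G']) (use \<delta> in \<open>auto intro!: continuous_intros\<close>)
    thus ?thesis by simp
  qed
  have mb: "(\<lambda>u. f (stereo u) * vol_density u :: real) \<in> borel_measurable lborel" if "continuous_on SU2 f" for f
    using integrable_SU2[OF that] by blast
  show ?thesis unfolding has_field_derivative_iff
  proof (subst tendsto_at_iff_sequentially, intro allI impI)
    fix X0 :: "nat \<Rightarrow> real" assume X0: "\<forall>i. X0 i \<in> UNIV - {0}" "X0 \<longlonglongrightarrow> 0"
    obtain N where N: "\<And>n. n \<ge> N \<Longrightarrow> \<bar>X0 n\<bar> < \<eta>"
      using LIMSEQ_D[OF X0(2) \<eta>(1)] by auto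
    \<comment> \<open>Dropping the first \<open>N\<close> terms brings the whole sequence into the
      range of the uniform bound.\<close>
    define X where "X n = X0 (n + N)" for n
    have X: "\<bar>X n\<bar> < \<eta>" "X n \<noteq> 0" for n using N X0 by (auto simp: X_def)
    have Xl: "X \<longlonglongrightarrow> 0" unfolding X_def by (rule LIMSEQ_ignore_initial_segment[OF X0(2)])
    have "(\<lambda>n. LINT u|lborel. (G (X n) (stereo u) - G 0 (stereo u)) / X n * vol_density u) \<longlonglongrightarrow> (LINT u|lborel. G' 0 (stereo u) * vol_density u)"
    proof (rule integral_dominated_convergence)
      show "integrable lborel (\<lambda>u. B * vol_density u)" using integrable_SU2[of "\<lambda>_. B"] by simp
      show "(\<lambda>u. G' 0 (stereo u) * vol_density u) \<in> borel_measurable lborel" by (rule mb[OF cG'0])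
      show "(\<lambda>u. (G (X n) (stereo u) - G 0 (stereo u)) / X n * vol_density u) \<in> borel_measurable lborel" for n
        by (rule mb) (use X[of n] \<eta> \<delta> in \<open>auto intro!: continuous_intros G\<close>)
      show "AE u in lborel. norm ((G (X n) (stereo u) - G 0 (stereo u)) / X n * vol_density u) \<le> B * vol_density u" for n
        using q[OF X stereo_SU2] vol_density_le(1) B0 by (intro AE_I2) (simp only: real_norm_def abs_mult, intro mult_mono; simp)
      show "AE u in lborel. (\<lambda>n. (G (X n) (stereo u) - G 0 (stereo u)) / X n * vol_density u) \<longlonglongrightarrow> G' 0 (stereo u) * vol_density u"
      proof (rule AE_I2)
        fix u
        have "((\<lambda>h. (G h (stereo u) - G 0 (stereo u)) / h) \<longlongrightarrow> G' 0 (stereo u)) (at 0)"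
          using d[of 0 "stereo u"] \<delta> stereo_SU2 by (simp add: has_field_derivative_iff)
        moreover have "filterlim X (at 0) sequentially" using Xl X(2) by (auto simp: filterlim_at)
        ultimately have "(\<lambda>n. (G (X n) (stereo u) - G 0 (stereo u)) / X n) \<longlonglongrightarrow> G' 0 (stereo u)"
          by (rule filterlim_compose)
        thus "(\<lambda>n. (G (X n) (stereo u) - G 0 (stereo u)) / X n * vol_density u) \<longlonglongrightarrow> G' 0 (stereo u) * vol_density u"
          by (rule tendsto_mult_right)
      qed
    qed
    moreover have "(LINT u|lborel. (G (X n) (stereo u) - G 0 (stereo u)) / X n * vol_density u) = (integral_SU2 (G (X n)) - integral_SU2 (G 0)) / X n" for n
    proof -
      have "(LINT u|lborel. (G (X n) (stereo u) - G 0 (stereo u)) / X n * vol_density u) = integral_SU2 (\<lambda>x. inverse (X n) * (G (X n) x - G 0 x))"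
        by (simp add: integral_SU2_def divide_inverse mult.commute mult.left_commute)
      also have "\<dots> = inverse (X n) * (integral_SU2 (G (X n)) - integral_SU2 (G 0))"
        using X(1)[of n] \<eta> \<delta> by (subst integral_SU2_cmult, subst integral_SU2_diff) (auto intro!: G)
      finally show ?thesis by (simp add: divide_inverse)
    qed
    ultimately have "(\<lambda>n. (integral_SU2 (G (X0 (n + N))) - integral_SU2 (G 0)) / X0 (n + N)) \<longlonglongrightarrow> integral_SU2 (G' 0)"
      by (simp only: integral_SU2_def[symmetric, of "G' 0"]) (simp only: X_def)
    thus "((\<lambda>y. (integral_SU2 (G y) - integral_SU2 (G 0)) / (y - 0)) \<circ> X0) \<longlonglongrightarrow> integral_SU2 (G' 0)"
      using LIMSEQ_offset[of "\<lambda>n. (integral_SU2 (G (X0 n)) - integral_SU2 (G 0)) / X0 n" N] by (simp add: o_def)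
  qed
qed


section \<open>The energy in terms of unit vector fields\<close>

lemma bounded_bilinear_matmul: "bounded_bilinear (\<lambda>(A::cmat2) (B::cmat2). A ** B)"
  unfolding bilinear_conv_bounded_bilinear[symmetric] bilinear_def
  by (intro conjI allI linearI) (simp_all add: cmat2_eq_iff matmul_nth algebra_simps)

lemma bounded_linear_ctransp: "bounded_linear ctransp"
  unfolding linear_conv_bounded_linear[symmetric]
  by (rule linearI) (simp_all add: cmat2_eq_iff)

lemma bounded_bilinear_cross3: "bounded_bilinear cross3"
  using bilinear_cross bilinear_conv_bounded_bilinear by blast

lemma ctransp_theta: "ctransp (theta i) = - theta i"
  using exhaust_3[of i] by (auto simp: cmat2_eq_iff theta_nth)

lemma frechet_conj_by:
  "((\<lambda>x. conj_by x A) has_derivative (\<lambda>v. x ** A ** ctransp v + v ** A ** ctransp x)) (at x)"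
  unfolding conj_by_def
  by (rule has_derivative_eq_rhs, (rule bounded_bilinear.FDERIV[OF bounded_bilinear_matmul] bounded_linear_imp_has_derivative
     bounded_linear_ctransp has_derivative_ident has_derivative_const)+) (simp add: fun_eq_iff cmat2_eq_iff matmul_nth)

lemma smooth_near_conj_by: "smooth_near (\<lambda>x. conj_by x A)"
  unfolding conj_by_def
  by (intro smooth_near_bilinear[OF bounded_bilinear_matmul] smooth_near_const smooth_near_linear bounded_linear_ctransp bounded_linear_ident)

text \<open>The derivative of Ad is ad; the sign comes from \<open>theta i\<close> being
  skew-Hermitian.\<close>

lemma lie_conj_by: "lie i (\<lambda>x. conj_by x A) x = conj_by x (ad (theta i) A)"
proof -
  have "lie i (\<lambda>x. conj_by x A) x = x ** A ** ctransp (frame i x) + frame i x ** A ** ctransp x"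
    using lie_eqI[OF frechet_conj_by] .
  also have "\<dots> = conj_by x (ad (theta i) A)"
    by (simp add: frame_def ctransp_mult ctransp_theta ad_def conj_by_def)
       (simp add: cmat2_eq_iff matmul_nth algebra_simps)
  finally show ?thesis .
qed

section \<open>The quotient as the unit sphere of R^3\<close>

lemma conj_by_SU1U1: "k \<in> SU1U1 \<Longrightarrow> conj_by k (theta 3) = theta 3"
proof -
  assume k: "k \<in> SU1U1"
  hence "k ** theta 3 = theta 3 ** k" by (simp add: SU1U1_def cmat2_eq_iff matmul_nth theta_nth)
  hence "conj_by k (theta 3) = theta 3 ** (k ** ctransp k)" by (simp add: conj_by_def matrix_mul_assoc)
  thus ?thesis using k SU2_inverse(1)[of k] by (simp add: SU1U1_def)
qed

lemma hopf_self: "g \<in> hopf g"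
proof -
  have "mat 1 \<in> SU1U1" using SU2_mat1 by (simp add: SU1U1_def mat_def)
  thus ?thesis unfolding hopf_def by (metis image_eqI matrix_mul_rid)
qed

lemma rep_SU2: assumes "p \<in> quot_N" shows "rep p \<in> SU2"
proof -
  obtain g where g: "g \<in> SU2" "p = hopf g" using assms by (auto simp: quot_N_def)
  have "rep p \<in> p" unfolding rep_def using hopf_self[of g] g(2) by (metis someI_ex)
  then obtain k where "k \<in> SU1U1" "rep p = g ** k" unfolding g(2) hopf_def by blast
  thus ?thesis using g(1) SU2_mult by (auto simp: SU1U1_def)
qed

lemma emb_rep: "emb p = conj_by (rep p) (theta 3)"
  by (simp add: emb_def conj_by_def)

text \<open>\<open>rep\<close> chooses some element of the coset. It differs from \<open>g\<close>
  by a factor in \<open>SU1U1\<close>, which commutes with \<open>theta 3\<close>.\<close>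

lemma emb_hopf: assumes "g \<in> SU2" shows "emb (hopf g) = conj_by g (theta 3)"
proof -
  have "rep (hopf g) \<in> hopf g" unfolding rep_def using hopf_self by (rule someI)
  then obtain k where "k \<in> SU1U1" "rep (hopf g) = g ** k" unfolding hopf_def by blast
  thus ?thesis by (simp add: emb_rep conj_by_mult conj_by_SU1U1)
qed

text \<open>The derivative within SU(2) chosen by \<open>diff_map\<close> is determined in the
  directions \<open>frame i x\<close> by \<open>tangential_derivative_unique\<close>, and by
  linearity in all their combinations. Any extension therefore computes it.\<close>

lemma diff_map_lie:
  assumes f: "smooth_near f" and e: "\<And>y. y \<in> SU2 \<Longrightarrow> emb (\<phi> y) = f y" and x: "x \<in> SU2"
  shows "diff_map \<phi> x (frame i x) = lie i f x"
    "diff_map \<phi> x (x ** mat3 c) = (\<Sum>i\<in>UNIV. c $ i *\<^sub>R lie i f x)"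
proof -
  have d: "((\<lambda>y. emb (\<phi> y)) has_derivative frechet_derivative f (at x)) (at x within SU2)"
    by (rule has_derivative_transform[OF x e has_derivative_at_withinI[OF smooth_near_has_derivative[OF f x]]]) simp
  hence d': "((\<lambda>y. emb (\<phi> y)) has_derivative frechet_derivative (\<lambda>y. emb (\<phi> y)) (at x within SU2)) (at x within SU2)"
    using frechet_derivative_works differentiable_def by blast
  show 1: "diff_map \<phi> x (frame i x) = lie i f x" for i
    unfolding diff_map_def lie_def by (rule tangential_derivative_unique[OF x d' d])
  have l: "linear (diff_map \<phi> x)" unfolding diff_map_def[abs_def] using d' has_derivative_linear by blast
  have "x ** mat3 c = (\<Sum>i\<in>UNIV. c $ i *\<^sub>R frame i x)"
    by (simp add: sum_3 frame_def cmat2_eq_iff matmul_nth mat3_def algebra_simps)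
  thus "diff_map \<phi> x (x ** mat3 c) = (\<Sum>i\<in>UNIV. c $ i *\<^sub>R lie i f x)"
    by (simp only: linear_sum[OF l] linear_scale[OF l] 1)
qed

lemma diff_map_hopf:
  assumes "x \<in> SU2" shows "diff_map hopf x (x ** mat3 c) = mat3 (rot x (cross3 (axis 3 1) c))"
proof -
  have "diff_map hopf x (x ** mat3 c) = (\<Sum>i\<in>UNIV. c $ i *\<^sub>R lie i (\<lambda>x. conj_by x (theta 3)) x)"
    by (rule diff_map_lie[OF smooth_near_conj_by emb_hopf assms])
  also have "\<dots> = conj_by x (ad (mat3 c) (theta 3))"
    unfolding lie_conj_by linear_sum[OF linear_conj_by, symmetric] linear_scale[OF linear_conj_by, symmetric]
    by (rule arg_cong[where f="conj_by x"]) (simp add: sum_3 cmat2_eq_iff ad_def matmul_nth mat3_def algebra_simps)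
  also have "ad (mat3 c) (theta 3) = mat3 (cross3 (axis 3 1) c)"
    unfolding mat3_axis[symmetric] ad_mat3 by (simp add: cross_skew[of c])
  finally show ?thesis by (simp add: mat3_rot assms)
qed

lemma p_space_iff: "X \<in> p_space \<longleftrightarrow> (\<exists>c. X = mat3 c \<and> c $ 3 = 0)"
proof
  assume "X \<in> p_space"
  then obtain a b where "X = a *\<^sub>R theta 1 + b *\<^sub>R theta 2"
    by (auto simp: p_space_def span_insert algebra_simps)
  hence "X = mat3 (vector [a, b, 0])" by (simp add: mat3_def sum_3)
  thus "\<exists>c. X = mat3 c \<and> c $ 3 = 0" by (intro exI[of _ "vector [a, b, 0]"]) simp
next
  assume "\<exists>c. X = mat3 c \<and> c $ 3 = 0"
  then obtain c :: "real^3" where "X = c $ 1 *\<^sub>R theta 1 + c $ 2 *\<^sub>R theta 2" by (auto simp: mat3_def sum_3)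
  thus "X \<in> p_space" unfolding p_space_def by (simp only:) (intro span_add span_scale span_base; simp)
qed

lemma mat3_inject: "mat3 a = mat3 b \<longleftrightarrow> a = b"
  by (metis coord_mat3)

lemma rot_inject: assumes "x \<in> SU2" shows "rot x a = rot x b \<longleftrightarrow> a = b"
  by (metis assms mat3_rot conj_by_inverse(1) mat3_inject)

lemma rot_surj: assumes "x \<in> SU2" obtains b where "a = rot x b"
proof
  show "a = rot x (rot (ctransp x) a)"
    by (metis assms SU2_ctransp mat3_rot conj_by_inverse(2) mat3_inject)
qed

text \<open>On the plane orthogonal to the third axis these are two opposite quarter turns. By
  \<open>diff_map_hopf\<close> one of them is the differential of the Hopf map up to rotation, so
  the other gives the horizontal lift.\<close>

lemma cross3_axis3_twice: "c $ 3 = 0 \<Longrightarrow> cross3 (axis 3 1) (cross3 c (axis 3 1)) = c"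
  by (simp add: cross3_def vec3_eq_iff axis_def)

lemma hor_lift_eq:
  assumes x: "x \<in> SU2" and c: "c $ 3 = 0"
  shows "hor_lift x (mat3 (rot x c)) = mat3 (cross3 c (axis 3 1))"
  unfolding hor_lift_def
proof (rule the_equality)
  show "mat3 (cross3 c (axis 3 1)) \<in> p_space \<and> diff_map hopf x (x ** mat3 (cross3 c (axis 3 1))) = mat3 (rot x c)"
    unfolding p_space_iff diff_map_hopf[OF x] cross3_axis3_twice[of c, OF c]
    by (auto simp: cross3_def axis_def intro!: exI[of _ "cross3 c (axis 3 1)"])
next
  fix X assume X: "X \<in> p_space \<and> diff_map hopf x (x ** X) = mat3 (rot x c)"
  then obtain d where d: "X = mat3 d" "d $ 3 = 0" unfolding p_space_iff by blast
  have "cross3 (axis 3 1) d = c" using X unfolding d(1) diff_map_hopf[OF x] mat3_inject rot_inject[OF x] by blast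
  hence "cross3 c (axis 3 1) = d" using d(2) by (auto simp: cross3_def vec3_eq_iff axis_def)
  thus "X = mat3 (cross3 c (axis 3 1))" by (simp add: d(1))
qed

text \<open>On horizontal vectors the differential of the Hopf map is a quarter turn followed by a
  rotation, hence an isometry: \<open>emb\<close> turns the quotient metric into the round metric of
  the unit sphere. The Kaehler form becomes minus the area form; the energy contains its
  square.\<close>

lemma metric_kaehler_eq:
  assumes p: "p \<in> quot_N" and N: "emb p = mat3 N" and v: "v \<bullet> N = 0" and w: "w \<bullet> N = 0"
  shows "metric_N p (mat3 v) (mat3 w) = v \<bullet> w" "kaehler_N p (mat3 v) (mat3 w) = - (N \<bullet> cross3 v w)"
proof -
  define x where "x = rep p"
  have x: "x \<in> SU2" using rep_SU2[OF p] by (simp add: x_def)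
  have "mat3 N = mat3 (rot x (axis 3 1))"
    using N[symmetric] x by (simp add: mat3_rot mat3_axis emb_rep x_def)
  hence Nr: "N = rot x (axis 3 1)" by (simp add: mat3_inject)
  have key: "metric_N p (mat3 v) (mat3 w) = v \<bullet> w" if v: "v \<bullet> N = 0" and w: "w \<bullet> N = 0" for v w
  proof -
    obtain a b where ab: "v = rot x a" "w = rot x b" using rot_surj[OF x] by metis
    have ab3: "a $ 3 = 0" "b $ 3 = 0" using v w unfolding ab Nr rot_inner[OF x] by (simp_all add: inner_axis)
    have "metric_N p (mat3 v) (mat3 w) = metric_SU2 (x ** mat3 (cross3 a (axis 3 1))) (x ** mat3 (cross3 b (axis 3 1)))"
      unfolding metric_N_def x_def[symmetric] ab hor_lift_eq[OF x ab3(1)] hor_lift_eq[OF x ab3(2)] ..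
    also have "\<dots> = cross3 a (axis 3 1) \<bullet> cross3 b (axis 3 1)"
      unfolding metric_mat3[symmetric] by (simp add: metric_SU2_def inner_SU2_left x)
    also have "\<dots> = a \<bullet> b" using ab3 by (simp add: cross3_def axis_def inner_vec_def sum_3)
    finally show ?thesis unfolding ab rot_inner[OF x] .
  qed
  from key[OF v w] show "metric_N p (mat3 v) (mat3 w) = v \<bullet> w" .
  obtain a where a: "v = rot x a" using rot_surj[OF x] by metis
  have a3: "a $ 3 = 0" using v unfolding a Nr rot_inner[OF x] by (simp add: inner_axis)
  \<comment> \<open>\<open>ad (theta 3)\<close> is a quarter turn of the horizontal plane; the
    rotation carries it to v -> v x N.\<close>
  have "J_N p (mat3 v) = diff_map hopf x (x ** ad (theta 3) (mat3 (cross3 a (axis 3 1))))"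
    unfolding J_N_def x_def[symmetric] a hor_lift_eq[OF x a3] ..
  also have "ad (theta 3) (mat3 (cross3 a (axis 3 1))) = mat3 (- a)"
    unfolding mat3_axis[symmetric] ad_mat3 cross3_axis3_twice[OF a3] ..
  also have "diff_map hopf x (x ** mat3 (- a)) = mat3 (rot x (cross3 a (axis 3 1)))"
    unfolding diff_map_hopf[OF x] by (simp add: cross_skew[of _ a])
  also have "rot x (cross3 a (axis 3 1)) = cross3 v N" by (simp add: a Nr rot_cross x)
  finally have J: "J_N p (mat3 v) = mat3 (cross3 v N)" .
  have "kaehler_N p (mat3 v) (mat3 w) = cross3 v N \<bullet> w"
    unfolding kaehler_N_def J by (rule key) (simp_all add: dot_cross_self w)
  also have "\<dots> = - (N \<bullet> cross3 v w)" by (simp add: cross3_simps)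
  finally show "kaehler_N p (mat3 v) (mat3 w) = - (N \<bullet> cross3 v w)" .
qed

text \<open>The pullback of the area form by a map \<open>n\<close> into the unit sphere of real^3.\<close>
definition omega :: "3 \<Rightarrow> 3 \<Rightarrow> (cmat2 \<Rightarrow> real^3) \<Rightarrow> cmat2 \<Rightarrow> real" where
  "omega i j n x = n x \<bullet> cross3 (lie i n x) (lie j n x)"

definition energy_density :: "real \<Rightarrow> (cmat2 \<Rightarrow> real^3) \<Rightarrow> cmat2 \<Rightarrow> real" where
  "energy_density \<alpha> n x = lie 1 n x \<bullet> lie 1 n x + lie 2 n x \<bullet> lie 2 n x + lie 3 n x \<bullet> lie 3 n x
     + \<alpha> * ((omega 1 2 n x)\<^sup>2 + (omega 1 3 n x)\<^sup>2 + (omega 2 3 n x)\<^sup>2)"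

lemma smooth_near_inner: "smooth_near f \<Longrightarrow> smooth_near g \<Longrightarrow> smooth_near (\<lambda>x. f x \<bullet> g x)"
  and smooth_near_cross: "smooth_near m \<Longrightarrow> smooth_near n \<Longrightarrow> smooth_near (\<lambda>x. cross3 (m x) (n x))"
  and smooth_near_mult: "smooth_near a \<Longrightarrow> smooth_near b \<Longrightarrow> smooth_near (\<lambda>x. a x * b x)" for a b :: "cmat2 \<Rightarrow> 'c::real_normed_algebra"
  by (rule smooth_near_bilinear[OF bounded_bilinear_inner] smooth_near_bilinear[OF bounded_bilinear_cross3]
     smooth_near_bilinear[OF bounded_bilinear_mult]; assumption)+

lemma lie_inner:
  "smooth_near f \<Longrightarrow> smooth_near g \<Longrightarrow> x \<in> SU2 \<Longrightarrow> lie i (\<lambda>x. f x \<bullet> g x) x = f x \<bullet> lie i g x + lie i f x \<bullet> g x"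
  by (rule lie_bilinear[OF bounded_bilinear_inner])

lemma lie_cross:
  "smooth_near f \<Longrightarrow> smooth_near g \<Longrightarrow> x \<in> SU2 \<Longrightarrow> lie i (\<lambda>x. cross3 (f x) (g x)) x = cross3 (f x) (lie i g x) + cross3 (lie i f x) (g x)"
  by (rule lie_bilinear[OF bounded_bilinear_cross3])

lemma lie_sphere_orthogonal:
  assumes n: "smooth_near n" and u: "\<And>x. x \<in> SU2 \<Longrightarrow> n x \<bullet> n x = 1" and x: "x \<in> SU2"
  shows "lie i n x \<bullet> n x = 0"
proof -
  have "lie i (\<lambda>x. n x \<bullet> n x) x = lie i (\<lambda>x. 1 :: real) x"
    by (rule lie_cong) (simp_all add: smooth_near_inner n u x)
  thus ?thesis by (simp add: lie_inner n x inner_commute)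
qed

lemma emb_unit:
  assumes "p \<in> quot_N" obtains N where "emb p = mat3 N" "N \<bullet> N = 1"
proof
  have x: "rep p \<in> SU2" using rep_SU2[OF assms] .
  show "emb p = mat3 (rot (rep p) (axis 3 1))" using x by (simp add: mat3_rot mat3_axis emb_rep)
  show "rot (rep p) (axis 3 1) \<bullet> rot (rep p) (axis 3 1) = 1" by (simp add: rot_inner[OF x] inner_axis)
qed

text \<open>The double sum in \<open>norm_pullback_sq\<close> counts every pair of indices twice,
  which cancels its factor 1/2.\<close>

lemma energy_eq:
  assumes f: "smooth_near f" and \<phi>: "\<phi> ` SU2 \<subseteq> quot_N" and e: "\<And>x. x \<in> SU2 \<Longrightarrow> emb (\<phi> x) = f x"
  defines "n \<equiv> \<lambda>x. coord (f x)"
  shows "energy \<alpha> \<phi> = 1/2 * integral_SU2 (energy_density \<alpha> n)"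
proof -
  have n: "smooth_near n" unfolding n_def by (rule smooth_near_apply_linear[OF linear_coord f])
  have fn: "f x = mat3 (n x)" "n x \<bullet> n x = 1" if x: "x \<in> SU2" for x
  proof -
    obtain N where "emb (\<phi> x) = mat3 N" "N \<bullet> N = 1" using emb_unit[of "\<phi> x"] \<phi> x by blast
    thus "f x = mat3 (n x)" "n x \<bullet> n x = 1" using e[OF x] by (auto simp: n_def)
  qed
  have lf: "diff_map \<phi> x (frame i x) = mat3 (lie i n x)" if x: "x \<in> SU2" for x i
  proof -
    have "diff_map \<phi> x (frame i x) = lie i f x" by (rule diff_map_lie(1)[OF f e x])
    also have "\<dots> = lie i (\<lambda>x. mat3 (n x)) x"
      by (rule lie_cong[OF f smooth_near_apply_linear[OF linear_mat3 n] fn(1) x])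
    finally show ?thesis by (simp add: lie_apply_linear[OF linear_mat3 n x])
  qed
  have "norm_diff_sq \<phi> x + \<alpha> * norm_pullback_sq \<phi> x = energy_density \<alpha> n x" if x: "x \<in> SU2" for x
  proof -
    have p: "\<phi> x \<in> quot_N" using \<phi> x by blast
    have N: "emb (\<phi> x) = mat3 (n x)" using e[OF x] fn(1)[OF x] by simp
    note mk = metric_kaehler_eq[OF p N lie_sphere_orthogonal[OF n fn(2) x] lie_sphere_orthogonal[OF n fn(2) x]]
    have 1: "norm_diff_sq \<phi> x = (\<Sum>i\<in>UNIV. lie i n x \<bullet> lie i n x)"
      unfolding norm_diff_sq_def lf[OF x] by (simp only: mk)
    have 2: "norm_pullback_sq \<phi> x = 1/2 * (\<Sum>i\<in>UNIV. \<Sum>j\<in>UNIV. (omega i j n x)\<^sup>2)"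
      unfolding norm_pullback_sq_def lf[OF x] by (simp add: mk omega_def)
    have o: "omega i j n x = - omega j i n x" for i j
      unfolding omega_def by (metis cross_skew inner_minus_right)
    have "omega i i n x = 0" for i by (simp add: omega_def)
    thus ?thesis unfolding 1 2 energy_density_def sum_3
      by (simp add: o[of 2 1] o[of 3 1] o[of 3 2] power2_eq_square)
  qed
  thus ?thesis unfolding energy_def by (simp cong: integral_SU2_cong)
qed


section \<open>Families of maps\<close>

text \<open>\<open>par v\<close> differentiates in the parameter only and \<open>plie i\<close>
  along the left-invariant field with the parameter frozen. Variations are thereby computed with
  commuting derivations on the product space.\<close>

definition par :: "'q::euclidean_space \<Rightarrow> ('q \<times> cmat2 \<Rightarrow> 'b::real_normed_vector) \<Rightarrow> 'q \<times> cmat2 \<Rightarrow> 'b" where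
  "par v G z = frechet_derivative G (at z) (v, 0)"

definition plie :: "3 \<Rightarrow> ('q::euclidean_space \<times> cmat2 \<Rightarrow> 'b::real_normed_vector) \<Rightarrow> 'q \<times> cmat2 \<Rightarrow> 'b" where
  "plie i G z = frechet_derivative G (at z) (0, frame i (snd z))"

lemma bounded_linear_plie_field: "bounded_linear (\<lambda>z. (0, frame i (snd z)))"
  by (intro bounded_linear_Pair bounded_linear_zero bounded_linear_compose[OF bounded_linear_frame] bounded_linear_snd)

lemma Cinf_par: "Cinf U G \<Longrightarrow> Cinf U (par v G)"
  unfolding par_def[abs_def] by (rule Cinf_frechet)

lemma Cinf_plie: "open U \<Longrightarrow> Cinf U G \<Longrightarrow> Cinf U (plie i G)"
  unfolding plie_def[abs_def]
  by (rule Cinf_frechet_field[OF _ _ Cinf_linear[OF _ bounded_linear_plie_field]])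

text \<open>The field (0, frame i x) does not change in the parameter direction, so the first term
  of \<open>frechet_frechet_field\<close> vanishes.\<close>

lemma par_plie_commute:
  fixes G :: "'q::euclidean_space \<times> cmat2 \<Rightarrow> 'b::real_inner"
  assumes "open U" "Cinf U G" "z \<in> U" shows "par v (plie i G) z = plie i (par v G) z"
proof -
  have "linear (frechet_derivative G (at z))"
    using Cinf_has_derivative[OF assms(2,3)] has_derivative_linear by blast
  hence "frechet_derivative G (at z) (0, 0) = 0" using linear_0[of "frechet_derivative G (at z)"] by (simp only: zero_prod_def)
  moreover have "frame i 0 = 0" by (simp add: frame_def cmat2_eq_iff matmul_nth)
  ultimately show ?thesis
    using frechet_frechet_field[OF assms bounded_linear_plie_field, of i "(v, 0)"]
    by (simp add: par_def[abs_def] plie_def[abs_def])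
qed

lemma par_bilinear:
  "bounded_bilinear B \<Longrightarrow> Cinf U f \<Longrightarrow> Cinf U g \<Longrightarrow> z \<in> U \<Longrightarrow> par v (\<lambda>z. B (f z) (g z)) z = B (f z) (par v g z) + B (par v f z) (g z)"
  unfolding par_def by (subst frechet_eq[OF bounded_bilinear.FDERIV]) (auto intro: Cinf_has_derivative)

lemma par_add:
  "Cinf U f \<Longrightarrow> Cinf U g \<Longrightarrow> z \<in> U \<Longrightarrow> par v (\<lambda>z. f z + g z) z = par v f z + par v g z"
  unfolding par_def by (subst frechet_eq[OF has_derivative_add]) (auto intro: Cinf_has_derivative)

lemma par_const: "par v (\<lambda>z. c) z = 0"
  unfolding par_def using frechet_eq[OF has_derivative_const] by metis

lemma par_cong: "open U \<Longrightarrow> z \<in> U \<Longrightarrow> (\<And>y. y \<in> U \<Longrightarrow> f y = g y) \<Longrightarrow> par v f z = par v g z"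
  unfolding par_def using frechet_derivative_cong_open[of U z f g] by simp

lemmas par_inner = par_bilinear[OF bounded_bilinear_inner]
  and par_cross = par_bilinear[OF bounded_bilinear_cross3]
  and par_mult = par_bilinear[OF bounded_bilinear_mult]

lemmas Cinf_inner = Cinf_bilinear[OF _ bounded_bilinear_inner]
  and Cinf_cross = Cinf_bilinear[OF _ bounded_bilinear_cross3]
  and Cinf_mult = Cinf_bilinear[OF _ bounded_bilinear_mult]

lemma par_curve:
  assumes "Cinf U G" "(q + h *\<^sub>R v, x) \<in> U"
  shows "((\<lambda>h. G (q + h *\<^sub>R v, x)) has_vector_derivative par v G (q + h *\<^sub>R v, x)) (at h)"
proof -
  have 1: "((\<lambda>h. (q + h *\<^sub>R v, x)) has_derivative (\<lambda>h. (h *\<^sub>R v, 0))) (at h)"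
    by (auto intro!: derivative_eq_intros)
  note D = Cinf_has_derivative[OF assms]
  have "((\<lambda>h. G (q + h *\<^sub>R v, x)) has_derivative (\<lambda>k. frechet_derivative G (at (q + h *\<^sub>R v, x)) (k *\<^sub>R v, 0))) (at h)"
    using has_derivative_compose[OF 1 D] .
  moreover have "frechet_derivative G (at (q + h *\<^sub>R v, x)) (k *\<^sub>R v, 0) = k *\<^sub>R par v G (q + h *\<^sub>R v, x)" for k
    using linear_scale[OF has_derivative_linear[OF D], of k "(v, 0)"] by (simp add: par_def)
  ultimately show ?thesis by (simp add: has_vector_derivative_def)
qed

text \<open>\<open>U\<close> is the open domain of a smooth extension, as \<open>smooth_on\<close>
  supplies it. Geometric identities such as unit length hold on
  \<open>ball 0 \<epsilon> \<times> SU2\<close> only, which is not open in the product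
  space.\<close>

locale family_domain =
  fixes U :: "('q::euclidean_space \<times> cmat2) set" and \<epsilon> :: real
  assumes U: "open U" and \<epsilon>: "\<epsilon> > 0" and sub: "ball 0 \<epsilon> \<times> SU2 \<subseteq> U"
begin

lemma in_U: "norm q < \<epsilon> \<Longrightarrow> x \<in> SU2 \<Longrightarrow> (q, x) \<in> U"
  using sub by auto

lemma smooth_near_slice:
  assumes "Cinf U G" "norm q < \<epsilon>" shows "smooth_near (\<lambda>x. G (q, x))"
proof -
  let ?c = "\<lambda>x. (q, 0) + (0, x)"
  have l: "bounded_linear (\<lambda>x. (0 :: 'q, x :: cmat2))" by (intro bounded_linear_Pair bounded_linear_zero bounded_linear_ident)
  have "open (?c -` U)" by (intro open_vimage[OF U] continuous_intros)
  moreover have "SU2 \<subseteq> ?c -` U" using in_U[OF assms(2)] by auto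
  moreover have "Cinf (?c -` U) (\<lambda>x. G (?c x))" by (rule Cinf_compose_affine[OF U l assms(1)])
  ultimately show ?thesis unfolding smooth_near_def by auto
qed

lemma lie_slice:
  assumes "Cinf U G" "norm q < \<epsilon>" "x \<in> SU2" shows "lie i (\<lambda>x. G (q, x)) x = plie i G (q, x)"
proof -
  have "((\<lambda>x. (q, x)) has_derivative (\<lambda>x. (0, x))) (at x)" by (auto intro!: derivative_eq_intros)
  from has_derivative_compose[OF this Cinf_has_derivative[OF assms(1) in_U[OF assms(2,3)]]]
  show ?thesis by (simp add: lie_eqI plie_def)
qed

lemma small_step:
  assumes "norm q < \<epsilon>" obtains \<delta> where "\<delta> > 0" "\<And>h. \<bar>h\<bar> < \<delta> \<Longrightarrow> norm (q + h *\<^sub>R v) < \<epsilon>"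
proof
  let ?\<delta> = "(\<epsilon> - norm q) / (norm v + 1)"
  have v: "norm v + 1 > 0" by (simp add: add_nonneg_pos)
  show "?\<delta> > 0" using assms v by simp
  fix h assume h: "\<bar>h\<bar> < ?\<delta>"
  have "norm (q + h *\<^sub>R v) \<le> norm q + \<bar>h\<bar> * norm v" using norm_triangle_ineq[of q "h *\<^sub>R v"] by simp
  also have "\<bar>h\<bar> * norm v \<le> \<bar>h\<bar> * (norm v + 1)" by (intro mult_left_mono) auto
  also have "\<bar>h\<bar> * (norm v + 1) < \<epsilon> - norm q" using h v by (simp add: pos_less_divide_eq)
  finally show "norm (q + h *\<^sub>R v) < \<epsilon>" by simp
qed

lemma integral_par:
  fixes G :: "'q \<times> cmat2 \<Rightarrow> real"
  assumes G: "Cinf U G" and q: "norm q < \<epsilon>"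
  shows "((\<lambda>h. integral_SU2 (\<lambda>x. G (q + h *\<^sub>R v, x))) has_real_derivative integral_SU2 (\<lambda>x. par v G (q, x))) (at 0)"
proof -
  obtain \<delta> where \<delta>: "\<delta> > 0" "\<And>h. \<bar>h\<bar> < \<delta> \<Longrightarrow> norm (q + h *\<^sub>R v) < \<epsilon>" using small_step[OF q] by blast
  have "((\<lambda>h. integral_SU2 (\<lambda>x. G (q + h *\<^sub>R v, x))) has_real_derivative integral_SU2 (\<lambda>x. par v G (q + 0 *\<^sub>R v, x))) (at 0)"
  proof (rule integral_SU2_has_derivative[OF \<delta>(1)])
    show "((\<lambda>h. G (q + h *\<^sub>R v, x)) has_real_derivative par v G (q + h *\<^sub>R v, x)) (at h)"
      if "\<bar>h\<bar> < \<delta>" "x \<in> SU2" for h x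
      using par_curve[OF G in_U[OF \<delta>(2)[OF that(1)] that(2)]] by (simp add: has_real_derivative_iff_has_vector_derivative)
    have "continuous_on U (par v G)" by (rule Cinf_continuous_on[OF Cinf_par[OF G]])
    moreover have "continuous_on ({-\<delta><..<\<delta>} \<times> SU2) (\<lambda>z. (q + fst z *\<^sub>R v, snd z))" by (intro continuous_intros)
    moreover have "(\<lambda>z. (q + fst z *\<^sub>R v, snd z)) ` ({-\<delta><..<\<delta>} \<times> SU2) \<subseteq> U"
      using in_U \<delta>(2) by (auto simp: abs_less_iff)
    ultimately have "continuous_on ({-\<delta><..<\<delta>} \<times> SU2) (\<lambda>z. par v G (q + fst z *\<^sub>R v, snd z))"
      by (rule continuous_on_compose2)
    thus "continuous_on ({-\<delta><..<\<delta>} \<times> SU2) (\<lambda>(h, x). par v G (q + h *\<^sub>R v, x))" by (simp add: case_prod_beta')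
    show "continuous_on SU2 (\<lambda>x. G (q + h *\<^sub>R v, x))" if "\<bar>h\<bar> < \<delta>" for h
      by (rule smooth_near_continuous_on[OF smooth_near_slice[OF G \<delta>(2)[OF that]]])
  qed
  thus ?thesis by simp
qed

text \<open>Constancy is available on the ball times SU(2) and not on \<open>U\<close>; moving in
  the parameter direction stays inside that set, so the parameter derivative still vanishes.\<close>

lemma par_eq_0:
  fixes G :: "'q \<times> cmat2 \<Rightarrow> 'b::real_normed_vector"
  assumes G: "Cinf U G" and c: "\<And>q x. norm q < \<epsilon> \<Longrightarrow> x \<in> SU2 \<Longrightarrow> G (q, x) = c" and q: "norm q < \<epsilon>" and x: "x \<in> SU2"
  shows "par v G (q, x) = 0"
proof -
  obtain \<delta> where \<delta>: "\<delta> > 0" "\<And>h. \<bar>h\<bar> < \<delta> \<Longrightarrow> norm (q + h *\<^sub>R v) < \<epsilon>" using small_step[OF q] by blast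
  have "((\<lambda>h. G (q + h *\<^sub>R v, x)) has_vector_derivative par v G (q, x)) (at 0)"
    using par_curve[OF G, of q 0 v x] in_U[OF q x] by simp
  moreover have "((\<lambda>h. G (q + h *\<^sub>R v, x)) has_vector_derivative 0) (at 0)"
  proof (rule has_vector_derivative_transform_within_open[of "\<lambda>_. c" _ _ "{-\<delta><..<\<delta>}"])
    show "c = G (q + h *\<^sub>R v, x)" if "h \<in> {-\<delta><..<\<delta>}" for h
      using c[OF \<delta>(2) x, of h] that by (simp add: abs_less_iff)
  qed (use \<delta>(1) in auto)
  ultimately show ?thesis by (rule vector_derivative_unique_at)
qed

end

text \<open>Three vectors in the plane orthogonal to \<open>n\<close> are linearly dependent. It
  removes every triple product of tangent vectors below.\<close>

lemma coplanar:
  fixes n a b c :: "real^3"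
  assumes "n \<bullet> n = 1" "a \<bullet> n = 0" "b \<bullet> n = 0" "c \<bullet> n = 0"
  shows "a \<bullet> cross3 b c = 0"
proof -
  have "(a \<bullet> cross3 b c) * (n \<bullet> n) = (a \<bullet> n) * (cross3 b c \<bullet> n) + (b \<bullet> n) * (cross3 c a \<bullet> n) + (c \<bullet> n) * (cross3 a b \<bullet> n)"
    unfolding cross3_def inner_vec_def sum_3 by (simp add: algebra_simps)
  thus ?thesis using assms by simp
qed

text \<open>The first variation of the pulled back area form is exact, up to the bracket
  \<open>[frame 1, frame 2] = - frame 3\<close>.\<close>
lemma integral_omega_variation:
  assumes n: "smooth_near n" and a: "smooth_near a"
    and nn: "\<And>x. x \<in> SU2 \<Longrightarrow> n x \<bullet> n x = 1" and an: "\<And>x. x \<in> SU2 \<Longrightarrow> a x \<bullet> n x = 0"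
  shows "integral_SU2 (\<lambda>x. a x \<bullet> cross3 (lie 1 n x) (lie 2 n x) + n x \<bullet> cross3 (lie 1 a x) (lie 2 n x) + n x \<bullet> cross3 (lie 1 n x) (lie 2 a x))
     = integral_SU2 (\<lambda>x. n x \<bullet> cross3 (a x) (lie 3 n x))"
proof -
  \<comment> \<open>The contraction of the area form with \<open>a\<close>, a 1-form on
    SU(2).\<close>
  define A where "A j x = n x \<bullet> cross3 (a x) (lie j n x)" for j x
  have A: "smooth_near (A j)" for j unfolding A_def[abs_def] by (intro smooth_near_inner smooth_near_cross smooth_near_lie n a)
  have t: "lie i n x \<bullet> n x = 0" if "x \<in> SU2" for i x by (rule lie_sphere_orthogonal[OF n nn that])
  \<comment> \<open>The right-hand side is the exterior derivative of the 1-form \<open>A\<close> on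
    (frame 1, frame 2): the term - A [frame 1, frame 2] is + \<open>A 3\<close>.\<close>
  have eq: "a x \<bullet> cross3 (lie 1 n x) (lie 2 n x) + n x \<bullet> cross3 (lie 1 a x) (lie 2 n x) + n x \<bullet> cross3 (lie 1 n x) (lie 2 a x)
      = (lie 1 (A 2) x - lie 2 (A 1) x) + A 3 x" if x: "x \<in> SU2" for x
  proof -
    have lA: "lie i (A j) x = n x \<bullet> cross3 (a x) (lie i (lie j n) x) + n x \<bullet> cross3 (lie i a x) (lie j n x)" for i j
    proof -
      have "lie i (A j) x = n x \<bullet> (cross3 (a x) (lie i (lie j n) x) + cross3 (lie i a x) (lie j n x)) + lie i n x \<bullet> cross3 (a x) (lie j n x)"
        unfolding A_def[abs_def]
        by (subst lie_inner[OF n _ x], intro smooth_near_cross smooth_near_lie n a)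
           (subst lie_cross[OF a smooth_near_lie[OF n] x], rule refl)
      moreover have "lie i n x \<bullet> cross3 (a x) (lie j n x) = 0"
        by (rule coplanar[OF nn[OF x] t[OF x] an[OF x] t[OF x]])
      ultimately show ?thesis by (simp add: inner_add_right)
    qed
    have z: "a x \<bullet> cross3 (lie 1 n x) (lie 2 n x) = 0"
      by (rule coplanar[OF nn[OF x] an[OF x] t[OF x] t[OF x]])
    have c: "lie 1 (lie 2 n) x = lie 2 (lie 1 n) x - lie 3 n x"
      using lie_commutator(1)[OF n x] by (simp add: algebra_simps)
    have s: "cross3 (lie 1 n x) (lie 2 a x) = - cross3 (lie 2 a x) (lie 1 n x)" by (rule cross_skew)
    have cd: "cross3 p (q - r) = cross3 p q - cross3 p r" for p q r :: "real^3"
      using bounded_bilinear.diff_right[OF bounded_bilinear_cross3] .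
    show ?thesis unfolding lA c z s unfolding A_def by (simp add: cd inner_diff_right)
  qed
  have "integral_SU2 (\<lambda>x. a x \<bullet> cross3 (lie 1 n x) (lie 2 n x) + n x \<bullet> cross3 (lie 1 a x) (lie 2 n x) + n x \<bullet> cross3 (lie 1 n x) (lie 2 a x))
    = integral_SU2 (\<lambda>x. (lie 1 (A 2) x - lie 2 (A 1) x) + A 3 x)" by (rule integral_SU2_cong[OF eq])
  also have "\<dots> = (integral_SU2 (lie 1 (A 2)) - integral_SU2 (lie 2 (A 1))) + integral_SU2 (A 3)"
    by (subst integral_SU2_add integral_SU2_diff, (intro continuous_on_diff smooth_near_continuous_on smooth_near_lie A)+)+ (rule refl)
  finally show ?thesis by (simp add: integral_lie A A_def[of 3, abs_def])
qed

lemma integral_by_parts_inner: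
  assumes "smooth_near f" "smooth_near g"
  shows "integral_SU2 (\<lambda>x. lie i f x \<bullet> g x) = - integral_SU2 (\<lambda>x. f x \<bullet> lie i g x)"
proof -
  have "0 = integral_SU2 (lie i (\<lambda>x. f x \<bullet> g x))" by (simp add: integral_lie smooth_near_inner assms)
  also have "\<dots> = integral_SU2 (\<lambda>x. f x \<bullet> lie i g x + lie i f x \<bullet> g x)"
    by (rule integral_SU2_cong) (simp add: lie_inner assms)
  also have "\<dots> = integral_SU2 (\<lambda>x. f x \<bullet> lie i g x) + integral_SU2 (\<lambda>x. lie i f x \<bullet> g x)"
    by (intro integral_SU2_add smooth_near_continuous_on smooth_near_inner smooth_near_lie assms)
  finally show ?thesis by simp
qed

text \<open>\<open>mframe 3\<close> is the Hopf map.\<close>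
definition mframe :: "3 \<Rightarrow> cmat2 \<Rightarrow> real^3" where
  "mframe j x = coord (conj_by x (theta j))"

lemma mframe_rot: "mframe j x = rot x (axis j 1)"
  by (simp add: mframe_def rot_def mat3_axis)

lemma smooth_near_mframe: "smooth_near (mframe j)"
  unfolding mframe_def[abs_def] by (intro smooth_near_apply_linear[OF linear_coord] smooth_near_conj_by)

lemma mframe_inner: "x \<in> SU2 \<Longrightarrow> mframe i x \<bullet> mframe j x = (if i = j then 1 else 0)"
  unfolding mframe_rot by (simp add: rot_inner inner_axis) (simp add: axis_def)

lemma rot_linear: "rot x (- a) = - rot x a" "rot x 0 = 0"
proof -
  have "linear (rot x)"
    unfolding rot_def[abs_def] using linear_conj_by linear_coord linear_mat3
    by (intro linear_compose[unfolded o_def, of "\<lambda>c. conj_by x (mat3 c)" coord] linear_compose[unfolded o_def, of mat3 "conj_by x"])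
       (auto intro: bounded_linear.linear)
  thus "rot x (- a) = - rot x a" "rot x 0 = 0" by (simp_all add: linear_neg linear_0)
qed

lemma lie_mframe:
  "lie 1 (mframe 1) x = 0" "lie 1 (mframe 2) x = - mframe 3 x" "lie 1 (mframe 3) x = mframe 2 x"
  "lie 2 (mframe 1) x = mframe 3 x" "lie 2 (mframe 2) x = 0" "lie 2 (mframe 3) x = - mframe 1 x"
  "lie 3 (mframe 1) x = - mframe 2 x" "lie 3 (mframe 2) x = mframe 1 x" "lie 3 (mframe 3) x = 0"
  if x: "x \<in> SU2"
proof -
  have *: "lie i (mframe j) x = - rot x (cross3 (axis i 1) (axis j 1))" for i j
  proof -
    have "lie i (mframe j) x = coord (conj_by x (ad (theta i) (theta j)))"
      unfolding mframe_def[abs_def] by (simp add: lie_apply_linear[OF linear_coord smooth_near_conj_by x] lie_conj_by)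
    also have "ad (theta i) (theta j) = mat3 (- cross3 (axis i 1) (axis j 1))"
      unfolding mat3_axis[symmetric] ad_mat3 ..
    finally show ?thesis by (simp add: rot_def[symmetric] rot_linear)
  qed
  show "lie 1 (mframe 1) x = 0" "lie 1 (mframe 2) x = - mframe 3 x" "lie 1 (mframe 3) x = mframe 2 x"
    "lie 2 (mframe 1) x = mframe 3 x" "lie 2 (mframe 2) x = 0" "lie 2 (mframe 3) x = - mframe 1 x"
    "lie 3 (mframe 1) x = - mframe 2 x" "lie 3 (mframe 2) x = mframe 1 x" "lie 3 (mframe 3) x = 0"
    unfolding * by (simp_all add: cross_basis rot_linear mframe_rot)
qed

lemma mframe_cross: "x \<in> SU2 \<Longrightarrow> cross3 (mframe 1 x) (mframe 2 x) = mframe 3 x"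
  "x \<in> SU2 \<Longrightarrow> cross3 (mframe 2 x) (mframe 3 x) = mframe 1 x"
  "x \<in> SU2 \<Longrightarrow> cross3 (mframe 3 x) (mframe 1 x) = mframe 2 x"
  by (simp_all add: mframe_rot rot_cross cross_basis)

lemma omega_mframe:
  assumes "x \<in> SU2" shows "omega 1 2 (mframe 3) x = 1" "omega 1 3 (mframe 3) x = 0" "omega 2 3 (mframe 3) x = 0"
proof -
  have "cross3 (mframe 2 x) (- mframe 1 x) = mframe 3 x"
    using mframe_cross(1)[OF assms] cross_skew[of "mframe 2 x" "mframe 1 x"] by simp
  thus "omega 1 2 (mframe 3) x = 1" "omega 1 3 (mframe 3) x = 0" "omega 2 3 (mframe 3) x = 0"
    by (simp_all add: omega_def lie_mframe assms mframe_inner)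
qed

text \<open>Harmonicity of the Hopf map: its Laplacian is \<open>- 2\<close> times itself.\<close>
lemma integral_dirichlet_hopf:
  assumes C: "smooth_near C"
  shows "integral_SU2 (\<lambda>x. lie 1 (mframe 3) x \<bullet> lie 1 C x + lie 2 (mframe 3) x \<bullet> lie 2 C x + lie 3 (mframe 3) x \<bullet> lie 3 C x)
    = 2 * integral_SU2 (\<lambda>x. mframe 3 x \<bullet> C x)"
proof -
  note m = smooth_near_mframe
  have n: "smooth_near (\<lambda>x. - mframe 1 x)" using smooth_near_apply_linear[OF bounded_linear_minus[OF bounded_linear_ident] m] .
  have ln: "lie 2 (\<lambda>x. - mframe 1 x) x = - mframe 3 x" if "x \<in> SU2" for x
    using lie_apply_linear[OF bounded_linear_minus[OF bounded_linear_ident] m that, of 2] by (simp add: lie_mframe that)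
  have "integral_SU2 (\<lambda>x. lie 1 (mframe 3) x \<bullet> lie 1 C x + lie 2 (mframe 3) x \<bullet> lie 2 C x + lie 3 (mframe 3) x \<bullet> lie 3 C x)
    = integral_SU2 (\<lambda>x. mframe 2 x \<bullet> lie 1 C x + (- mframe 1 x) \<bullet> lie 2 C x)"
    by (rule integral_SU2_cong) (simp add: lie_mframe)
  also have "\<dots> = integral_SU2 (\<lambda>x. mframe 2 x \<bullet> lie 1 C x) + integral_SU2 (\<lambda>x. (- mframe 1 x) \<bullet> lie 2 C x)"
    by (intro integral_SU2_add smooth_near_continuous_on smooth_near_inner smooth_near_lie m n C)
  also have "\<dots> = - integral_SU2 (\<lambda>x. lie 1 (mframe 2) x \<bullet> C x) - integral_SU2 (\<lambda>x. lie 2 (\<lambda>x. - mframe 1 x) x \<bullet> C x)"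
    by (simp only: integral_by_parts_inner[OF m C] integral_by_parts_inner[OF n C])
  also have "integral_SU2 (\<lambda>x. lie 1 (mframe 2) x \<bullet> C x) = - integral_SU2 (\<lambda>x. mframe 3 x \<bullet> C x)"
    unfolding integral_SU2_minus[symmetric] by (rule integral_SU2_cong) (simp add: lie_mframe)
  also have "integral_SU2 (\<lambda>x. lie 2 (\<lambda>x. - mframe 1 x) x \<bullet> C x) = - integral_SU2 (\<lambda>x. mframe 3 x \<bullet> C x)"
    unfolding integral_SU2_minus[symmetric] by (rule integral_SU2_cong) (simp add: ln)
  finally show ?thesis by simp
qed


section \<open>First and second variation\<close>

text \<open>The linearisation of \<open>omega i j\<close> at the Hopf map. The third Leibniz term,
  with \<open>X\<close> in place of \<open>mframe 3\<close>, is absent since it vanishes by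
  \<open>coplanar\<close> for tangent \<open>X\<close>.\<close>

definition omega_dot :: "3 \<Rightarrow> 3 \<Rightarrow> (cmat2 \<Rightarrow> real^3) \<Rightarrow> cmat2 \<Rightarrow> real" where
  "omega_dot i j X x = mframe 3 x \<bullet> cross3 (lie i (mframe 3) x) (lie j X x)
     + mframe 3 x \<bullet> cross3 (lie i X x) (lie j (mframe 3) x)"

text \<open>The second derivative of the energy after the acceleration has been eliminated: it
  leaves - 2 (X . X) from the Dirichlet part and the last triple product from the area part.\<close>

definition hess :: "real \<Rightarrow> (cmat2 \<Rightarrow> real^3) \<Rightarrow> real" where
  "hess \<alpha> X = integral_SU2 (\<lambda>x. lie 1 X x \<bullet> lie 1 X x + lie 2 X x \<bullet> lie 2 X x + lie 3 X x \<bullet> lie 3 X x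
     - 2 * (X x \<bullet> X x)
     + \<alpha> * ((omega_dot 1 2 X x)\<^sup>2 + (omega_dot 1 3 X x)\<^sup>2 + (omega_dot 2 3 X x)\<^sup>2 + mframe 3 x \<bullet> cross3 (X x) (lie 3 X x)))"

locale hopf_family = family_domain U \<epsilon> for U :: "('q::euclidean_space \<times> cmat2) set" and \<epsilon> +
  fixes N :: "'q \<times> cmat2 \<Rightarrow> real^3" and \<alpha> :: real
  assumes N: "Cinf U N"
    and unit: "\<And>q x. norm q < \<epsilon> \<Longrightarrow> x \<in> SU2 \<Longrightarrow> N (q, x) \<bullet> N (q, x) = 1"
    and N0: "\<And>x. x \<in> SU2 \<Longrightarrow> N (0, x) = mframe 3 x"
begin

definition om :: "3 \<Rightarrow> 3 \<Rightarrow> 'q \<times> cmat2 \<Rightarrow> real" where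
  "om i j z = N z \<bullet> cross3 (plie i N z) (plie j N z)"

text \<open>The density of \<open>energy_density\<close> on the product space, with products in
  place of squares so that \<open>par_mult\<close> applies.\<close>

definition dens :: "'q \<times> cmat2 \<Rightarrow> real" where
  "dens z = plie 1 N z \<bullet> plie 1 N z + plie 2 N z \<bullet> plie 2 N z + plie 3 N z \<bullet> plie 3 N z
     + \<alpha> * (om 1 2 z * om 1 2 z + om 1 3 z * om 1 3 z + om 2 3 z * om 2 3 z)"

lemmas smooth_rules = Cinf_add[OF U] Cinf_inner[OF U] Cinf_cross[OF U] Cinf_mult[OF U] Cinf_plie[OF U] Cinf_par
  Cinf_const[OF U] N

lemmas par_rules = par_add[where U=U] par_inner[where U=U] par_cross[where U=U] par_mult[where U=U] par_const
  par_plie_commute[OF U]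

lemma Cinf_om: "Cinf U (om i j)"
  unfolding om_def[abs_def] by (intro smooth_rules)

lemma Cinf_dens: "Cinf U dens"
  unfolding dens_def[abs_def] by (intro smooth_rules Cinf_om)

lemma par_om:
  assumes "z \<in> U"
  shows "par v (om i j) z = par v N z \<bullet> cross3 (plie i N z) (plie j N z)
    + N z \<bullet> cross3 (plie i (par v N) z) (plie j N z) + N z \<bullet> cross3 (plie i N z) (plie j (par v N) z)"
  unfolding om_def[abs_def] using assms by (simp add: par_rules smooth_rules inner_add_right)

lemma par_dens:
  assumes "z \<in> U"
  shows "par v dens z = 2 * (plie 1 N z \<bullet> plie 1 (par v N) z + plie 2 N z \<bullet> plie 2 (par v N) z + plie 3 N z \<bullet> plie 3 (par v N) z)
    + 2 * \<alpha> * (om 1 2 z * par v (om 1 2) z + om 1 3 z * par v (om 1 3) z + om 2 3 z * par v (om 2 3) z)"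
  unfolding dens_def[abs_def] using assms
  by (simp add: par_rules smooth_rules Cinf_om inner_commute[of "plie _ (par _ _) _"] algebra_simps)

text \<open>The Leibniz rule applied to \<open>par_dens\<close>. The first and third groups contain
  the acceleration and are evaluated after integration; the others are products of first
  variations.\<close>

lemma par_par_dens:
  assumes "z \<in> U"
  shows "par v (par w dens) z = 2 * (plie 1 N z \<bullet> plie 1 (par v (par w N)) z + plie 2 N z \<bullet> plie 2 (par v (par w N)) z + plie 3 N z \<bullet> plie 3 (par v (par w N)) z)
    + 2 * (plie 1 (par v N) z \<bullet> plie 1 (par w N) z + plie 2 (par v N) z \<bullet> plie 2 (par w N) z + plie 3 (par v N) z \<bullet> plie 3 (par w N) z)
    + 2 * \<alpha> * (om 1 2 z * par v (par w (om 1 2)) z + om 1 3 z * par v (par w (om 1 3)) z + om 2 3 z * par v (par w (om 2 3)) z)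
    + 2 * \<alpha> * (par v (om 1 2) z * par w (om 1 2) z + par v (om 1 3) z * par w (om 1 3) z + par v (om 2 3) z * par w (om 2 3) z)"
proof -
  have "par v (par w dens) z = par v (\<lambda>z. 2 * (plie 1 N z \<bullet> plie 1 (par w N) z + plie 2 N z \<bullet> plie 2 (par w N) z + plie 3 N z \<bullet> plie 3 (par w N) z)
    + 2 * \<alpha> * (om 1 2 z * par w (om 1 2) z + om 1 3 z * par w (om 1 3) z + om 2 3 z * par w (om 2 3) z)) z"
    by (rule par_cong[OF U assms par_dens])
  thus ?thesis using assms by (simp add: par_rules smooth_rules Cinf_om algebra_simps)
qed

lemma smooth_near_N: "norm q < \<epsilon> \<Longrightarrow> smooth_near (\<lambda>x. N (q, x))"
  by (rule smooth_near_slice[OF N])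

lemma norm0: "norm (0::'q) < \<epsilon>" using \<epsilon> by simp

lemma plie_N0: "x \<in> SU2 \<Longrightarrow> plie i N (0, x) = lie i (mframe 3) x"
  using lie_slice[OF N norm0, of x i] lie_cong[OF smooth_near_N[OF norm0] smooth_near_mframe N0, of x i] by simp

lemma om0: "x \<in> SU2 \<Longrightarrow> om 1 2 (0, x) = 1" "x \<in> SU2 \<Longrightarrow> om 1 3 (0, x) = 0" "x \<in> SU2 \<Longrightarrow> om 2 3 (0, x) = 0"
  using omega_mframe[of x] by (simp_all add: om_def plie_N0 N0 omega_def)

lemma energy_density_dens:
  assumes "norm q < \<epsilon>" "x \<in> SU2"
  shows "energy_density \<alpha> (\<lambda>x. N (q, x)) x = dens (q, x)"
  unfolding energy_density_def dens_def omega_def om_def lie_slice[OF N assms] by (simp add: power2_eq_square)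

lemma par_N_orthogonal:
  assumes q: "norm q < \<epsilon>" and x: "x \<in> SU2" shows "par v N (q, x) \<bullet> N (q, x) = 0"
proof -
  have "par v (\<lambda>z. N z \<bullet> N z) (q, x) = 0"
    by (rule par_eq_0[where c=1, OF _ _ q x]) (intro smooth_rules, rule unit)
  thus ?thesis using in_U[OF q x] by (simp add: par_rules smooth_rules inner_commute)
qed

text \<open>Differentiates the tangency relation of \<open>par_N_orthogonal\<close> once more at the
  centre of the family.\<close>

lemma par_par_N:
  assumes x: "x \<in> SU2"
  shows "mframe 3 x \<bullet> par v (par w N) (0, x) = - (par v N (0, x) \<bullet> par w N (0, x))"
proof -
  have "par v (\<lambda>z. par w N z \<bullet> N z) (0, x) = 0"
    by (rule par_eq_0[where c=0, OF _ _ norm0 x]) (intro smooth_rules, rule par_N_orthogonal)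
  thus ?thesis using in_U[OF norm0 x] N0[OF x] by (simp add: par_rules smooth_rules inner_commute)
qed

text \<open>Stated for every \<open>q\<close> in the ball and not only for the Hopf map at
  \<open>q = 0\<close>, because it is differentiated in \<open>q\<close> below.\<close>

lemma integral_par_om:
  assumes q: "norm q < \<epsilon>"
  shows "integral_SU2 (\<lambda>x. par v (om 1 2) (q, x)) = integral_SU2 (\<lambda>x. N (q, x) \<bullet> cross3 (par v N (q, x)) (plie 3 N (q, x)))"
proof -
  have a: "smooth_near (\<lambda>x. par v N (q, x))" by (rule smooth_near_slice[OF Cinf_par[OF N] q])
  have "integral_SU2 (\<lambda>x. par v (om 1 2) (q, x)) = integral_SU2 (\<lambda>x. par v N (q, x) \<bullet> cross3 (lie 1 (\<lambda>x. N (q, x)) x) (lie 2 (\<lambda>x. N (q, x)) x)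
    + N (q, x) \<bullet> cross3 (lie 1 (\<lambda>x. par v N (q, x)) x) (lie 2 (\<lambda>x. N (q, x)) x) + N (q, x) \<bullet> cross3 (lie 1 (\<lambda>x. N (q, x)) x) (lie 2 (\<lambda>x. par v N (q, x)) x))"
    by (rule integral_SU2_cong) (simp add: par_om in_U[OF q] lie_slice[OF N q] lie_slice[OF Cinf_par[OF N] q])
  also have "\<dots> = integral_SU2 (\<lambda>x. N (q, x) \<bullet> cross3 (par v N (q, x)) (lie 3 (\<lambda>x. N (q, x)) x))"
    by (rule integral_omega_variation[OF smooth_near_N[OF q] a unit[OF q] par_N_orthogonal[OF q]])
  also have "\<dots> = integral_SU2 (\<lambda>x. N (q, x) \<bullet> cross3 (par v N (q, x)) (plie 3 N (q, x)))"
    by (rule integral_SU2_cong) (simp add: lie_slice[OF N q])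
  finally show ?thesis .
qed

lemma cont: "Cinf U G \<Longrightarrow> continuous_on SU2 (\<lambda>x. G (0, x))"
  by (rule smooth_near_continuous_on[OF smooth_near_slice[OF _ norm0]])

lemma integral_dirichlet_0:
  assumes "Cinf U G"
  shows "integral_SU2 (\<lambda>x. plie 1 N (0, x) \<bullet> plie 1 G (0, x) + plie 2 N (0, x) \<bullet> plie 2 G (0, x) + plie 3 N (0, x) \<bullet> plie 3 G (0, x))
     = 2 * integral_SU2 (\<lambda>x. mframe 3 x \<bullet> G (0, x))"
  unfolding integral_dirichlet_hopf[OF smooth_near_slice[OF assms norm0], symmetric]
  by (rule integral_SU2_cong) (simp add: plie_N0 lie_slice[OF assms norm0])

text \<open>Integration by parts turns the Dirichlet part into the pairing of the tangent field with
  \<open>mframe 3\<close>, which is zero. In the area part only \<open>om 1 2\<close> is nonzero,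
  and its variation integrates to a term with the vanishing factor
  \<open>lie 3 (mframe 3)\<close>.\<close>

lemma first_variation_0: "integral_SU2 (\<lambda>x. par v dens (0, x)) = 0"
proof -
  have "integral_SU2 (\<lambda>x. par v dens (0, x)) = integral_SU2 (\<lambda>x. 2 * (plie 1 N (0, x) \<bullet> plie 1 (par v N) (0, x) + plie 2 N (0, x) \<bullet> plie 2 (par v N) (0, x) + plie 3 N (0, x) \<bullet> plie 3 (par v N) (0, x))
     + 2 * \<alpha> * par v (om 1 2) (0, x))"
    by (rule integral_SU2_cong) (simp add: par_dens in_U[OF norm0] om0)
  also have "\<dots> = 2 * (2 * integral_SU2 (\<lambda>x. mframe 3 x \<bullet> par v N (0, x))) + 2 * \<alpha> * integral_SU2 (\<lambda>x. par v (om 1 2) (0, x))"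
    by (subst integral_SU2_add, (intro cont smooth_rules Cinf_om)+)
       (simp only: integral_SU2_cmult integral_dirichlet_0[OF Cinf_par[OF N]])
  also have "integral_SU2 (\<lambda>x. mframe 3 x \<bullet> par v N (0, x)) = integral_SU2 (\<lambda>x. 0)"
    by (rule integral_SU2_cong) (use par_N_orthogonal[OF norm0] N0 in \<open>simp add: inner_commute\<close>)
  also have "integral_SU2 (\<lambda>x. par v (om 1 2) (0, x)) = integral_SU2 (\<lambda>x. 0)"
    unfolding integral_par_om[OF norm0] by (rule integral_SU2_cong) (simp add: plie_N0 lie_mframe)
  finally show ?thesis by simp
qed

lemma integral_par_par_om:
  "integral_SU2 (\<lambda>x. par v (par w (om 1 2)) (0, x)) = integral_SU2 (\<lambda>x. mframe 3 x \<bullet> cross3 (par w N (0, x)) (plie 3 (par v N) (0, x)))"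
proof -
  define G where "G z = N z \<bullet> cross3 (par w N z) (plie 3 N z)" for z
  have G: "Cinf U G" unfolding G_def[abs_def] by (intro smooth_rules)
  obtain \<delta> where \<delta>: "\<delta> > 0" "\<And>h. \<bar>h\<bar> < \<delta> \<Longrightarrow> norm (0 + h *\<^sub>R v) < \<epsilon>" using small_step[OF norm0] by blast
  have "((\<lambda>h. integral_SU2 (\<lambda>x. G (0 + h *\<^sub>R v, x))) has_real_derivative integral_SU2 (\<lambda>x. par v (par w (om 1 2)) (0, x))) (at 0)"
  \<comment> \<open>Both sides of \<open>integral_par_om\<close> agree for all small
    \<open>h\<close>, so their derivatives at 0 agree as well. The derivative of the right side at
    the Hopf map contains no acceleration, since \<open>plie 3 N\<close> vanishes there.\<close>
  proof (rule has_field_derivative_transform_within_open[OF integral_par[OF Cinf_par[OF Cinf_om] norm0], of "{-\<delta><..<\<delta>}"])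
    show "integral_SU2 (\<lambda>x. par w (om 1 2) (0 + h *\<^sub>R v, x)) = integral_SU2 (\<lambda>x. G (0 + h *\<^sub>R v, x))" if "h \<in> {-\<delta><..<\<delta>}" for h
      unfolding G_def by (rule integral_par_om[OF \<delta>(2)]) (use that in auto)
  qed (use \<delta>(1) in auto)
  from DERIV_unique[OF this integral_par[OF G norm0]]
  have "integral_SU2 (\<lambda>x. par v (par w (om 1 2)) (0, x)) = integral_SU2 (\<lambda>x. par v G (0, x))" .
  also have "\<dots> = integral_SU2 (\<lambda>x. mframe 3 x \<bullet> cross3 (par w N (0, x)) (plie 3 (par v N) (0, x)))"
  proof (rule integral_SU2_cong)
    fix x assume x: "x \<in> SU2"
    show "par v G (0, x) = mframe 3 x \<bullet> cross3 (par w N (0, x)) (plie 3 (par v N) (0, x))"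
      unfolding G_def[abs_def] using in_U[OF norm0 x]
      by (simp add: par_rules smooth_rules plie_N0 lie_mframe x N0 inner_add_right)
  qed
  finally show ?thesis .
qed

lemma par_om_0:
  assumes x: "x \<in> SU2" and X: "smooth_near X" "\<And>x. x \<in> SU2 \<Longrightarrow> par v N (0, x) = X x"
  shows "par v (om i j) (0, x) = omega_dot i j X x" "plie i (par v N) (0, x) = lie i X x"
proof -
  have l: "plie i (par v N) (0, x) = lie i X x" for i
    using lie_slice[OF Cinf_par[OF N] norm0 x, of i v] lie_cong[OF smooth_near_slice[OF Cinf_par[OF N] norm0] X x, of i] by simp
  thus "plie i (par v N) (0, x) = lie i X x" .
  have "par v N (0, x) \<bullet> cross3 (plie i N (0, x)) (plie j N (0, x)) = 0"
    by (rule coplanar[of "mframe 3 x"])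
       (use par_N_orthogonal[OF norm0 x] N0[OF x] lie_sphere_orthogonal[OF smooth_near_mframe _ x] in
         \<open>simp_all add: mframe_inner x plie_N0\<close>)
  thus "par v (om i j) (0, x) = omega_dot i j X x"
    unfolding par_om[OF in_U[OF norm0 x]] omega_dot_def by (simp add: l plie_N0 x N0)
qed

text \<open>P and K carry the acceleration: P integrates to - 2 X . X by harmonicity of the Hopf map
  and \<open>par_par_N\<close>, K to L by \<open>integral_par_par_om\<close>. Q and R are the
  squares of first variations.\<close>

lemma second_variation_0:
  assumes X: "smooth_near X" "\<And>x. x \<in> SU2 \<Longrightarrow> par v N (0, x) = X x" "\<And>x. x \<in> SU2 \<Longrightarrow> par w N (0, x) = X x"
  shows "1/2 * integral_SU2 (\<lambda>x. par v (par w dens) (0, x)) = hess \<alpha> X"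
proof -
  let ?C = "par v (par w N)"
  define P where "P x = plie 1 N (0, x) \<bullet> plie 1 ?C (0, x) + plie 2 N (0, x) \<bullet> plie 2 ?C (0, x) + plie 3 N (0, x) \<bullet> plie 3 ?C (0, x)" for x
  define Q where "Q x = lie 1 X x \<bullet> lie 1 X x + lie 2 X x \<bullet> lie 2 X x + lie 3 X x \<bullet> lie 3 X x" for x
  define R where "R x = (omega_dot 1 2 X x)\<^sup>2 + (omega_dot 1 3 X x)\<^sup>2 + (omega_dot 2 3 X x)\<^sup>2" for x
  define K where "K x = par v (par w (om 1 2)) (0, x)" for x
  define L where "L x = mframe 3 x \<bullet> cross3 (X x) (lie 3 X x)" for x
  have cP: "continuous_on SU2 P" unfolding P_def[abs_def] by (intro cont smooth_rules)
  have cQ: "continuous_on SU2 Q" unfolding Q_def[abs_def]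
    by (intro smooth_near_continuous_on smooth_near_add smooth_near_inner smooth_near_lie X)
  have cR: "continuous_on SU2 R" unfolding R_def[abs_def] omega_dot_def power2_eq_square
    by (intro smooth_near_continuous_on smooth_near_add smooth_near_mult smooth_near_inner smooth_near_cross smooth_near_lie smooth_near_mframe X)
  have cK: "continuous_on SU2 K" unfolding K_def[abs_def] by (intro cont Cinf_par Cinf_om)
  have cL: "continuous_on SU2 L" unfolding L_def[abs_def]
    by (intro smooth_near_continuous_on smooth_near_inner smooth_near_cross smooth_near_lie smooth_near_mframe X)
  have cX: "continuous_on SU2 (\<lambda>x. X x \<bullet> X x)" by (intro smooth_near_continuous_on smooth_near_inner X)
  have "1/2 * integral_SU2 (\<lambda>x. par v (par w dens) (0, x)) = integral_SU2 (\<lambda>x. P x + Q x + \<alpha> * (R x + K x))"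
    unfolding integral_SU2_cmult[symmetric]
    by (rule integral_SU2_cong)
       (simp add: par_par_dens in_U[OF norm0] om0 P_def Q_def R_def K_def par_om_0[OF _ X(1,2)] par_om_0[OF _ X(1,3)] power2_eq_square algebra_simps)
  also have "\<dots> = integral_SU2 P + integral_SU2 Q + \<alpha> * (integral_SU2 R + integral_SU2 K)"
    by (simp add: integral_SU2_add integral_SU2_cmult cP cQ cR cK continuous_on_add continuous_on_mult_left)
  also have "integral_SU2 K = integral_SU2 L"
    unfolding K_def integral_par_par_om by (rule integral_SU2_cong) (simp add: L_def X par_om_0(2)[OF _ X(1,2)])
  also have "integral_SU2 P = 2 * integral_SU2 (\<lambda>x. mframe 3 x \<bullet> ?C (0, x))"
    unfolding P_def by (intro integral_dirichlet_0 smooth_rules)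
  also have "integral_SU2 (\<lambda>x. mframe 3 x \<bullet> ?C (0, x)) = - integral_SU2 (\<lambda>x. X x \<bullet> X x)"
    unfolding integral_SU2_minus[symmetric] by (rule integral_SU2_cong) (simp add: par_par_N X)
  also have "2 * - integral_SU2 (\<lambda>x. X x \<bullet> X x) + integral_SU2 Q + \<alpha> * (integral_SU2 R + integral_SU2 L) = hess \<alpha> X"
  proof -
    have "hess \<alpha> X = integral_SU2 (\<lambda>x. Q x - 2 * (X x \<bullet> X x) + \<alpha> * (R x + L x))"
      unfolding hess_def Q_def R_def L_def by simp
    also have "\<dots> = integral_SU2 Q - 2 * integral_SU2 (\<lambda>x. X x \<bullet> X x) + \<alpha> * (integral_SU2 R + integral_SU2 L)"
      by (simp add: integral_SU2_add integral_SU2_diff integral_SU2_cmult cQ cR cL cX continuous_on_add continuous_on_diff continuous_on_mult_left)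
    finally show ?thesis by simp
  qed
  finally show ?thesis .
qed

end

text \<open>Passes from a set-valued variation to a family of unit vector fields, by the extension
  hidden in \<open>smooth_on\<close> and the coordinates of su(2).\<close>

lemma hopf_variation_family:
  assumes "variation hopf \<Phi>"
  obtains U \<epsilon> F where "hopf_family U \<epsilon> (\<lambda>z. coord (F z))"
    "\<And>q. norm q < \<epsilon> \<Longrightarrow> smooth_near (\<lambda>x. F (q, x)) \<and> \<Phi> q ` SU2 \<subseteq> quot_N \<and> (\<forall>x\<in>SU2. emb (\<Phi> q x) = F (q, x))"
    "Cinf U F"
proof -
  have \<Phi>0: "\<And>x. x \<in> SU2 \<Longrightarrow> \<Phi> 0 x = hopf x" using assms by (simp add: variation_def)
  obtain \<epsilon> where \<epsilon>: "\<epsilon> > 0" "\<And>q. q \<in> ball 0 \<epsilon> \<Longrightarrow> \<Phi> q ` SU2 \<subseteq> quot_N" "smooth_on (ball 0 \<epsilon> \<times> SU2) (\<lambda>(q, x). emb (\<Phi> q x))"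
    using assms unfolding variation_def by blast
  obtain U F where U: "open U" "ball 0 \<epsilon> \<times> SU2 \<subseteq> U" and F: "\<And>z. z \<in> ball 0 \<epsilon> \<times> SU2 \<Longrightarrow> F z = (case z of (q, x) \<Rightarrow> emb (\<Phi> q x))" "Cinf U F"
    using \<epsilon>(3) unfolding smooth_on_def Cinf_def by blast
  interpret fd: family_domain U \<epsilon> by unfold_locales (use U \<epsilon> in auto)
  have eF: "emb (\<Phi> q x) = F (q, x)" if "norm q < \<epsilon>" "x \<in> SU2" for q x
    using F(1)[of "(q, x)"] that by simp
  have fam: "hopf_family U \<epsilon> (\<lambda>z. coord (F z))"
  proof
    show "Cinf U (\<lambda>z. coord (F z))" by (rule Cinf_apply_linear[OF U(1) linear_coord F(2)])
    show "coord (F (q, x)) \<bullet> coord (F (q, x)) = 1" if q: "norm q < \<epsilon>" and x: "x \<in> SU2" for q x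
    proof -
      obtain M where "emb (\<Phi> q x) = mat3 M" "M \<bullet> M = 1" using emb_unit[of "\<Phi> q x"] \<epsilon>(2)[of q] q x by auto
      thus ?thesis using eF[OF q x] by auto
    qed
    show "coord (F (0, x)) = mframe 3 x" if "x \<in> SU2" for x
      using eF[of 0 x] \<epsilon>(1) that by (simp add: \<Phi>0 emb_hopf mframe_def)
  qed
  show ?thesis
  proof (rule that)
    show "hopf_family U \<epsilon> (\<lambda>z. coord (F z))" by (rule fam)
    show "smooth_near (\<lambda>x. F (q, x)) \<and> \<Phi> q ` SU2 \<subseteq> quot_N \<and> (\<forall>x\<in>SU2. emb (\<Phi> q x) = F (q, x))" if "norm q < \<epsilon>" for q
      using fd.smooth_near_slice[OF F(2) that] eF[OF that] \<epsilon>(2)[of q] that by simp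
  qed (rule F(2))
qed

text \<open>Holds at every \<open>q\<close> in the ball: the Hessian differentiates the result along
  the points (s, 0).\<close>

lemma energy_variation_derivative:
  assumes fam: "hopf_family U \<epsilon> (\<lambda>z. coord (F z))"
    and F: "\<And>q. norm q < \<epsilon> \<Longrightarrow> smooth_near (\<lambda>x. F (q, x)) \<and> \<Phi> q ` SU2 \<subseteq> quot_N \<and> (\<forall>x\<in>SU2. emb (\<Phi> q x) = F (q, x))"
    and q: "norm q < \<epsilon>"
  shows "((\<lambda>h. energy \<alpha> (\<Phi> (q + h *\<^sub>R v))) has_real_derivative 1/2 * integral_SU2 (\<lambda>x. par v (hopf_family.dens (\<lambda>z. coord (F z)) \<alpha>) (q, x))) (at 0)"
proof -
  interpret hopf_family U \<epsilon> "\<lambda>z. coord (F z)" \<alpha> by (rule fam)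
  obtain \<delta> where \<delta>: "\<delta> > 0" "\<And>h. \<bar>h\<bar> < \<delta> \<Longrightarrow> norm (q + h *\<^sub>R v) < \<epsilon>" using small_step[OF q] by blast
  have E: "energy \<alpha> (\<Phi> p) = 1/2 * integral_SU2 (\<lambda>x. dens (p, x))" if p: "norm p < \<epsilon>" for p
  proof -
    have "energy \<alpha> (\<Phi> p) = 1/2 * integral_SU2 (energy_density \<alpha> (\<lambda>x. coord (F (p, x))))"
      by (rule energy_eq) (use F[OF p] in auto)
    also have "integral_SU2 (energy_density \<alpha> (\<lambda>x. coord (F (p, x)))) = integral_SU2 (\<lambda>x. dens (p, x))"
      by (rule integral_SU2_cong) (rule energy_density_dens[OF p])
    finally show ?thesis .
  qed
  show ?thesis
  proof (rule has_field_derivative_transform_within_open[OF DERIV_cmult[OF integral_par[OF Cinf_dens q]], where S="{-\<delta><..<\<delta>}"])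
    show "1/2 * integral_SU2 (\<lambda>x. dens (q + h *\<^sub>R v, x)) = energy \<alpha> (\<Phi> (q + h *\<^sub>R v))" if "h \<in> {-\<delta><..<\<delta>}" for h
      using E[OF \<delta>(2), of h] that by (simp add: abs_less_iff)
  qed (use \<delta>(1) in auto)
qed

lemma critical_point_hopf: "critical_point \<alpha> hopf"
  unfolding critical_point_def
proof (intro conjI allI impI)
  have "smooth_on SU2 (\<lambda>x. emb (hopf x))"
  proof -
    obtain U where "open U" "SU2 \<subseteq> U" "Cinf U (\<lambda>x. conj_by x (theta 3))"
      using smooth_near_conj_by[of "theta 3"] unfolding smooth_near_def by blast
    thus ?thesis unfolding smooth_on_def Cinf_def using emb_hopf
      by (intro exI[of _ U] exI[of _ "\<lambda>x. conj_by x (theta 3)"]) auto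
  qed
  thus "smooth_map hopf" by (simp add: smooth_map_def quot_N_def)
next
  fix \<Phi> :: "real \<Rightarrow> cmat2 \<Rightarrow> cmat2 set" assume v: "variation hopf \<Phi>"
  obtain U \<epsilon> F where fam: "hopf_family U \<epsilon> (\<lambda>z. coord (F z))"
    and F: "\<And>q. norm q < \<epsilon> \<Longrightarrow> smooth_near (\<lambda>x. F (q, x)) \<and> \<Phi> q ` SU2 \<subseteq> quot_N \<and> (\<forall>x\<in>SU2. emb (\<Phi> q x) = F (q, x))"
    by (rule hopf_variation_family[OF v]) (rule that, assumption+)
  interpret hopf_family U \<epsilon> "\<lambda>z. coord (F z)" \<alpha> by (rule fam)
  show "((\<lambda>t. energy \<alpha> (\<Phi> t)) has_real_derivative 0) (at 0)"
  proof -
    have "((\<lambda>h. energy \<alpha> (\<Phi> (0 + h *\<^sub>R 1))) has_real_derivative 1/2 * integral_SU2 (\<lambda>x. par 1 dens (0, x))) (at 0)"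
      by (rule energy_variation_derivative[OF fam _ norm0]) (rule F)
    thus ?thesis unfolding first_variation_0 by simp
  qed
qed

lemma hessian_of_variation:
  fixes \<Phi> :: "real \<times> real \<Rightarrow> cmat2 \<Rightarrow> cmat2 set"
  assumes v: "variation hopf \<Phi>" and X: "smooth_near X"
    and t: "\<And>x. x \<in> SU2 \<Longrightarrow> ((\<lambda>t. emb (\<Phi> (0, t) x)) has_vector_derivative X x) (at 0)"
    and s: "\<And>x. x \<in> SU2 \<Longrightarrow> ((\<lambda>s. emb (\<Phi> (s, 0) x)) has_vector_derivative X x) (at 0)"
  obtains D where "\<forall>\<^sub>F s in nhds 0. ((\<lambda>t. energy \<alpha> (\<Phi> (s, t))) has_real_derivative D s) (at 0)"
    "(D has_real_derivative hess \<alpha> (\<lambda>x. coord (X x))) (at 0)"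
proof -
  obtain U \<epsilon> F where fam: "hopf_family U \<epsilon> (\<lambda>z. coord (F z))"
    and F: "\<And>q. norm q < \<epsilon> \<Longrightarrow> smooth_near (\<lambda>x. F (q, x)) \<and> \<Phi> q ` SU2 \<subseteq> quot_N \<and> (\<forall>x\<in>SU2. emb (\<Phi> q x) = F (q, x))"
    and cF: "Cinf U F"
    by (rule hopf_variation_family[OF v]) (rule that, assumption+)
  interpret hopf_family U \<epsilon> "\<lambda>z. coord (F z)" \<alpha> by (rule fam)
  have pX: "par w (\<lambda>z. coord (F z)) (0, x) = coord (X x)"
    if w: "\<And>x. x \<in> SU2 \<Longrightarrow> ((\<lambda>h. emb (\<Phi> (h *\<^sub>R w) x)) has_vector_derivative X x) (at 0)" and x: "x \<in> SU2" for w x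
  proof -
    obtain \<delta> where \<delta>: "\<delta> > 0" "\<And>h. \<bar>h\<bar> < \<delta> \<Longrightarrow> norm (0 + h *\<^sub>R w) < \<epsilon>" using small_step[OF norm0] by blast
    have "((\<lambda>h. F (0 + h *\<^sub>R w, x)) has_vector_derivative par w F (0, x)) (at 0)"
      using par_curve[OF cF, of 0 0 w x] in_U[OF norm0 x] by simp
    hence "((\<lambda>h. emb (\<Phi> (h *\<^sub>R w) x)) has_vector_derivative par w F (0, x)) (at 0)"
    proof (rule has_vector_derivative_transform_within_open[of _ _ _ "{-\<delta><..<\<delta>}"])
      show "F (0 + h *\<^sub>R w, x) = emb (\<Phi> (h *\<^sub>R w) x)" if "h \<in> {-\<delta><..<\<delta>}" for h
        using F[OF \<delta>(2), of h] x that by (simp add: abs_less_iff)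
    qed (use \<delta>(1) in auto)
    hence "par w F (0, x) = X x" using w[OF x] by (rule vector_derivative_unique_at)
    moreover have "par w (\<lambda>z. coord (F z)) (0, x) = coord (par w F (0, x))"
      unfolding par_def by (rule frechet_apply_linear[OF linear_coord Cinf_has_derivative[OF cF in_U[OF norm0 x]]])
    ultimately show ?thesis by simp
  qed
  \<comment> \<open>\<open>t\<close> is the second parameter, so the inner derivative is in
    direction (0, 1) at (s, 0) and the outer one in direction (1, 0).\<close>
  define D where "D s = 1/2 * integral_SU2 (\<lambda>x. par (0, 1) dens ((s, 0), x))" for s
  have "((\<lambda>t. energy \<alpha> (\<Phi> (s, t))) has_real_derivative D s) (at 0)" if "\<bar>s\<bar> < \<epsilon>" for s
  proof -
    have "((\<lambda>h. energy \<alpha> (\<Phi> ((s, 0) + h *\<^sub>R (0, 1)))) has_real_derivative 1/2 * integral_SU2 (\<lambda>x. par (0, 1) dens ((s, 0), x))) (at 0)"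
      by (rule energy_variation_derivative[OF fam]) (rule F, assumption, simp add: norm_Pair that)
    thus ?thesis by (simp add: D_def)
  qed
  moreover have "\<forall>\<^sub>F s in nhds 0. \<bar>s\<bar> < \<epsilon>"
    using \<epsilon> unfolding eventually_nhds_metric by (intro exI[of _ \<epsilon>]) (auto simp: dist_real_def)
  ultimately have "\<forall>\<^sub>F s in nhds 0. ((\<lambda>t. energy \<alpha> (\<Phi> (s, t))) has_real_derivative D s) (at 0)"
    by (auto elim: eventually_mono)
  moreover have "(D has_real_derivative hess \<alpha> (\<lambda>x. coord (X x))) (at 0)"
  proof -
    have "((\<lambda>s. 1/2 * integral_SU2 (\<lambda>x. par (0, 1) dens (0 + s *\<^sub>R (1, 0), x))) has_real_derivative 1/2 * integral_SU2 (\<lambda>x. par (1, 0) (par (0, 1) dens) (0, x))) (at 0)"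
      by (rule DERIV_cmult[OF integral_par[OF Cinf_par[OF Cinf_dens] norm0]])
    moreover have "1/2 * integral_SU2 (\<lambda>x. par (1, 0) (par (0, 1) dens) (0, x)) = hess \<alpha> (\<lambda>x. coord (X x))"
      by (rule second_variation_0[OF smooth_near_apply_linear[OF linear_coord X]]) (use pX s t in auto)
    ultimately show ?thesis by (simp add: D_def[abs_def])
  qed
  ultimately show ?thesis using that by blast
qed


section \<open>The Hessian and the instability\<close>

text \<open>\<open>tangent_N\<close> admits any point of the fibre as base point. The torus fixes
  \<open>theta 3\<close>, hence \<open>mframe 3\<close> is constant on the fibre and all base points
  give the same plane.\<close>

lemma tangent_N_hopf:
  assumes x: "x \<in> SU2" shows "tangent_N (hopf x) = {mat3 \<xi> | \<xi>. \<xi> \<bullet> mframe 3 x = 0}"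
proof (intro equalityI subsetI)
  fix v assume "v \<in> tangent_N (hopf x)"
  then obtain g X where g: "g \<in> hopf x" "X \<in> p_space" "v = diff_map hopf g (g ** X)" unfolding tangent_N_def by blast
  then obtain k where k: "k \<in> SU1U1" "g = x ** k" by (auto simp: hopf_def)
  have gS: "g \<in> SU2" using k x SU2_mult by (auto simp: SU1U1_def)
  obtain c where c: "X = mat3 c" using g(2) p_space_iff by blast
  have "mframe 3 x = mframe 3 g" unfolding mframe_def k(2) conj_by_mult conj_by_SU1U1[OF k(1)] ..
  hence "rot g (cross3 (axis 3 1) c) \<bullet> mframe 3 x = 0"
    unfolding mframe_rot by (simp add: rot_inner gS dot_cross_self)
  thus "v \<in> {mat3 \<xi> | \<xi>. \<xi> \<bullet> mframe 3 x = 0}" unfolding g(3) c diff_map_hopf[OF gS] by blast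
next
  fix v assume "v \<in> {mat3 \<xi> | \<xi>. \<xi> \<bullet> mframe 3 x = 0}"
  then obtain \<xi> where \<xi>: "v = mat3 \<xi>" "\<xi> \<bullet> mframe 3 x = 0" by blast
  obtain d where d: "\<xi> = rot x d" using rot_surj[OF x] by metis
  have d3: "d $ 3 = 0" using \<xi>(2) unfolding d mframe_rot rot_inner[OF x] by (simp add: inner_axis)
  have "v = diff_map hopf x (x ** mat3 (cross3 d (axis 3 1)))"
    unfolding diff_map_hopf[OF x] cross3_axis3_twice[OF d3] \<xi>(1) d ..
  moreover have "mat3 (cross3 d (axis 3 1)) \<in> p_space"
    unfolding p_space_iff by (rule exI[of _ "cross3 d (axis 3 1)"]) (simp add: cross3_def axis_def)
  ultimately show "v \<in> tangent_N (hopf x)" unfolding tangent_N_def using hopf_self by blast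
qed

text \<open>A normalised quaternion: 1 + \<open>mat3 y\<close> has real part 1 and an imaginary part
  of length |y|/2.\<close>

lemma SU2_one_plus_mat3:
  assumes r: "r\<^sup>2 * (1 + (y \<bullet> y) / 4) = 1"
  shows "r *\<^sub>R (mat 1 + mat3 y) \<in> SU2"
proof -
  have "(cmod ((r *\<^sub>R (mat 1 + mat3 y)) $ 1 $ 1))\<^sup>2 + (cmod ((r *\<^sub>R (mat 1 + mat3 y)) $ 2 $ 1))\<^sup>2
      = r\<^sup>2 * ((1\<^sup>2 + (y $ 3 / 2)\<^sup>2) + ((y $ 2 / 2)\<^sup>2 + (y $ 1 / 2)\<^sup>2))"
    by (simp add: norm_mult power_mult_distrib power_divide cmod_power2 mat3_nth mat_def algebra_simps)
  also have "\<dots> = r\<^sup>2 * (1 + (y \<bullet> y) / 4)"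
    unfolding inner_vec_def[of y] sum_3 by (simp add: power2_eq_square algebra_simps)
  also have "\<dots> = 1" by (rule r)
  finally show ?thesis unfolding SU2_iff by (simp add: mat3_nth mat_def complex_eq_iff)
qed

text \<open>Rotating the Hopf map about the axis \<open>mframe 3 \<times> X\<close> moves it in the direction \<open>X\<close>; the
  Cayley-type formula below avoids square roots in the embedded map.\<close>
lemma hopf_variation_exists:
  assumes X: "smooth_near X" and tan: "\<And>x. x \<in> SU2 \<Longrightarrow> X x = mat3 (\<xi> x) \<and> \<xi> x \<bullet> mframe 3 x = 0"
  obtains \<Phi> :: "real \<times> real \<Rightarrow> cmat2 \<Rightarrow> cmat2 set" where "variation hopf \<Phi>"
    "\<And>x. x \<in> SU2 \<Longrightarrow> ((\<lambda>t. emb (\<Phi> (0, t) x)) has_vector_derivative X x) (at 0)"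
    "\<And>x. x \<in> SU2 \<Longrightarrow> ((\<lambda>s. emb (\<Phi> (s, 0) x)) has_vector_derivative X x) (at 0)"
proof -
  obtain W where W: "open W" "SU2 \<subseteq> W" "Cinf W X" using X smooth_near_def by metis
  define n where "n x = conj_by x (theta 3)" for x
  define Z where "Z x = ad (n x) (X x)" for x
  \<comment> \<open>Conjugation of \<open>n\<close> by 1 + k Z, normalised by (1 + k Z)(1 - k Z) = 1
    + k^2 (Z . Z)/2. It is written in terms of the extension \<open>X\<close>, hence smooth near
    SU(2), whereas \<open>g\<close> below uses \<open>\<xi>\<close>, which is controlled on SU(2)
    only.\<close>
  define E where "E k x = inverse (1 + k * k * (Z x \<bullet> Z x) / 2) *\<^sub>R ((mat 1 + k *\<^sub>R Z x) ** n x ** ctransp (mat 1 + k *\<^sub>R Z x))" for k x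
  define y where "y x = - cross3 (mframe 3 x) (\<xi> x)" for x
  have ZS: "Z x = mat3 (y x)" "n x = mat3 (mframe 3 x)" if x: "x \<in> SU2" for x
  proof -
    show nx: "n x = mat3 (mframe 3 x)" unfolding n_def mframe_rot mat3_rot[OF x] mat3_axis ..
    show "Z x = mat3 (y x)" unfolding Z_def nx y_def using tan[OF x] by (simp add: ad_mat3)
  qed
  define g where "g k x = (1 / sqrt (1 + k * k * (y x \<bullet> y x) / 4)) *\<^sub>R (mat 1 + mat3 (k *\<^sub>R y x))" for k x
  \<comment> \<open>Depends on s + t only, so both velocities are \<open>X\<close>, as the diagonal
    of the Hessian requires.\<close>
  define \<Phi> where "\<Phi> q x = hopf (g (fst q + snd q) x ** x)" for q :: "real \<times> real" and x
  have pos: "1 + k * k * (y x \<bullet> y x) / 4 > 0" "1 + k * k * (Z x \<bullet> Z x) / 2 > 0" for k x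
    by (intro add_pos_nonneg divide_nonneg_nonneg mult_nonneg_nonneg[OF zero_le_square] inner_ge_zero; simp)+
  have gS: "g k x \<in> SU2" for k x
    unfolding g_def
  proof (rule SU2_one_plus_mat3)
    have "(1 / sqrt (1 + k * k * (y x \<bullet> y x) / 4))\<^sup>2 = 1 / (1 + k * k * (y x \<bullet> y x) / 4)"
      using pos(1)[of k x] by (simp only: power_divide real_sqrt_pow2 less_imp_le power_one)
    thus "(1 / sqrt (1 + k * k * (y x \<bullet> y x) / 4))\<^sup>2 * (1 + (k *\<^sub>R y x \<bullet> k *\<^sub>R y x) / 4) = 1"
      using pos(1)[of k x] by (simp add: mult.assoc)
  qed
  have emb: "emb (\<Phi> q x) = E (fst q + snd q) x" if x: "x \<in> SU2" for q x
  proof -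
    define k where "k = fst q + snd q"
    define Y where "Y = mat 1 + k *\<^sub>R Z x"
    define r where "r = 1 / sqrt (1 + k * k * (y x \<bullet> y x) / 4)"
    have "Z x \<bullet> Z x = (y x \<bullet> y x) / 2"
      using metric_mat3[of "y x" "y x"] unfolding ZS(1)[OF x] metric_SU2_def by simp
    hence r: "r * r = inverse (1 + k * k * (Z x \<bullet> Z x) / 2)"
      using pos(1)[of k x] by (simp add: r_def inverse_eq_divide)
    have gY: "g k x = r *\<^sub>R Y"
      using linear_scale[OF bounded_linear.linear[OF linear_mat3], of k "y x"] by (simp add: g_def r_def Y_def ZS(1)[OF x])
    have "emb (\<Phi> q x) = conj_by (g k x) (n x)"
      unfolding \<Phi>_def k_def[symmetric] emb_hopf[OF SU2_mult[OF gS x]] conj_by_mult n_def ..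
    also have "\<dots> = (r * r) *\<^sub>R (Y ** n x ** ctransp Y)"
      unfolding gY conj_by_def
      by (simp add: bounded_bilinear.scaleR_left[OF bounded_bilinear_matmul] bounded_bilinear.scaleR_right[OF bounded_bilinear_matmul]
        linear_scale[OF bounded_linear.linear[OF bounded_linear_ctransp]])
    also have "\<dots> = E k x" unfolding r E_def Y_def ..
    finally show ?thesis by (simp add: k_def)
  qed
  have "smooth_on (ball 0 1 \<times> SU2) (\<lambda>(q, x). emb (\<Phi> q x))"
  proof -
    define U where "U = (\<lambda>z::(real \<times> real) \<times> cmat2. 0 + snd z) -` W"
    have U: "open U" unfolding U_def by (intro open_vimage[OF W(1)] continuous_intros)
    define k where "k z = fst (fst z) + snd (fst z)" for z :: "(real \<times> real) \<times> cmat2"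
    have "bounded_linear k" unfolding k_def[abs_def]
      by (intro bounded_linear_add bounded_linear_compose[OF bounded_linear_fst] bounded_linear_compose[OF bounded_linear_snd] bounded_linear_fst)
    hence ck: "Cinf U k" by (rule Cinf_linear[OF U])
    have cX: "Cinf U (\<lambda>z. X (0 + snd z))"
      unfolding U_def by (rule Cinf_compose_affine[OF W(1) bounded_linear_snd W(3)])
    have cs: "Cinf U snd" by (rule Cinf_linear[OF U bounded_linear_snd])
    have cn: "Cinf U (\<lambda>z. n (snd z))" unfolding n_def conj_by_def
      by (intro Cinf_bilinear[OF U bounded_bilinear_matmul] Cinf_apply_linear[OF U bounded_linear_ctransp] cs Cinf_const[OF U])
    have dm: "A - B = A + (-1) *\<^sub>R B" for A B :: cmat2 by simp
    have cZ: "Cinf U (\<lambda>z. Z (snd z))" unfolding Z_def ad_def dm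
      using cX by (intro Cinf_add[OF U] Cinf_bilinear[OF U bounded_bilinear_matmul] Cinf_bilinear[OF U bounded_bilinear_scaleR] cn Cinf_const[OF U]) simp_all
    have c1: "Cinf U (\<lambda>z. mat 1 + k z *\<^sub>R Z (snd z))"
      by (intro Cinf_add[OF U] Cinf_bilinear[OF U bounded_bilinear_scaleR] ck cZ Cinf_const[OF U])
    have "Cinf U (\<lambda>z. 1 + (k z * k z * (Z (snd z) \<bullet> Z (snd z))) * (1/2))"
      by (intro Cinf_add[OF U] Cinf_mult[OF U] Cinf_inner[OF U] ck cZ Cinf_const[OF U])
    hence "Cinf U (\<lambda>z. inverse (1 + k z * k z * (Z (snd z) \<bullet> Z (snd z)) / 2))"
      using pos(2) by (intro Cinf_inverse[OF U]) (auto simp: less_imp_neq[symmetric])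
    hence "Cinf U (\<lambda>z. E (k z) (snd z))" unfolding E_def
      by (intro Cinf_bilinear[OF U bounded_bilinear_scaleR] Cinf_bilinear[OF U bounded_bilinear_matmul]
        Cinf_apply_linear[OF U bounded_linear_ctransp] c1 cn)
    moreover have "ball 0 1 \<times> SU2 \<subseteq> U" using W(2) by (auto simp: U_def)
    ultimately show ?thesis unfolding smooth_on_def Cinf_def using U emb
      by (intro exI[of _ U] exI[of _ "\<lambda>z. E (k z) (snd z)"]) (auto simp: k_def)
  qed
  moreover have "\<Phi> 0 x = hopf x" for x by (simp add: \<Phi>_def g_def linear_0[OF bounded_linear.linear[OF linear_mat3]])
  moreover have "\<Phi> q ` SU2 \<subseteq> quot_N" for q using SU2_mult[OF gS] by (auto simp: \<Phi>_def quot_N_def)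
  ultimately have "variation hopf \<Phi>" unfolding variation_def by (auto intro!: exI[of _ 1])
  moreover have d: "((\<lambda>k. E k x) has_vector_derivative X x) (at 0)" if x: "x \<in> SU2" for x
  proof -
    let ?Y = "\<lambda>k. mat 1 + k *\<^sub>R Z x"
    have Y: "(?Y has_derivative (\<lambda>k. k *\<^sub>R Z x)) (at 0)" by (auto intro!: derivative_eq_intros)
    have "((\<lambda>k. ?Y k ** n x ** ctransp (?Y k)) has_derivative (\<lambda>k. (?Y 0 ** n x) ** ctransp (k *\<^sub>R Z x) + (?Y 0 ** 0 + (k *\<^sub>R Z x) ** n x) ** ctransp (?Y 0))) (at 0)"
      by (intro bounded_bilinear.FDERIV[OF bounded_bilinear_matmul] bounded_linear.has_derivative[OF bounded_linear_ctransp] Y has_derivative_const)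
    moreover have "((\<lambda>k::real. inverse (1 + k * k * (Z x \<bullet> Z x) / 2)) has_derivative (\<lambda>_. 0)) (at 0)"
      by (auto intro!: derivative_eq_intros)
    ultimately have "((\<lambda>k. E k x) has_derivative (\<lambda>k. inverse (1 + 0 * 0 * (Z x \<bullet> Z x) / 2) *\<^sub>R ((?Y 0 ** n x) ** ctransp (k *\<^sub>R Z x) + (?Y 0 ** 0 + (k *\<^sub>R Z x) ** n x) ** ctransp (?Y 0)) + 0 *\<^sub>R (?Y 0 ** n x ** ctransp (?Y 0)))) (at 0)"
      unfolding E_def by (intro has_derivative_scaleR)
    moreover have "inverse (1 + 0 * 0 * (Z x \<bullet> Z x) / 2) *\<^sub>R ((?Y 0 ** n x) ** ctransp (k *\<^sub>R Z x) + (?Y 0 ** 0 + (k *\<^sub>R Z x) ** n x) ** ctransp (?Y 0)) + 0 *\<^sub>R (?Y 0 ** n x ** ctransp (?Y 0)) = k *\<^sub>R X x" for k :: real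
    proof -
      have "ctransp (Z x) = - Z x" using ZS(1)[OF x] su2_iff[of "Z x"] by (auto simp: su2_def)
      hence ct: "ctransp (k *\<^sub>R Z x) = - (k *\<^sub>R Z x)" by (simp add: cmat2_eq_iff)
      have "k *\<^sub>R ad (Z x) (n x) = n x ** (- (k *\<^sub>R Z x)) + (k *\<^sub>R Z x) ** n x"
        by (simp add: ad_def cmat2_eq_iff matmul_nth algebra_simps)
      moreover have "ad (Z x) (n x) = X x"
      proof -
        \<comment> \<open>For \<open>\<xi>\<close> orthogonal to the unit vector m, (m x \<xi>) x m
          = \<xi>; with \<open>y = - m x \<xi>\<close> this makes the initial velocity [Z, n] equal
          to \<open>X\<close>.\<close>
        have "\<xi> x = cross3 (cross3 (mframe 3 x) (\<xi> x)) (mframe 3 x)"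
          using cross_skew[of "cross3 (mframe 3 x) (\<xi> x)" "mframe 3 x"] tan[OF x] mframe_inner[OF x, of 3 3]
          by (simp add: Lagrange inner_commute)
        thus ?thesis unfolding ZS[OF x] ad_mat3 y_def using tan[OF x] by simp
      qed
      ultimately show ?thesis unfolding ct by (simp add: matrix_mul_assoc)
    qed
    ultimately show ?thesis by (simp add: has_vector_derivative_def)
  qed
  ultimately show ?thesis
    by (intro that[of \<Phi>]) (auto simp: emb)
qed

lemma section_extension:
  assumes "X \<in> sections hopf"
  obtains Y where "smooth_near Y" "\<And>x. x \<in> SU2 \<Longrightarrow> X x = Y x"
    "\<And>x. x \<in> SU2 \<Longrightarrow> X x = mat3 (coord (Y x)) \<and> coord (Y x) \<bullet> mframe 3 x = 0"
proof -
  obtain U Y where U: "open U" "SU2 \<subseteq> U" and Y: "\<forall>x\<in>SU2. Y x = X x" "Cinf U Y"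
    using assms unfolding sections_def smooth_on_def Cinf_def by blast
  have t: "X x = mat3 (coord (Y x)) \<and> coord (Y x) \<bullet> mframe 3 x = 0" if x: "x \<in> SU2" for x
  proof -
    have "X x \<in> tangent_N (hopf x)" using assms x by (simp add: sections_def)
    then obtain \<xi> where "X x = mat3 \<xi>" "\<xi> \<bullet> mframe 3 x = 0" unfolding tangent_N_hopf[OF x] by blast
    thus ?thesis using Y(1) x by simp
  qed
  show ?thesis
  proof (rule that)
    show "smooth_near Y" unfolding smooth_near_def using U Y(2) by blast
    show "X x = Y x" if "x \<in> SU2" for x using Y(1) that by simp
  qed (rule t)
qed

text \<open>The definite description has a value by \<open>hopf_variation_exists\<close>, and by
  \<open>hessian_of_variation\<close> every admissible variation yields the same one.
  \<open>X'\<close> is the section as given, \<open>X\<close> a smooth extension of it from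
  SU(2).\<close>

lemma hessian_hopf:
  assumes X: "smooth_near X" and tan: "\<And>x. x \<in> SU2 \<Longrightarrow> X' x = X x" "\<And>x. x \<in> SU2 \<Longrightarrow> X' x = mat3 (coord (X x)) \<and> coord (X x) \<bullet> mframe 3 x = 0"
  shows "hessian \<alpha> hopf X' X' = hess \<alpha> (\<lambda>x. coord (X x))"
  unfolding hessian_def
proof (rule the_equality)
  obtain \<Phi> :: "real \<times> real \<Rightarrow> cmat2 \<Rightarrow> cmat2 set" where \<Phi>: "variation hopf \<Phi>"
    "\<And>x. x \<in> SU2 \<Longrightarrow> ((\<lambda>t. emb (\<Phi> (0, t) x)) has_vector_derivative X x) (at 0)"
    "\<And>x. x \<in> SU2 \<Longrightarrow> ((\<lambda>s. emb (\<Phi> (s, 0) x)) has_vector_derivative X x) (at 0)"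
    by (rule hopf_variation_exists[OF X, of "\<lambda>x. coord (X x)"]) (use tan in auto)
  obtain D where "\<forall>\<^sub>F s in nhds 0. ((\<lambda>t. energy \<alpha> (\<Phi> (s, t))) has_real_derivative D s) (at 0)"
    "(D has_real_derivative hess \<alpha> (\<lambda>x. coord (X x))) (at 0)"
    by (rule hessian_of_variation[OF \<Phi>(1) X \<Phi>(2,3)])
  thus "\<exists>\<Phi> D. variation hopf \<Phi> \<and>
     (\<forall>x\<in>SU2. ((\<lambda>t. emb (\<Phi> (0, t) x)) has_vector_derivative X' x) (at 0)) \<and>
     (\<forall>x\<in>SU2. ((\<lambda>s. emb (\<Phi> (s, 0) x)) has_vector_derivative X' x) (at 0)) \<and>
     (\<forall>\<^sub>F s in nhds 0. ((\<lambda>t. energy \<alpha> (\<Phi> (s, t))) has_real_derivative D s) (at 0)) \<and>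
     (D has_real_derivative hess \<alpha> (\<lambda>x. coord (X x))) (at 0)"
    using \<Phi> tan(1) by (intro exI[of _ \<Phi>] exI[of _ D]) simp
next
  fix r assume "\<exists>(\<Phi> :: real \<times> real \<Rightarrow> cmat2 \<Rightarrow> cmat2 set) D. variation hopf \<Phi> \<and>
     (\<forall>x\<in>SU2. ((\<lambda>t. emb (\<Phi> (0, t) x)) has_vector_derivative X' x) (at 0)) \<and>
     (\<forall>x\<in>SU2. ((\<lambda>s. emb (\<Phi> (s, 0) x)) has_vector_derivative X' x) (at 0)) \<and>
     (\<forall>\<^sub>F s in nhds 0. ((\<lambda>t. energy \<alpha> (\<Phi> (s, t))) has_real_derivative D s) (at 0)) \<and>
     (D has_real_derivative r) (at 0)"
  then obtain \<Phi> :: "real \<times> real \<Rightarrow> cmat2 \<Rightarrow> cmat2 set" and D where \<Phi>: "variation hopf \<Phi>"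
     "\<And>x. x\<in>SU2 \<Longrightarrow> ((\<lambda>t. emb (\<Phi> (0, t) x)) has_vector_derivative X x) (at 0)"
     "\<And>x. x\<in>SU2 \<Longrightarrow> ((\<lambda>s. emb (\<Phi> (s, 0) x)) has_vector_derivative X x) (at 0)"
    and D: "\<forall>\<^sub>F s in nhds 0. ((\<lambda>t. energy \<alpha> (\<Phi> (s, t))) has_real_derivative D s) (at 0)"
     "(D has_real_derivative r) (at 0)"
    using tan(1) by auto
  obtain D' where D': "\<forall>\<^sub>F s in nhds 0. ((\<lambda>t. energy \<alpha> (\<Phi> (s, t))) has_real_derivative D' s) (at 0)"
    "(D' has_real_derivative hess \<alpha> (\<lambda>x. coord (X x))) (at 0)"
    by (rule hessian_of_variation[OF \<Phi>(1) X \<Phi>(2,3)])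
  \<comment> \<open>The inner derivatives are unique near \<open>s = 0\<close>, so \<open>D\<close>
    and \<open>D'\<close> have the same derivative at 0.\<close>
  have "\<forall>\<^sub>F s in nhds 0. D s = D' s"
    using D(1) D'(1) by eventually_elim (rule DERIV_unique)
  hence "(D' has_real_derivative r) (at 0)" using D(2) DERIV_cong_ev[OF refl _ refl] by blast
  thus "r = hess \<alpha> (\<lambda>x. coord (X x))" using D'(2) DERIV_unique by blast
qed

section \<open>The Hessian as a quadratic form on complex functions\<close>

text \<open>A tangent field \<open>a mframe 1 + b mframe 2\<close> along the Hopf map is encoded by the function \<open>f = a + i b\<close>.\<close>
definition field_of :: "(cmat2 \<Rightarrow> complex) \<Rightarrow> cmat2 \<Rightarrow> real^3" where
  "field_of f x = Re (f x) *\<^sub>R mframe 1 x + Im (f x) *\<^sub>R mframe 2 x"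

definition hessq :: "real \<Rightarrow> (cmat2 \<Rightarrow> complex) \<Rightarrow> real" where
  "hessq \<alpha> f = integral_SU2 (\<lambda>x. (cmod (lie 1 f x))\<^sup>2 + (cmod (lie 2 f x))\<^sup>2 + (cmod (lie 3 f x))\<^sup>2
     - 2 * Im (cnj (f x) * lie 3 f x)
     + \<alpha> * ((Im (lie 1 f x - \<i> * lie 2 f x))\<^sup>2 + (cmod (lie 3 f x))\<^sup>2 - Im (cnj (f x) * lie 3 f x)))"

lemma smooth_near_field_of: "smooth_near f \<Longrightarrow> smooth_near (field_of f)"
  unfolding field_of_def[abs_def]
  by (intro smooth_near_add smooth_near_bilinear[OF bounded_bilinear_scaleR] smooth_near_apply_linear[OF bounded_linear_Re]
    smooth_near_apply_linear[OF bounded_linear_Im] smooth_near_mframe)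

lemma lie_field_of:
  assumes f: "smooth_near f" and x: "x \<in> SU2"
  shows "lie i (field_of f) x = Re (lie i f x) *\<^sub>R mframe 1 x + Im (lie i f x) *\<^sub>R mframe 2 x
     + (Re (f x) *\<^sub>R lie i (mframe 1) x + Im (f x) *\<^sub>R lie i (mframe 2) x)"
proof -
  note L = bounded_linear_Re bounded_linear_Im
  note S = smooth_near_apply_linear[OF L(1) f] smooth_near_apply_linear[OF L(2) f]
  note B = bounded_bilinear_scaleR
  have "lie i (field_of f) x = lie i (\<lambda>x. Re (f x) *\<^sub>R mframe 1 x) x + lie i (\<lambda>x. Im (f x) *\<^sub>R mframe 2 x) x"
    unfolding field_of_def[abs_def]
    by (rule lie_add[OF smooth_near_bilinear[OF B S(1) smooth_near_mframe] smooth_near_bilinear[OF B S(2) smooth_near_mframe] x])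
  thus ?thesis
    unfolding lie_bilinear[OF B S(1) smooth_near_mframe x] lie_bilinear[OF B S(2) smooth_near_mframe x]
      lie_apply_linear[OF L(1) f x] lie_apply_linear[OF L(2) f x] by simp
qed

text \<open>The rotation of the frame \<open>mframe\<close> creates the terms of order zero, and
  these cancel: the \<open>mframe 3\<close> components and the square of the third derivative give 2
  |f|^2 against - 2 (X . X), and likewise within the \<alpha> part.\<close>

lemma hess_field_of:
  assumes f: "smooth_near f"
  shows "hess \<alpha> (field_of f) = hessq \<alpha> f"
  unfolding hess_def hessq_def
proof (rule integral_SU2_cong)
  fix x assume x: "x \<in> SU2"
  define a b where "a = Re (f x)" and "b = Im (f x)"
  define A B where "A i = Re (lie i f x)" and "B i = Im (lie i f x)" for i
  define m where "m i = mframe i x" for i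
  note L = lie_field_of[OF f x]
  have l: "lie 1 (field_of f) x = A 1 *\<^sub>R m 1 + B 1 *\<^sub>R m 2 + (- b) *\<^sub>R m 3"
    "lie 2 (field_of f) x = A 2 *\<^sub>R m 1 + B 2 *\<^sub>R m 2 + a *\<^sub>R m 3"
    "lie 3 (field_of f) x = (A 3 + b) *\<^sub>R m 1 + (B 3 - a) *\<^sub>R m 2"
    "field_of f x = a *\<^sub>R m 1 + b *\<^sub>R m 2"
    unfolding L by (simp_all add: lie_mframe x A_def B_def a_def b_def m_def field_of_def algebra_simps)
  have mm: "m 1 \<bullet> m 1 = 1" "m 2 \<bullet> m 2 = 1" "m 3 \<bullet> m 3 = 1" "m 1 \<bullet> m 2 = 0" "m 1 \<bullet> m 3 = 0" "m 2 \<bullet> m 3 = 0"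
      "m 2 \<bullet> m 1 = 0" "m 3 \<bullet> m 1 = 0" "m 3 \<bullet> m 2 = 0"
    by (simp_all add: m_def mframe_inner x)
  have mc: "cross3 (m 1) (m 2) = m 3" "cross3 (m 2) (m 3) = m 1" "cross3 (m 3) (m 1) = m 2"
     "cross3 (m 2) (m 1) = - m 3" "cross3 (m 3) (m 2) = - m 1" "cross3 (m 1) (m 3) = - m 2"
    using mframe_cross[OF x] cross_skew[of "m 2" "m 1"] cross_skew[of "m 3" "m 2"] cross_skew[of "m 1" "m 3"] by (simp_all add: m_def)
  note alg = l mm mc cross_add_left cross_add_right cross_mult_left cross_mult_right inner_add_left inner_add_right
    bounded_bilinear.diff_left[OF bounded_bilinear_cross3] bounded_bilinear.diff_right[OF bounded_bilinear_cross3] inner_diff_left inner_diff_right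
  have o: "omega_dot 1 2 (field_of f) x = B 1 - A 2" "omega_dot 1 3 (field_of f) x = - (A 3 + b)"
     "omega_dot 2 3 (field_of f) x = - (B 3 - a)"
    unfolding omega_dot_def lie_mframe[OF x] m_def[symmetric] by (simp_all add: alg)
  have t: "mframe 3 x \<bullet> cross3 (field_of f x) (lie 3 (field_of f) x) = a * (B 3 - a) - b * (A 3 + b)"
    unfolding m_def[symmetric] by (simp add: alg)
  have n: "lie 1 (field_of f) x \<bullet> lie 1 (field_of f) x = (A 1)\<^sup>2 + (B 1)\<^sup>2 + b\<^sup>2"
    "lie 2 (field_of f) x \<bullet> lie 2 (field_of f) x = (A 2)\<^sup>2 + (B 2)\<^sup>2 + a\<^sup>2"
    "lie 3 (field_of f) x \<bullet> lie 3 (field_of f) x = (A 3 + b)\<^sup>2 + (B 3 - a)\<^sup>2"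
    "field_of f x \<bullet> field_of f x = a\<^sup>2 + b\<^sup>2"
    by (simp_all add: alg power2_eq_square)
  have c: "(cmod (lie i f x))\<^sup>2 = (A i)\<^sup>2 + (B i)\<^sup>2" "Im (cnj (f x) * lie 3 f x) = a * B 3 - b * A 3"
     "Im (lie 1 f x - \<i> * lie 2 f x) = B 1 - A 2" for i
    by (simp_all add: cmod_power2 A_def B_def a_def b_def)
  show "lie 1 (field_of f) x \<bullet> lie 1 (field_of f) x + lie 2 (field_of f) x \<bullet> lie 2 (field_of f) x + lie 3 (field_of f) x \<bullet> lie 3 (field_of f) x
      - 2 * (field_of f x \<bullet> field_of f x) + \<alpha> * ((omega_dot 1 2 (field_of f) x)\<^sup>2 + (omega_dot 1 3 (field_of f) x)\<^sup>2 + (omega_dot 2 3 (field_of f) x)\<^sup>2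
        + mframe 3 x \<bullet> cross3 (field_of f x) (lie 3 (field_of f) x))
    = (cmod (lie 1 f x))\<^sup>2 + (cmod (lie 2 f x))\<^sup>2 + (cmod (lie 3 f x))\<^sup>2 - 2 * Im (cnj (f x) * lie 3 f x)
     + \<alpha> * ((Im (lie 1 f x - \<i> * lie 2 f x))\<^sup>2 + (cmod (lie 3 f x))\<^sup>2 - Im (cnj (f x) * lie 3 f x))"
    unfolding n o t c by (simp add: power2_eq_square algebra_simps)
qed

lemma hess_cong:
  assumes "smooth_near X" "smooth_near Y" "\<And>x. x \<in> SU2 \<Longrightarrow> X x = Y x"
  shows "hess \<alpha> X = hess \<alpha> Y"
  unfolding hess_def omega_dot_def
  by (rule integral_SU2_cong) (simp add: assms(3) lie_cong[OF assms])

lemma mframe_expansion: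
  assumes x: "x \<in> SU2" and c: "v \<bullet> mframe 3 x = 0"
  shows "v = (v \<bullet> mframe 1 x) *\<^sub>R mframe 1 x + (v \<bullet> mframe 2 x) *\<^sub>R mframe 2 x"
proof -
  obtain d where d: "v = rot x d" using rot_surj[OF x] by metis
  define p where "p = (v \<bullet> mframe 1 x) *\<^sub>R mframe 1 x + (v \<bullet> mframe 2 x) *\<^sub>R mframe 2 x"
  obtain e where e: "p = rot x e" using rot_surj[OF x] by metis
  have "d $ i = e $ i" for i
  proof -
    have "d $ i = v \<bullet> mframe i x" unfolding d mframe_rot rot_inner[OF x] by (simp add: inner_axis)
    also have "v \<bullet> mframe i x = p \<bullet> mframe i x"
      using exhaust_3[of i] c by (auto simp: p_def inner_add_left mframe_inner x)
    also have "\<dots> = e $ i" unfolding e mframe_rot rot_inner[OF x] by (simp add: inner_axis)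
    finally show ?thesis .
  qed
  hence "d = e" by (simp add: vec_eq_iff)
  thus ?thesis using d e p_def by simp
qed

lemma hessian_hopf_hessq:
  assumes "X \<in> sections hopf"
  obtains f where "smooth_near f" "hessian \<alpha> hopf X X = hessq \<alpha> f"
proof -
  obtain Y where Y: "smooth_near Y" "\<And>x. x \<in> SU2 \<Longrightarrow> X x = Y x"
    "\<And>x. x \<in> SU2 \<Longrightarrow> X x = mat3 (coord (Y x)) \<and> coord (Y x) \<bullet> mframe 3 x = 0"
    by (rule section_extension[OF assms]) (rule that, assumption+)
  define f where "f x = complex_of_real (coord (Y x) \<bullet> mframe 1 x) + \<i> * complex_of_real (coord (Y x) \<bullet> mframe 2 x)" for x
  have cY: "smooth_near (\<lambda>x. coord (Y x))" by (rule smooth_near_apply_linear[OF linear_coord Y(1)])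
  have f: "smooth_near f" unfolding f_def[abs_def]
    by (intro smooth_near_add smooth_near_mult smooth_near_const smooth_near_apply_linear[OF bounded_linear_of_real]
      smooth_near_inner cY smooth_near_mframe)
  have "hessian \<alpha> hopf X X = hess \<alpha> (\<lambda>x. coord (Y x))" by (rule hessian_hopf[OF Y])
  also have "\<dots> = hess \<alpha> (field_of f)"
    by (rule hess_cong[OF cY smooth_near_field_of[OF f]])
       (use mframe_expansion Y(3) in \<open>auto simp: field_of_def f_def\<close>)
  also have "\<dots> = hessq \<alpha> f" by (rule hess_field_of[OF f])
  finally show ?thesis using that f by blast
qed

lemma field_of_section:
  assumes f: "smooth_near f"
  shows "(\<lambda>x. mat3 (field_of f x)) \<in> sections hopf" "hessian \<alpha> hopf (\<lambda>x. mat3 (field_of f x)) (\<lambda>x. mat3 (field_of f x)) = hessq \<alpha> f"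
proof -
  have s: "smooth_near (\<lambda>x. mat3 (field_of f x))"
    by (rule smooth_near_apply_linear[OF linear_mat3 smooth_near_field_of[OF f]])
  have o: "field_of f x \<bullet> mframe 3 x = 0" if "x \<in> SU2" for x
    using that by (simp add: field_of_def inner_add_left mframe_inner)
  show "(\<lambda>x. mat3 (field_of f x)) \<in> sections hopf"
    using s o unfolding sections_def smooth_near_def smooth_on_def Cinf_def by (auto simp: tangent_N_hopf)
  have "hessian \<alpha> hopf (\<lambda>x. mat3 (field_of f x)) (\<lambda>x. mat3 (field_of f x)) = hess \<alpha> (\<lambda>x. coord (mat3 (field_of f x)))"
    by (rule hessian_hopf[OF s]) (auto simp: o)
  thus "hessian \<alpha> hopf (\<lambda>x. mat3 (field_of f x)) (\<lambda>x. mat3 (field_of f x)) = hessq \<alpha> f"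
    by (simp add: hess_field_of[OF f])
qed

lemma lie_entries:
  "lie 1 (\<lambda>x. x $ i $ 1) x = \<i> / 2 * x $ i $ 2" "lie 1 (\<lambda>x. x $ i $ 2) x = \<i> / 2 * x $ i $ 1"
  "lie 2 (\<lambda>x. x $ i $ 1) x = - x $ i $ 2 / 2" "lie 2 (\<lambda>x. x $ i $ 2) x = x $ i $ 1 / 2"
  "lie 3 (\<lambda>x. x $ i $ 1) x = \<i> / 2 * x $ i $ 1" "lie 3 (\<lambda>x. x $ i $ 2) x = - (\<i> / 2 * x $ i $ 2)"
  by (simp_all add: lie_linear[OF bounded_linear_nth2] frame_def matmul_nth theta_nth)

text \<open>g_11 is annihilated by e_1 + i e_2, so no positive contribution comes from raising. The
  three integrals that remain are multiples of the volume, because left-invariant derivatives of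
  suitable quadratic functions integrate to zero.\<close>

lemma hessq_entry:
  "hessq \<alpha> (\<lambda>x. x $ 1 $ 1) = (\<alpha> - 1) / 8 * integral_SU2 (\<lambda>x. 1)"
proof -
  define p q where "p = integral_SU2 (\<lambda>x. (cmod (x $ 1 $ 1))\<^sup>2)" and "q = integral_SU2 (\<lambda>x. (cmod (x $ 1 $ 2))\<^sup>2)"
  define r where "r = integral_SU2 (\<lambda>x. (Re (x $ 1 $ 2))\<^sup>2)"
  note S = smooth_near_linear[OF bounded_linear_nth2]
  have c: "continuous_on SU2 (\<lambda>x. (cmod (x $ i $ j))\<^sup>2)" "continuous_on SU2 (\<lambda>x. (Re (x $ i $ j))\<^sup>2)" "continuous_on SU2 (\<lambda>x. (Im (x $ i $ j))\<^sup>2)" for i j :: 2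
    by (intro continuous_intros)+
  have lin: "integral_SU2 (\<lambda>x. a * P x + b * Q x + c * (R x - d * Q x)) = a * integral_SU2 P + b * integral_SU2 Q + c * (integral_SU2 R - d * integral_SU2 Q)"
    if "continuous_on SU2 P" "continuous_on SU2 Q" "continuous_on SU2 R" for a b c d P Q R
    using that by (simp add: integral_SU2_add integral_SU2_diff integral_SU2_cmult continuous_on_add continuous_on_diff continuous_on_mult_left)
  have "integral_SU2 (\<lambda>x. 1) = p + q"
  proof -
    have "integral_SU2 (\<lambda>x. 1) = integral_SU2 (\<lambda>x. (cmod (x $ 1 $ 1))\<^sup>2 + (cmod (x $ 1 $ 2))\<^sup>2)"
      by (rule integral_SU2_cong) (simp add: SU2_iff)
    thus ?thesis by (simp add: p_def q_def integral_SU2_add c)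
  qed
  \<comment> \<open>\<open>lie 1\<close> rotates the two entries of a row into each other, so
    differentiating Im (x_11 cnj x_12) yields half the difference of their squared moduli.\<close>
  moreover have "p = q"
  proof -
    have 1: "smooth_near (\<lambda>x. Im (x $ 1 $ 1 * cnj (x $ 1 $ 2)))"
      by (intro smooth_near_apply_linear[OF bounded_linear_Im] smooth_near_mult S smooth_near_apply_linear[OF bounded_linear_cnj])
    have "lie 1 (\<lambda>x. Im (x $ 1 $ 1 * cnj (x $ 1 $ 2))) x = 1/2 * ((cmod (x $ 1 $ 2))\<^sup>2 - (cmod (x $ 1 $ 1))\<^sup>2)" if x: "x \<in> SU2" for x
    proof -
      have "lie 1 (\<lambda>x. x $ 1 $ 1 * cnj (x $ 1 $ 2)) x = x $ 1 $ 1 * cnj (\<i> / 2 * x $ 1 $ 1) + \<i> / 2 * x $ 1 $ 2 * cnj (x $ 1 $ 2)"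
        by (simp only: lie_bilinear[OF bounded_bilinear_mult S smooth_near_apply_linear[OF bounded_linear_cnj S] x] lie_apply_linear[OF bounded_linear_cnj S x] lie_entries)
      moreover have "lie 1 (\<lambda>x. Im (x $ 1 $ 1 * cnj (x $ 1 $ 2))) x = Im (lie 1 (\<lambda>x. x $ 1 $ 1 * cnj (x $ 1 $ 2)) x)"
        by (rule lie_apply_linear[OF bounded_linear_Im smooth_near_mult[OF S smooth_near_apply_linear[OF bounded_linear_cnj S]] x])
      ultimately show ?thesis by (simp only:) (simp add: cmod_power2, simp add: power2_eq_square field_simps)
    qed
    from integral_SU2_cong[OF this] integral_lie[OF 1, of 1]
    have "integral_SU2 (\<lambda>x. 1/2 * ((cmod (x $ 1 $ 2))\<^sup>2 - (cmod (x $ 1 $ 1))\<^sup>2)) = 0" by (simp only:)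
    thus ?thesis unfolding integral_SU2_cmult integral_SU2_diff[OF c(1) c(1)] p_def q_def by simp
  qed
  \<comment> \<open>\<open>lie 3\<close> rotates the phase of x_12, so real and imaginary part have
    the same mean square.\<close>
  moreover have "q = 2 * r"
  proof -
    have 1: "smooth_near (\<lambda>x. Re (x $ 1 $ 2) * Im (x $ 1 $ 2))"
      by (intro smooth_near_mult smooth_near_apply_linear[OF bounded_linear_Im] smooth_near_apply_linear[OF bounded_linear_Re] S)
    have "lie 3 (\<lambda>x. Re (x $ 1 $ 2) * Im (x $ 1 $ 2)) x = 1/2 * ((Im (x $ 1 $ 2))\<^sup>2 - (Re (x $ 1 $ 2))\<^sup>2)" if x: "x \<in> SU2" for x
      unfolding lie_bilinear[OF bounded_bilinear_mult smooth_near_apply_linear[OF bounded_linear_Re S] smooth_near_apply_linear[OF bounded_linear_Im S] x]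
        lie_apply_linear[OF bounded_linear_Re S x] lie_apply_linear[OF bounded_linear_Im S x] lie_entries
      by (simp add: power2_eq_square algebra_simps)
    from integral_SU2_cong[OF this] integral_lie[OF 1, of 3]
    have "integral_SU2 (\<lambda>x. 1/2 * ((Im (x $ 1 $ 2))\<^sup>2 - (Re (x $ 1 $ 2))\<^sup>2)) = 0" by (simp only:)
    hence "integral_SU2 (\<lambda>x. (Im (x $ 1 $ 2))\<^sup>2) = r"
      unfolding integral_SU2_cmult integral_SU2_diff[OF c(3) c(2)] r_def by simp
    thus ?thesis unfolding q_def cmod_power2 by (simp add: integral_SU2_add c r_def)
  qed
  moreover have "hessq \<alpha> (\<lambda>x. x $ 1 $ 1) = 1/2 * q + (- 3/4) * p + \<alpha> * (r - 1/4 * p)"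
  proof -
    have "hessq \<alpha> (\<lambda>x. x $ 1 $ 1) = integral_SU2 (\<lambda>x. 1/2 * (cmod (x $ 1 $ 2))\<^sup>2 + (- 3/4) * (cmod (x $ 1 $ 1))\<^sup>2 + \<alpha> * ((Re (x $ 1 $ 2))\<^sup>2 - 1/4 * (cmod (x $ 1 $ 1))\<^sup>2))"
      unfolding hessq_def lie_entries
      by (rule integral_SU2_cong)
         (simp add: norm_mult norm_divide power_mult_distrib power_divide cmod_power2, simp add: power2_eq_square field_simps)
    also have "\<dots> = 1/2 * q + (- 3/4) * p + \<alpha> * (r - 1/4 * p)"
      unfolding p_def q_def r_def by (rule lin[OF c(1) c(1) c(2)])
    finally show ?thesis .
  qed
  ultimately show ?thesis by (simp add: algebra_simps)
qed

lemma hopf_unstable: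
  assumes "\<alpha> < 1" shows "\<not> stable_map \<alpha> hopf"
proof
  assume s: "stable_map \<alpha> hopf"
  let ?f = "\<lambda>x::cmat2. x $ 1 $ 1"
  have f: "smooth_near ?f" by (rule smooth_near_linear[OF bounded_linear_nth2])
  have "hessq \<alpha> ?f \<ge> 0"
    using s field_of_section(1)[OF f] unfolding stable_map_def field_of_section(2)[OF f, of \<alpha>, symmetric] by blast
  moreover have "hessq \<alpha> ?f < 0"
    unfolding hessq_entry using assms integral_SU2_one_pos by (intro mult_neg_pos) auto
  ultimately show False by simp
qed


section \<open>Weights\<close>

text \<open>The real L2 product. Because of the term with Im, \<open>hessq\<close> is quadratic over
  the reals only, so multiplication by i and conjugation are tracked separately.\<close>

definition ip :: "(cmat2 \<Rightarrow> complex) \<Rightarrow> (cmat2 \<Rightarrow> complex) \<Rightarrow> real" where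
  "ip f g = integral_SU2 (\<lambda>x. f x \<bullet> g x)"

definition lower :: "(cmat2 \<Rightarrow> complex) \<Rightarrow> cmat2 \<Rightarrow> complex" where
  "lower f x = lie 1 f x - \<i> * lie 2 f x"

definition raise :: "(cmat2 \<Rightarrow> complex) \<Rightarrow> cmat2 \<Rightarrow> complex" where
  "raise f x = lie 1 f x + \<i> * lie 2 f x"

lemma smooth_near_cmult: "smooth_near f \<Longrightarrow> smooth_near (\<lambda>x. c * f x)" for c :: "'c::real_normed_algebra"
  by (intro smooth_near_mult smooth_near_const)

lemma smooth_near_minus: "smooth_near f \<Longrightarrow> smooth_near (\<lambda>x. - f x)"
  by (rule smooth_near_apply_linear[OF bounded_linear_minus[OF bounded_linear_ident]])

lemma smooth_near_diff: "smooth_near f \<Longrightarrow> smooth_near g \<Longrightarrow> smooth_near (\<lambda>x. f x - g x)"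
  using smooth_near_add[OF _ smooth_near_minus, of f g] by simp

lemma smooth_near_cnj: "smooth_near f \<Longrightarrow> smooth_near (\<lambda>x. cnj (f x))"
  by (rule smooth_near_apply_linear[OF bounded_linear_cnj])

lemma smooth_near_lower: "smooth_near f \<Longrightarrow> smooth_near (lower f)"
  unfolding lower_def[abs_def] by (intro smooth_near_diff smooth_near_cmult smooth_near_lie)

lemma smooth_near_raise: "smooth_near f \<Longrightarrow> smooth_near (raise f)"
  unfolding raise_def[abs_def] by (intro smooth_near_add smooth_near_cmult smooth_near_lie)

lemmas smooth_intros = smooth_near_const smooth_near_add smooth_near_diff smooth_near_minus smooth_near_cmult smooth_near_mult
  smooth_near_cnj smooth_near_lower smooth_near_raise smooth_near_lie smooth_near_sum

lemma lie_cmult: "smooth_near f \<Longrightarrow> x \<in> SU2 \<Longrightarrow> lie i (\<lambda>x. c * f x) x = c * lie i f x" for c :: "'c::real_normed_algebra"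
  by (rule lie_apply_linear[OF bounded_linear_mult_right])

lemma lie_mult: "smooth_near f \<Longrightarrow> smooth_near g \<Longrightarrow> x \<in> SU2 \<Longrightarrow> lie i (\<lambda>x. f x * g x) x = f x * lie i g x + lie i f x * g x"
  for f :: "cmat2 \<Rightarrow> 'c::real_normed_algebra"
  by (rule lie_bilinear[OF bounded_bilinear_mult])

lemma lie_cnj: "smooth_near f \<Longrightarrow> x \<in> SU2 \<Longrightarrow> lie i (\<lambda>x. cnj (f x)) x = cnj (lie i f x)"
  by (rule lie_apply_linear[OF bounded_linear_cnj])

lemma lie_minus: "smooth_near f \<Longrightarrow> x \<in> SU2 \<Longrightarrow> lie i (\<lambda>x. - f x) x = - lie i f x"
  by (rule lie_apply_linear[OF bounded_linear_minus[OF bounded_linear_ident]])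

lemma lie_diff: "smooth_near f \<Longrightarrow> smooth_near g \<Longrightarrow> x \<in> SU2 \<Longrightarrow> lie i (\<lambda>x. f x - g x) x = lie i f x - lie i g x"
  using lie_add[OF _ smooth_near_minus, of f g x i] lie_minus[of g x i] by simp

lemma ip_cong: "(\<And>x. x \<in> SU2 \<Longrightarrow> f x = f' x) \<Longrightarrow> (\<And>x. x \<in> SU2 \<Longrightarrow> g x = g' x) \<Longrightarrow> ip f g = ip f' g'"
  unfolding ip_def by (rule integral_SU2_cong) simp

lemma continuous_ip: "smooth_near f \<Longrightarrow> smooth_near g \<Longrightarrow> continuous_on SU2 (\<lambda>x. f x \<bullet> g x)"
  by (intro smooth_near_continuous_on smooth_near_inner)

lemma ip_commute: "ip f g = ip g f"
  unfolding ip_def by (simp add: inner_commute)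

lemma ip_add:
  "smooth_near f \<Longrightarrow> smooth_near g \<Longrightarrow> smooth_near h \<Longrightarrow> ip (\<lambda>x. f x + g x) h = ip f h + ip g h"
  "smooth_near f \<Longrightarrow> smooth_near g \<Longrightarrow> smooth_near h \<Longrightarrow> ip h (\<lambda>x. f x + g x) = ip h f + ip h g"
  unfolding ip_def by (simp_all add: inner_add_left inner_add_right integral_SU2_add continuous_ip)

lemma ip_diff:
  "smooth_near f \<Longrightarrow> smooth_near g \<Longrightarrow> smooth_near h \<Longrightarrow> ip (\<lambda>x. f x - g x) h = ip f h - ip g h"
  "smooth_near f \<Longrightarrow> smooth_near g \<Longrightarrow> smooth_near h \<Longrightarrow> ip h (\<lambda>x. f x - g x) = ip h f - ip h g"
  unfolding ip_def by (simp_all add: inner_diff_left inner_diff_right integral_SU2_diff continuous_ip)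

lemma ip_minus: "ip (\<lambda>x. - f x) h = - ip f h" "ip h (\<lambda>x. - f x) = - ip h f"
  unfolding ip_def by (simp_all add: integral_SU2_minus)

lemma ip_scale: "ip (\<lambda>x. of_real c * f x) h = c * ip f h" "ip h (\<lambda>x. of_real c * f x) = c * ip h f"
  unfolding ip_def by (simp_all add: integral_SU2_cmult[symmetric] scaleR_conv_of_real[symmetric])

lemma ip_nonneg: "ip f f \<ge> 0"
  unfolding ip_def by (rule integral_SU2_nonneg) simp

lemma ip_mult_i: "ip (\<lambda>x. \<i> * f x) g = - ip f (\<lambda>x. \<i> * g x)" "ip (\<lambda>x. \<i> * f x) (\<lambda>x. \<i> * g x) = ip f g"
  unfolding ip_def integral_SU2_minus[symmetric] by (rule integral_SU2_cong; simp add: inner_complex_def)+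

lemma ip_cnj: "ip (\<lambda>x. cnj (f x)) g = ip f (\<lambda>x. cnj (g x))" "ip (\<lambda>x. cnj (f x)) (\<lambda>x. cnj (g x)) = ip f g"
  unfolding ip_def by (rule integral_SU2_cong; simp add: inner_complex_def)+

lemma ip_sum:
  assumes "\<And>i. i \<in> I \<Longrightarrow> smooth_near (f i)" "smooth_near g"
  shows "ip (\<lambda>x. \<Sum>i\<in>I. f i x) g = (\<Sum>i\<in>I. ip (f i) g)" "ip g (\<lambda>x. \<Sum>i\<in>I. f i x) = (\<Sum>i\<in>I. ip g (f i))"
  unfolding ip_def by (simp_all add: inner_sum_left inner_sum_right integral_SU2_sum continuous_ip assms)

lemma ip_lie: "smooth_near f \<Longrightarrow> smooth_near g \<Longrightarrow> ip (lie i f) g = - ip f (lie i g)"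
  unfolding ip_def by (rule integral_by_parts_inner)

text \<open>The fields are skew-adjoint and the adjoint of i is - i, hence \<open>raise\<close> and
  \<open>lower\<close> are negative adjoints of each other.\<close>

lemma ip_lower:
  assumes f: "smooth_near f" and g: "smooth_near g"
  shows "ip (lower f) g = - ip f (raise g)" "ip (raise f) g = - ip f (lower g)"
proof -
  have "ip (\<lambda>x. \<i> * lie 2 f x) g = ip f (\<lambda>x. \<i> * lie 2 g x)"
  proof -
    have "ip (\<lambda>x. \<i> * lie 2 f x) g = - ip (lie 2 f) (\<lambda>x. \<i> * g x)" by (rule ip_mult_i)
    also have "\<dots> = ip f (lie 2 (\<lambda>x. \<i> * g x))" by (simp add: ip_lie f smooth_near_cmult g)
    also have "\<dots> = ip f (\<lambda>x. \<i> * lie 2 g x)" by (rule ip_cong) (simp_all add: lie_cmult g)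
    finally show ?thesis .
  qed
  thus "ip (lower f) g = - ip f (raise g)" "ip (raise f) g = - ip f (lower g)"
    unfolding lower_def[abs_def] raise_def[abs_def]
    by (simp_all add: ip_add ip_diff ip_lie f g smooth_near_lie smooth_near_cmult)
qed

lemma raise_lower_commutator:
  assumes f: "smooth_near f" and x: "x \<in> SU2"
  shows "lower (raise f) x - raise (lower f) x = - 2 * \<i> * lie 3 f x"
    "lie 3 (lower f) x = lower (lie 3 f) x - \<i> * lower f x"
proof -
  note s = smooth_near_lie[OF f] smooth_near_cmult[OF smooth_near_lie[OF f]]
  have r: "lie i (raise f) x = lie i (lie 1 f) x + \<i> * lie i (lie 2 f) x"
    "lie i (lower f) x = lie i (lie 1 f) x - \<i> * lie i (lie 2 f) x" for i
    unfolding raise_def[abs_def] lower_def[abs_def]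
    by (simp_all add: lie_add[OF s x] lie_diff[OF s x] lie_cmult[OF s(1) x])
  note c = lie_commutator[OF f x]
  have c': "lie 1 (lie 2 f) x = lie 2 (lie 1 f) x - lie 3 f x" "lie 3 (lie 2 f) x = lie 2 (lie 3 f) x + lie 1 f x"
    "lie 3 (lie 1 f) x = lie 1 (lie 3 f) x - lie 2 f x"
    using c by (simp_all add: algebra_simps)
  show "lower (raise f) x - raise (lower f) x = - 2 * \<i> * lie 3 f x"
    unfolding lower_def[of "raise f"] raise_def[of "lower f"] r c' by (simp add: algebra_simps)
  show "lie 3 (lower f) x = lower (lie 3 f) x - \<i> * lower f x"
    unfolding r c' unfolding lower_def by (simp_all add: algebra_simps)
qed

lemma raise_add: "smooth_near f \<Longrightarrow> smooth_near g \<Longrightarrow> x \<in> SU2 \<Longrightarrow> raise (\<lambda>x. f x + g x) x = raise f x + raise g x"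
  and lower_add: "smooth_near f \<Longrightarrow> smooth_near g \<Longrightarrow> x \<in> SU2 \<Longrightarrow> lower (\<lambda>x. f x + g x) x = lower f x + lower g x"
  and raise_cmult: "smooth_near f \<Longrightarrow> x \<in> SU2 \<Longrightarrow> raise (\<lambda>x. c * f x) x = c * raise f x"
  and lower_cmult: "smooth_near f \<Longrightarrow> x \<in> SU2 \<Longrightarrow> lower (\<lambda>x. c * f x) x = c * lower f x"
  and raise_cnj: "smooth_near f \<Longrightarrow> x \<in> SU2 \<Longrightarrow> raise (\<lambda>x. cnj (f x)) x = cnj (lower f x)"
  and lower_cong: "smooth_near f \<Longrightarrow> smooth_near g \<Longrightarrow> (\<And>x. x \<in> SU2 \<Longrightarrow> f x = g x) \<Longrightarrow> x \<in> SU2 \<Longrightarrow> lower f x = lower g x"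
  by (simp_all add: raise_def lower_def lie_add lie_cmult lie_cnj lie_cong[of f g] algebra_simps)

lemma lower_mult: "smooth_near f \<Longrightarrow> smooth_near g \<Longrightarrow> x \<in> SU2 \<Longrightarrow> lower (\<lambda>x. f x * g x) x = f x * lower g x + lower f x * g x"
  by (simp add: lower_def lie_mult algebra_simps)

lemma lower_sum:
  assumes "\<And>i. i \<in> I \<Longrightarrow> smooth_near (f i)" "x \<in> SU2"
  shows "lower (\<lambda>x. \<Sum>i\<in>I. f i x) x = (\<Sum>i\<in>I. lower (f i) x)"
  unfolding lower_def by (simp add: lie_sum assms sum_subtractf sum_distrib_left)

text \<open>\<open>wt m f\<close>: \<open>f\<close> has weight \<open>m / 2\<close> for the right action of the maximal torus.\<close>
definition wt :: "int \<Rightarrow> (cmat2 \<Rightarrow> complex) \<Rightarrow> bool" where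
  "wt m f \<longleftrightarrow> smooth_near f \<and> (\<forall>x\<in>SU2. lie 3 f x = \<i> * (of_int m / 2) * f x)"

lemma wt_smooth: "wt m f \<Longrightarrow> smooth_near f" by (simp add: wt_def)
lemma wt_lie: "wt m f \<Longrightarrow> x \<in> SU2 \<Longrightarrow> lie 3 f x = \<i> * (of_int m / 2) * f x" by (simp add: wt_def)

text \<open>From [e_3, L] = - i L. The index counts halves of weights, so one step down subtracts
  2.\<close>

lemma wt_lower: assumes "wt m f" shows "wt (m - 2) (lower f)"
  unfolding wt_def
proof (intro conjI ballI)
  note f = wt_smooth[OF assms]
  show "smooth_near (lower f)" by (intro smooth_intros f)
  fix x assume x: "x \<in> SU2"
  have "lower (lie 3 f) x = lower (\<lambda>x. (\<i> * (of_int m / 2)) * f x) x"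
    by (rule lower_cong[OF _ _ wt_lie[OF assms] x]) (intro smooth_intros f)+
  also have "\<dots> = \<i> * (of_int m / 2) * lower f x" by (rule lower_cmult[OF f x])
  finally show "lie 3 (lower f) x = \<i> * (of_int (m - 2) / 2) * lower f x"
    unfolding raise_lower_commutator(2)[OF f x] by (simp add: field_simps)
qed

lemma wt_cnj: "wt m f \<Longrightarrow> wt (- m) (\<lambda>x. cnj (f x))"
  unfolding wt_def[of "- m"] by (auto simp: lie_cnj[OF wt_smooth[of m]] wt_lie[of m] dest: wt_smooth intro: smooth_near_cnj)

lemma wt_add: "wt m f \<Longrightarrow> wt m g \<Longrightarrow> wt m (\<lambda>x. f x + g x)"
  unfolding wt_def by (auto simp: lie_add algebra_simps intro: smooth_near_add)

lemma wt_cmult: "wt m f \<Longrightarrow> wt m (\<lambda>x. c * f x)"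
  unfolding wt_def by (auto simp: lie_cmult intro: smooth_near_cmult)

lemma wt_zero: "wt m (\<lambda>x. 0)" by (simp add: wt_def)

lemma wt_cong: "wt m f \<Longrightarrow> smooth_near g \<Longrightarrow> (\<And>x. x \<in> SU2 \<Longrightarrow> f x = g x) \<Longrightarrow> wt m g"
  unfolding wt_def using lie_cong[of f g] by auto

lemma wt_mult: "wt m f \<Longrightarrow> wt n g \<Longrightarrow> wt (m + n) (\<lambda>x. f x * g x)"
  unfolding wt_def by (auto simp: lie_mult field_simps intro: smooth_near_mult)

text \<open>Eigenfunctions of a skew-adjoint operator for different eigenvalues.\<close>

lemma wt_orthogonal:
  assumes f: "wt m f" and g: "wt n g" and "m \<noteq> n" shows "ip f g = 0"
proof -
  \<comment> \<open>Chosen so that \<open>lie 3 h\<close> is the real multiple - m/2 of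
    \<open>f\<close>; \<open>ip\<close> commutes with real factors only.\<close>
  define h where "h x = \<i> * f x" for x
  have h: "wt m h" unfolding h_def by (rule wt_cmult[OF f])
  have i: "smooth_near (\<lambda>x. \<i> * g x)" using wt_smooth[OF g] by (rule smooth_near_cmult)
  have "real_of_int m / 2 * ip (\<lambda>x. \<i> * h x) g = ip (\<lambda>x. of_real (of_int m / 2) * (\<i> * h x)) g" by (simp only: ip_scale)
  also have "\<dots> = ip (lie 3 h) g" by (rule ip_cong) (simp_all add: wt_lie[OF h])
  also have "\<dots> = - ip h (lie 3 g)" by (rule ip_lie[OF wt_smooth[OF h] wt_smooth[OF g]])
  also have "ip h (lie 3 g) = ip h (\<lambda>x. of_real (of_int n / 2) * (\<i> * g x))" by (rule ip_cong) (simp_all add: wt_lie[OF g])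
  also have "\<dots> = real_of_int n / 2 * ip h (\<lambda>x. \<i> * g x)" by (rule ip_scale)
  also have "ip h (\<lambda>x. \<i> * g x) = - ip (\<lambda>x. \<i> * h x) g" by (simp add: ip_mult_i)
  finally have "real_of_int (m - n) * ip (\<lambda>x. \<i> * h x) g = 0" by (simp add: field_simps)
  hence "ip (\<lambda>x. \<i> * h x) g = 0" using assms(3) by simp
  moreover have "ip (\<lambda>x. \<i> * h x) g = - ip f g" unfolding h_def ip_minus(1)[symmetric] by (rule ip_cong) simp_all
  ultimately show ?thesis by simp
qed

text \<open>Pointwise, Im z Im w is half of z . w - z . cnj w.\<close>

lemma integral_Im_Im:
  assumes "smooth_near f" "smooth_near g"
  shows "integral_SU2 (\<lambda>x. Im (f x) * Im (g x)) = 1/2 * (ip f g - ip f (\<lambda>x. cnj (g x)))"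
proof -
  have "1/2 * (ip f g - ip f (\<lambda>x. cnj (g x))) = integral_SU2 (\<lambda>x. 1/2 * (f x \<bullet> g x - f x \<bullet> cnj (g x)))"
    unfolding ip_def by (simp only: integral_SU2_cmult integral_SU2_diff[OF continuous_ip[OF assms] continuous_ip[OF assms(1) smooth_near_cnj[OF assms(2)]]])
  also have "\<dots> = integral_SU2 (\<lambda>x. Im (f x) * Im (g x))"
    by (rule integral_SU2_cong) (simp add: inner_complex_def)
  finally show ?thesis by simp
qed

lemma ip_raise_lower:
  assumes f: "smooth_near f"
  shows "ip (raise f) (raise f) - ip (lower f) (lower f) = 2 * ip f (\<lambda>x. \<i> * lie 3 f x)"
proof -
  have "ip (raise f) (raise f) - ip (lower f) (lower f) = - (ip f (lower (raise f)) - ip f (raise (lower f)))"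
    by (simp add: ip_lower f smooth_near_raise smooth_near_lower)
  also have "ip f (lower (raise f)) - ip f (raise (lower f)) = ip f (\<lambda>x. lower (raise f) x - raise (lower f) x)"
    by (simp add: ip_diff smooth_intros f)
  also have "\<dots> = ip f (\<lambda>x. of_real (- 2) * (\<i> * lie 3 f x))"
    by (rule ip_cong) (simp_all add: raise_lower_commutator f mult.assoc)
  also have "\<dots> = - 2 * ip f (\<lambda>x. \<i> * lie 3 f x)" by (rule ip_scale)
  finally show ?thesis by simp
qed

text \<open>|e_1 f|^2 + |e_2 f|^2 is the mean of |R f|^2 and |L f|^2. Trading |L f|^2 for |R f|^2 by
  \<open>ip_raise_lower\<close> halves the coefficient 2 of the first-order term, which then matches
  the \<alpha> part and gives the common factor 1 + \<alpha>.\<close>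

lemma hessq_ip:
  assumes f: "smooth_near f"
  shows "hessq \<alpha> f = ip (raise f) (raise f) + (1 + \<alpha>) * (ip (lie 3 f) (lie 3 f) + ip f (\<lambda>x. \<i> * lie 3 f x))
     + \<alpha> * integral_SU2 (\<lambda>x. (Im (lower f x))\<^sup>2)"
proof -
  define R where "R x = raise f x \<bullet> raise f x" for x
  define L where "L x = lower f x \<bullet> lower f x" for x
  define T where "T x = lie 3 f x \<bullet> lie 3 f x" for x
  define S where "S x = f x \<bullet> (\<i> * lie 3 f x)" for x
  define M where "M x = (Im (lower f x))\<^sup>2" for x
  have c: "continuous_on SU2 R" "continuous_on SU2 L" "continuous_on SU2 T" "continuous_on SU2 S"
    unfolding R_def[abs_def] L_def[abs_def] T_def[abs_def] S_def[abs_def] by (intro continuous_ip smooth_intros f)+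
  have cM: "continuous_on SU2 M" unfolding M_def[abs_def]
    by (intro continuous_intros smooth_near_continuous_on[OF smooth_near_lower[OF f]])
  have "hessq \<alpha> f = integral_SU2 (\<lambda>x. (1/2 * (R x + L x) + T x + 2 * S x) + \<alpha> * (M x + T x + S x))"
    unfolding hessq_def
  proof (rule integral_SU2_cong)
    fix x assume "x \<in> SU2"
    have "(cmod (lie 1 f x))\<^sup>2 + (cmod (lie 2 f x))\<^sup>2 = 1/2 * (R x + L x)"
      by (simp add: R_def L_def raise_def lower_def inner_complex_def cmod_power2, simp add: power2_eq_square algebra_simps)
    moreover have "(cmod (lie 3 f x))\<^sup>2 = T x" "Im (cnj (f x) * lie 3 f x) = - S x"
      by (simp_all add: T_def S_def inner_complex_def cmod_power2) (simp_all add: power2_eq_square algebra_simps)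
    ultimately show "(cmod (lie 1 f x))\<^sup>2 + (cmod (lie 2 f x))\<^sup>2 + (cmod (lie 3 f x))\<^sup>2 - 2 * Im (cnj (f x) * lie 3 f x)
       + \<alpha> * ((Im (lie 1 f x - \<i> * lie 2 f x))\<^sup>2 + (cmod (lie 3 f x))\<^sup>2 - Im (cnj (f x) * lie 3 f x))
       = (1/2 * (R x + L x) + T x + 2 * S x) + \<alpha> * (M x + T x + S x)"
      by (simp only: M_def lower_def) simp
  qed
  also have "\<dots> = (1/2 * (integral_SU2 R + integral_SU2 L) + integral_SU2 T + 2 * integral_SU2 S) + \<alpha> * (integral_SU2 M + integral_SU2 T + integral_SU2 S)"
    by (simp only: integral_SU2_add integral_SU2_cmult c cM continuous_on_add continuous_on_mult_left)
  also have "integral_SU2 L = integral_SU2 R - 2 * integral_SU2 S"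
    using ip_raise_lower[OF f] unfolding ip_def R_def[symmetric] L_def[symmetric] S_def[symmetric] by simp
  finally show ?thesis
    unfolding ip_def R_def[symmetric] T_def[symmetric] S_def[symmetric] M_def[symmetric] by (simp add: algebra_simps)
qed

text \<open>The only dangerous weight is 1/2. It couples through the last term to weight 3/2; writing the weight-1/2 part as
  \<open>raise \<psi>\<close> exhibits the sum of both contributions as a sum of squares.\<close>
lemma dangerous_weights_nonneg:
  assumes \<psi>: "wt (- 1) \<psi>" and w: "wt (- 3) w" and \<alpha>: "\<alpha> \<ge> 1"
  defines "u \<equiv> raise \<psi>"
  shows "(1 + \<alpha>) * (- 1/4 * ip u u + 3/4 * ip w w) + \<alpha> / 2 * ip (\<lambda>x. lower u x - raise w x) (\<lambda>x. lower u x - raise w x) \<ge> 0"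
proof -
  note s\<psi> = wt_smooth[OF \<psi>] and sw = wt_smooth[OF w]
  \<comment> \<open>With this shift the commutator on weight -1/2 gives lower u - raise w = -
    (\<psi> + raise w'), which frees \<psi> itself.\<close>
  define w' where "w' x = w x - lower \<psi> x" for x
  have w': "smooth_near w'" unfolding w'_def[abs_def] by (intro smooth_intros s\<psi> sw)
  define p d c e g where "p = ip \<psi> \<psi>" and "d = ip (lower \<psi>) (lower \<psi>)" and "c = ip (lower \<psi>) w'"
    and "e = ip w' w'" and "g = ip (raise w') (raise w')"
  have u: "ip u u = d + p"
  proof -
    have "ip \<psi> (\<lambda>x. \<i> * lie 3 \<psi> x) = ip \<psi> (\<lambda>x. of_real (1/2) * \<psi> x)"
      by (rule ip_cong) (simp_all add: wt_lie[OF \<psi>])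
    also have "\<dots> = 1/2 * p" unfolding p_def by (rule ip_scale)
    finally show ?thesis using ip_raise_lower[OF s\<psi>] by (simp add: u_def d_def)
  qed
  have ww: "ip w w = d + 2 * c + e"
  proof -
    have "ip w w = ip (\<lambda>x. lower \<psi> x + w' x) (\<lambda>x. lower \<psi> x + w' x)" by (rule ip_cong) (simp_all add: w'_def)
    also have "\<dots> = d + 2 * c + e"
      by (simp add: ip_add smooth_intros s\<psi> w' d_def c_def e_def ip_commute[of w' "lower \<psi>"])
    finally show ?thesis .
  qed
  have l: "ip (\<lambda>x. lower u x - raise w x) (\<lambda>x. lower u x - raise w x) = p - 2 * c + g"
  proof -
    have "lower u x - raise w x = - (\<psi> x + raise w' x)" if x: "x \<in> SU2" for x
    proof -
      have "raise w x = raise (\<lambda>x. lower \<psi> x + w' x) x" by (simp add: w'_def)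
      also have "\<dots> = raise (lower \<psi>) x + raise w' x" by (intro raise_add smooth_intros s\<psi> w' x)
      finally have "lower u x - raise w x = (lower (raise \<psi>) x - raise (lower \<psi>) x) - raise w' x" by (simp add: u_def)
      also have "lower (raise \<psi>) x - raise (lower \<psi>) x = - \<psi> x"
        unfolding raise_lower_commutator(1)[OF s\<psi> x] wt_lie[OF \<psi> x] by (simp add: field_simps)
      finally show ?thesis by simp
    qed
    hence "ip (\<lambda>x. lower u x - raise w x) (\<lambda>x. lower u x - raise w x) = ip (\<lambda>x. - (\<psi> x + raise w' x)) (\<lambda>x. - (\<psi> x + raise w' x))"
      by (intro ip_cong)
    also have "\<dots> = ip (\<lambda>x. \<psi> x + raise w' x) (\<lambda>x. \<psi> x + raise w' x)" by (simp only: ip_minus minus_minus)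
    also have "\<dots> = p + 2 * ip (raise w') \<psi> + g"
      by (simp add: ip_add smooth_intros s\<psi> w' p_def g_def ip_commute[of \<psi> "raise w'"])
    also have "ip (raise w') \<psi> = - c" unfolding ip_lower(2)[OF w' s\<psi>] c_def ip_commute[of w'] ..
    finally show ?thesis by simp
  qed
  have nn: "p \<ge> 0" "e \<ge> 0" "g \<ge> 0" unfolding p_def e_def g_def by (rule ip_nonneg)+
  have dce: "d + 2 * c + e \<ge> 0" using ip_nonneg[of w] by (simp only: ww)
  \<comment> \<open>The weight (3 + \<alpha>)/4 of |w|^2 is forced by the only mixed quantity c. The
    remaining coefficients then come out nonnegative exactly because \<alpha> \<ge> 1.\<close>
  have "(1 + \<alpha>) * (- 1/4 * (d + p) + 3/4 * (d + 2 * c + e)) + \<alpha> / 2 * (p - 2 * c + g)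
     = (\<alpha> - 1) / 4 * p + \<alpha> / 2 * g + (3 + \<alpha>) / 4 * (d + 2 * c + e) + (\<alpha> - 1) / 4 * d + \<alpha> / 2 * e"
    by (simp add: field_simps)
  moreover have d: "d \<ge> 0" unfolding d_def by (rule ip_nonneg)
  have "0 \<le> (\<alpha> - 1) / 4 * p + \<alpha> / 2 * g + (3 + \<alpha>) / 4 * k + (\<alpha> - 1) / 4 * d + \<alpha> / 2 * e" if "k \<ge> 0" for k
    using nn d that \<alpha> by (intro add_nonneg_nonneg mult_nonneg_nonneg) auto
  note this[OF dce]
  ultimately show ?thesis unfolding u ww l by simp
qed

text \<open>The coefficient m (m - 2)/4 of |F m|^2 is negative for the integer m = 1 only. In the
  term with Im, lowering sends weights 1 and 3 to -1 and 1, which conjugation exchanges; the other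
  components are orthogonal to these and to their conjugates. So everything reduces to
  \<open>dangerous_weights_nonneg\<close>.\<close>

lemma hessq_weights_nonneg:
  assumes M: "finite M" "1 \<in> M" "3 \<in> M" and F: "\<And>m. wt m (F m)"
    and \<psi>: "wt (- 1) \<psi>" "\<And>x. x \<in> SU2 \<Longrightarrow> F 1 x = raise \<psi> x"
    and f: "smooth_near f" "\<And>x. x \<in> SU2 \<Longrightarrow> f x = (\<Sum>m\<in>M. F m x)" and \<alpha>: "\<alpha> \<ge> 1"
  shows "hessq \<alpha> f \<ge> 0"
proof -
  note sF = wt_smooth[OF F]
  define u v where "u = F 1" and "v = F 3"
  have sS: "smooth_near (\<lambda>x. \<Sum>m\<in>M. c m * F m x)" for c by (intro smooth_intros sF)
  have l3: "lie 3 f x = (\<Sum>m\<in>M. (\<i> * (of_int m / 2)) * F m x)" if x: "x \<in> SU2" for x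
  proof -
    have "lie 3 f x = lie 3 (\<lambda>x. \<Sum>m\<in>M. F m x) x"
      by (rule lie_cong[OF f(1) _ f(2) x]) (intro smooth_intros sF)
    thus ?thesis by (simp add: lie_sum sF x wt_lie[OF F])
  qed
  have diag: "ip (\<lambda>x. \<Sum>m\<in>M. of_real (a m) * F m x) (\<lambda>x. \<Sum>m\<in>M. of_real (b m) * F m x) = (\<Sum>m\<in>M. a m * b m * ip (F m) (F m))" for a b
  proof -
    have "ip (\<lambda>x. \<Sum>m\<in>M. of_real (a m) * F m x) (\<lambda>x. \<Sum>m\<in>M. of_real (b m) * F m x)
      = (\<Sum>m\<in>M. \<Sum>n\<in>M. a m * (b n * ip (F m) (F n)))"
      by (simp add: ip_sum sF smooth_near_cmult sS ip_scale sum_distrib_left)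
    also have "\<dots> = (\<Sum>m\<in>M. \<Sum>n\<in>M. if n = m then a m * b m * ip (F m) (F m) else 0)"
      using wt_orthogonal[OF F F] by (intro sum.cong refl) auto
    finally show ?thesis using M(1) by simp
  qed
  have "ip (lie 3 f) (lie 3 f) + ip f (\<lambda>x. \<i> * lie 3 f x) = (\<Sum>m\<in>M. (real_of_int m / 2) * (real_of_int m / 2 - 1) * ip (F m) (F m))"
  proof -
    have "ip (lie 3 f) (lie 3 f) = ip (\<lambda>x. \<i> * lie 3 f x) (\<lambda>x. \<i> * lie 3 f x)" by (rule ip_mult_i(2)[symmetric])
    also have "\<dots> = ip (\<lambda>x. \<Sum>m\<in>M. of_real (- real_of_int m / 2) * F m x) (\<lambda>x. \<Sum>m\<in>M. of_real (- real_of_int m / 2) * F m x)"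
      by (rule ip_cong) (simp_all add: l3 sum_distrib_left, simp_all add: mult.assoc[symmetric])
    also have "\<dots> = (\<Sum>m\<in>M. (- real_of_int m / 2) * (- real_of_int m / 2) * ip (F m) (F m))" by (rule diag)
    moreover have "ip f (\<lambda>x. \<i> * lie 3 f x) = ip (\<lambda>x. \<Sum>m\<in>M. of_real 1 * F m x) (\<lambda>x. \<Sum>m\<in>M. of_real (- real_of_int m / 2) * F m x)"
      by (rule ip_cong) (simp_all add: f(2) l3 sum_distrib_left, simp_all add: mult.assoc[symmetric])
    moreover have "\<dots> = (\<Sum>m\<in>M. 1 * (- real_of_int m / 2) * ip (F m) (F m))" by (rule diag)
    ultimately show ?thesis by (simp only: sum.distrib[symmetric]) (simp add: algebra_simps)
  qed
  \<comment> \<open>All other weights are dropped as nonnegative; m = 1 and m = 3 contribute - 1/4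
    and 3/4.\<close>
  moreover have "(\<Sum>m\<in>M. (real_of_int m / 2) * (real_of_int m / 2 - 1) * ip (F m) (F m)) \<ge> (\<Sum>m\<in>{1,3}. (real_of_int m / 2) * (real_of_int m / 2 - 1) * ip (F m) (F m))"
  proof (rule sum_mono2)
    fix m assume "m \<in> M - {1, 3}"
    hence "m \<le> 0 \<or> 2 \<le> m" by auto
    hence "0 \<le> (real_of_int m / 2) * (real_of_int m / 2 - 1)"
      by (auto intro: mult_nonpos_nonpos mult_nonneg_nonneg)
    thus "0 \<le> (real_of_int m / 2) * (real_of_int m / 2 - 1) * ip (F m) (F m)" using ip_nonneg by (rule mult_nonneg_nonneg)
  qed (use M in auto)
  ultimately have A: "ip (lie 3 f) (lie 3 f) + ip f (\<lambda>x. \<i> * lie 3 f x) \<ge> - 1/4 * ip u u + 3/4 * ip v v"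
    by (simp add: u_def v_def)
  define M' where "M' = M - {1, 3}"
  define G where "G x = (\<Sum>m\<in>M'. lower (F m) x)" for x
  define P where "P x = lower u x + lower v x" for x
  have G: "smooth_near G" unfolding G_def[abs_def] by (intro smooth_intros sF)
  have P: "smooth_near P" unfolding P_def[abs_def] u_def v_def by (intro smooth_intros sF)
  have Df: "lower f x = G x + P x" if x: "x \<in> SU2" for x
  proof -
    have "lower f x = lower (\<lambda>x. \<Sum>m\<in>M. F m x) x"
      by (rule lower_cong[OF f(1) _ f(2) x]) (intro smooth_intros sF)
    also have "\<dots> = (\<Sum>m\<in>M. lower (F m) x)" by (rule lower_sum[OF sF x])
    also have "M = M' \<union> {1, 3}" using M by (auto simp: M'_def)
    also have "(\<Sum>m\<in>M' \<union> {1, 3}. lower (F m) x) = G x + (\<Sum>m\<in>{1, 3}. lower (F m) x)"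
      unfolding G_def by (rule sum.union_disjoint) (use M(1) in \<open>auto simp: M'_def\<close>)
    finally show ?thesis by (simp add: P_def u_def v_def)
  qed
  \<comment> \<open>After lowering, the components of \<open>G\<close> have weights m - 2 different
    from 1 and -1, which are those of \<open>P\<close> and of its conjugate.\<close>
  have GP: "integral_SU2 (\<lambda>x. Im (G x) * Im (P x)) = 0"
  proof -
    have z: "ip G h = 0" if h: "wt 1 h \<or> wt (- 1) h" for h
    proof -
      have "smooth_near h" using h wt_smooth by blast
      moreover have "ip (lower (F m)) h = 0" if "m \<in> M'" for m
        using h wt_orthogonal[OF wt_lower[OF F[of m]], of _ h] that by (auto simp: M'_def)
      ultimately show ?thesis unfolding G_def[abs_def] by (simp add: ip_sum smooth_near_lower sF)
    qed
    have lu: "wt (- 1) (lower u)" and lv: "wt 1 (lower v)"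
      using wt_lower[OF F[of 1]] wt_lower[OF F[of 3]] by (simp_all add: u_def v_def)
    have "ip G P = ip G (lower u) + ip G (lower v)"
      unfolding P_def[abs_def] by (rule ip_add(2)) (intro wt_smooth[OF lu] wt_smooth[OF lv] G)+
    hence 1: "ip G P = 0" using z lu lv by simp
    have "ip G (\<lambda>x. cnj (P x)) = ip G (\<lambda>x. cnj (lower u x)) + ip G (\<lambda>x. cnj (lower v x))"
      unfolding P_def[abs_def] complex_cnj_add
      by (rule ip_add(2)) (intro wt_smooth[OF wt_cnj[OF lu]] wt_smooth[OF wt_cnj[OF lv]] G)+
    hence "ip G (\<lambda>x. cnj (P x)) = 0" using z wt_cnj[OF lu] wt_cnj[OF lv] by simp
    with 1 show ?thesis by (simp add: integral_Im_Im[OF G P])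
  qed
  have B: "integral_SU2 (\<lambda>x. (Im (lower f x))\<^sup>2) \<ge> integral_SU2 (\<lambda>x. Im (P x) * Im (P x))"
  proof -
    have c: "continuous_on SU2 (\<lambda>x. Im (h x) * Im (k x))" if "smooth_near h" "smooth_near k" for h k
      by (intro continuous_intros smooth_near_continuous_on that)
    have "integral_SU2 (\<lambda>x. (Im (lower f x))\<^sup>2) = integral_SU2 (\<lambda>x. Im (G x) * Im (G x) + 2 * (Im (G x) * Im (P x)) + Im (P x) * Im (P x))"
      by (rule integral_SU2_cong) (simp add: Df power2_eq_square algebra_simps)
    also have "\<dots> = integral_SU2 (\<lambda>x. Im (G x) * Im (G x)) + 2 * integral_SU2 (\<lambda>x. Im (G x) * Im (P x)) + integral_SU2 (\<lambda>x. Im (P x) * Im (P x))"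
      by (simp only: integral_SU2_add integral_SU2_cmult c G P continuous_on_add continuous_on_mult_left)
    finally show ?thesis using GP integral_SU2_nonneg[of "\<lambda>x. Im (G x) * Im (G x)"] by simp
  qed
  define w where "w x = cnj (v x)" for x
  have w: "wt (- 3) w" unfolding w_def v_def by (rule wt_cnj[OF F])
  \<comment> \<open>With a = lower u and b = raise w, both of weight -1/2, P is a + cnj b and its
    imaginary part is Im (a - b). A function of nonzero weight is orthogonal to its conjugate, so
    its imaginary part carries half of its norm.\<close>
  have C: "integral_SU2 (\<lambda>x. Im (P x) * Im (P x)) = 1/2 * ip (\<lambda>x. lower u x - raise w x) (\<lambda>x. lower u x - raise w x)"
  proof -
    define a b where "a = lower u" and "b = (\<lambda>x. cnj (lower v x))"
    have a: "wt (- 1) a" and b: "wt (- 1) b"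
      using wt_lower[OF F[of 1]] wt_cnj[OF wt_lower[OF F[of 3]]] by (simp_all add: a_def b_def u_def v_def)
    note s = wt_smooth[OF a] wt_smooth[OF b] smooth_near_cnj[OF wt_smooth[OF a]] smooth_near_cnj[OF wt_smooth[OF b]]
    have z: "ip a (\<lambda>x. cnj (a x)) = 0" "ip b (\<lambda>x. cnj (b x)) = 0" "ip a (\<lambda>x. cnj (b x)) = 0" "ip b (\<lambda>x. cnj (a x)) = 0"
      using wt_orthogonal[OF a wt_cnj[OF a]] wt_orthogonal[OF b wt_cnj[OF b]] wt_orthogonal[OF a wt_cnj[OF b]] wt_orthogonal[OF b wt_cnj[OF a]] by auto
    have Pa: "P = (\<lambda>x. a x + cnj (b x))" by (simp add: P_def[abs_def] a_def b_def)
    have "integral_SU2 (\<lambda>x. Im (P x) * Im (P x)) = 1/2 * (ip P P - ip P (\<lambda>x. cnj (P x)))" by (rule integral_Im_Im[OF P P])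
    also have "ip P P = ip a a + ip b b" unfolding Pa
      by (simp add: ip_add s smooth_near_add ip_cnj z)
    also have "ip P (\<lambda>x. cnj (P x)) = 2 * ip a b" unfolding Pa
      by (simp add: ip_add s smooth_near_add ip_cnj z ip_commute[of b a])
    also have "1/2 * (ip a a + ip b b - 2 * ip a b) = 1/2 * ip (\<lambda>x. a x - b x) (\<lambda>x. a x - b x)"
      by (simp add: ip_diff s smooth_near_diff ip_commute[of b a])
    also have "ip (\<lambda>x. a x - b x) (\<lambda>x. a x - b x) = ip (\<lambda>x. lower u x - raise w x) (\<lambda>x. lower u x - raise w x)"
      by (rule ip_cong) (simp_all add: a_def b_def w_def[abs_def] raise_cnj v_def sF)
    finally show ?thesis .
  qed
  have "(1 + \<alpha>) * (- 1/4 * ip u u + 3/4 * ip w w) + \<alpha> / 2 * ip (\<lambda>x. lower u x - raise w x) (\<lambda>x. lower u x - raise w x) \<ge> 0"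
  proof -
    have e: "lower u x = lower (raise \<psi>) x" if x: "x \<in> SU2" for x
      by (rule lower_cong[OF _ _ _ x]) (use sF \<psi> wt_smooth[OF \<psi>(1)] in \<open>auto simp: u_def intro: smooth_intros\<close>)
    have "ip u u = ip (raise \<psi>) (raise \<psi>)" by (rule ip_cong) (simp_all add: u_def \<psi>)
    moreover have "ip (\<lambda>x. lower u x - raise w x) (\<lambda>x. lower u x - raise w x) = ip (\<lambda>x. lower (raise \<psi>) x - raise w x) (\<lambda>x. lower (raise \<psi>) x - raise w x)"
      by (rule ip_cong) (simp_all add: e)
    ultimately show ?thesis using dangerous_weights_nonneg[OF \<psi>(1) w \<alpha>] by simp
  qed
  moreover have "ip w w = ip v v" unfolding w_def[abs_def] by (rule ip_cnj)
  moreover have "(1 + \<alpha>) * (ip (lie 3 f) (lie 3 f) + ip f (\<lambda>x. \<i> * lie 3 f x)) \<ge> (1 + \<alpha>) * (- 1/4 * ip u u + 3/4 * ip v v)"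
    using A \<alpha> by (intro mult_left_mono) auto
  moreover have "\<alpha> * integral_SU2 (\<lambda>x. (Im (lower f x))\<^sup>2) \<ge> \<alpha> * (1/2 * ip (\<lambda>x. lower u x - raise w x) (\<lambda>x. lower u x - raise w x))"
    using B C \<alpha> by (intro mult_left_mono) auto
  ultimately show ?thesis unfolding hessq_ip[OF f(1)] using ip_nonneg[of "raise f"] by simp
qed


section \<open>Polynomials and the stability\<close>

lemma smooth_near_power: "smooth_near f \<Longrightarrow> smooth_near (\<lambda>x. f x ^ n)" for f :: "cmat2 \<Rightarrow> complex"
  by (induction n) (auto intro: smooth_near_mult)

lemma smooth_near_entry: "smooth_near (\<lambda>x. x $ i $ j)"
  by (rule smooth_near_linear[OF bounded_linear_nth2])

lemma raise_mult: "smooth_near f \<Longrightarrow> smooth_near g \<Longrightarrow> x \<in> SU2 \<Longrightarrow> raise (\<lambda>x. f x * g x) x = f x * raise g x + raise f x * g x"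
  by (simp add: raise_def lie_mult algebra_simps)

lemma lower_entry: "lower (\<lambda>x. x $ i $ 1) x = \<i> * x $ i $ 2" "lower (\<lambda>x. x $ i $ 2) x = 0"
  and raise_entry: "raise (\<lambda>x. x $ i $ 1) x = 0" "raise (\<lambda>x. x $ i $ 2) x = \<i> * x $ i $ 1"
  by (simp_all add: lower_def raise_def lie_entries)

lemma lower_power: "x \<in> SU2 \<Longrightarrow> lower (\<lambda>x. x $ i $ 1 ^ n) x = of_nat n * (\<i> * x $ i $ 2) * x $ i $ 1 ^ (n - 1)"
proof (induction n)
  case (Suc n)
  have "lower (\<lambda>x. x $ i $ 1 ^ Suc n) x = x $ i $ 1 * lower (\<lambda>x. x $ i $ 1 ^ n) x + \<i> * x $ i $ 2 * x $ i $ 1 ^ n"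
    using lower_mult[OF smooth_near_entry smooth_near_power[OF smooth_near_entry] Suc.prems, of i 1 i 1 n] by (simp add: lower_entry)
  thus ?case using Suc by (cases n) (simp_all add: algebra_simps)
qed (simp add: lower_def)

lemma raise_power: "x \<in> SU2 \<Longrightarrow> raise (\<lambda>x. x $ i $ 1 ^ n) x = 0"
proof (induction n)
  case (Suc n)
  thus ?case
    using raise_mult[OF smooth_near_entry smooth_near_power[OF smooth_near_entry] Suc.prems, of i 1 i 1 n] by (simp add: raise_entry)
qed (simp add: raise_def)

section \<open>Highest weight vectors and the functions obtained by lowering them\<close>

text \<open>Highest weight vectors of spin \<open>(a + b) / 2\<close>.\<close>
definition hw :: "nat \<Rightarrow> nat \<Rightarrow> cmat2 \<Rightarrow> complex" where
  "hw a b x = x $ 1 $ 1 ^ a * x $ 2 $ 1 ^ b"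

lemma smooth_near_hw: "smooth_near (hw a b)"
  unfolding hw_def[abs_def] by (intro smooth_near_mult smooth_near_power smooth_near_entry)

lemma lower_hw: "x \<in> SU2 \<Longrightarrow> lower (hw a b) x = x $ 1 $ 1 ^ a * (of_nat b * (\<i> * x $ 2 $ 2) * x $ 2 $ 1 ^ (b - 1))
    + of_nat a * (\<i> * x $ 1 $ 2) * x $ 1 $ 1 ^ (a - 1) * x $ 2 $ 1 ^ b"
  unfolding hw_def[abs_def]
  by (simp only: lower_mult[OF smooth_near_power[OF smooth_near_entry] smooth_near_power[OF smooth_near_entry]] lower_power)

lemma raise_hw: "x \<in> SU2 \<Longrightarrow> raise (hw a b) x = 0"
  unfolding hw_def[abs_def]
  by (simp add: raise_mult[OF smooth_near_power[OF smooth_near_entry] smooth_near_power[OF smooth_near_entry]] raise_power)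

lemma wt_entry: "wt 1 (\<lambda>x. x $ i $ 1)" "wt (- 1) (\<lambda>x. x $ i $ 2)"
  by (simp_all add: wt_def smooth_near_entry lie_entries)

lemma wt_power: "wt (int n) (\<lambda>x. x $ i $ 1 ^ n)"
proof (induction n)
  case (Suc n)
  thus ?case using wt_mult[OF wt_entry(1) Suc, of i] by (simp add: add.commute)
qed (simp add: wt_def)

lemma wt_hw: "wt (int a + int b) (hw a b)"
  unfolding hw_def[abs_def] by (intro wt_mult wt_power)

lemma wt_lower_hw: "wt (int a + int b - 2 * int k) ((lower ^^ k) (hw a b))"
proof (induction k)
  case (Suc k)
  thus ?case using wt_lower[OF Suc] by (simp add: algebra_simps)
qed (simp add: wt_hw)

text \<open>The span of the generators of one fixed weight. The rule \<open>cong\<close> is there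
  because reductions by det = 1 hold on SU(2) only.\<close>

inductive weight_poly :: "int \<Rightarrow> (cmat2 \<Rightarrow> complex) \<Rightarrow> bool" where
  zero: "weight_poly m (\<lambda>x. 0)"
| gen: "weight_poly (int a + int b - 2 * int k) ((lower ^^ k) (hw a b))"
| add: "weight_poly m f \<Longrightarrow> weight_poly m g \<Longrightarrow> weight_poly m (\<lambda>x. f x + g x)"
| cmult: "weight_poly m f \<Longrightarrow> weight_poly m (\<lambda>x. c * f x)"
| cong: "weight_poly m f \<Longrightarrow> smooth_near g \<Longrightarrow> (\<And>x. x \<in> SU2 \<Longrightarrow> f x = g x) \<Longrightarrow> weight_poly m g"

lemma weight_poly_wt: "weight_poly m f \<Longrightarrow> wt m f"
  by (induction rule: weight_poly.induct) (auto intro: wt_zero wt_lower_hw wt_add wt_cmult wt_cong)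

lemma weight_poly_smooth: "weight_poly m f \<Longrightarrow> smooth_near f" using weight_poly_wt wt_smooth by blast

lemma weight_poly_lower: "weight_poly m f \<Longrightarrow> weight_poly (m - 2) (lower f)"
proof (induction rule: weight_poly.induct)
  case (zero m)
  have "lower (\<lambda>x. 0) = (\<lambda>x. 0)" by (simp add: lower_def fun_eq_iff)
  thus ?case by (simp add: weight_poly.zero)
next
  case (gen a b k)
  show ?case using weight_poly.gen[of a b "Suc k"] by (simp add: algebra_simps)
next
  case (add m f g)
  show ?case
    by (rule weight_poly.cong[OF weight_poly.add[OF add.IH]])
       (use add.hyps[THEN weight_poly_smooth] in \<open>auto intro: smooth_intros simp: lower_add\<close>)
next
  case (cmult m f c)
  show ?case
    by (rule weight_poly.cong[OF weight_poly.cmult[OF cmult.IH, of c]])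
       (use cmult.hyps[THEN weight_poly_smooth] in \<open>auto intro: smooth_intros simp: lower_cmult\<close>)
next
  case (cong m f g)
  show ?case
    by (rule weight_poly.cong[OF cong.IH]) (use cong weight_poly_smooth[OF cong.hyps(1)] lower_cong[of f g] in \<open>auto intro: smooth_intros\<close>)
qed

lemma SU2_det: "x \<in> SU2 \<Longrightarrow> x $ 1 $ 1 * x $ 2 $ 2 = 1 + x $ 2 $ 1 * x $ 1 $ 2"
  by (simp add: SU2_def det_2 algebra_simps)

text \<open>Lowering x_i1 times \<open>hw a b\<close> produces x_i2 times \<open>hw a b\<close> and
  one further term; the relation det = 1 rewrites the latter as a multiple of the same product plus
  a highest weight vector of degree a + b - 1. Solving for the product divides by N = i (a + b +
  1).\<close>

lemma weight_poly_column2_hw: "weight_poly (int a + int b - 1) (\<lambda>x. x $ i $ 2 * hw a b x)"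
proof -
  have s: "smooth_near (\<lambda>x. x $ i $ 2 * hw a b x)" by (intro smooth_intros smooth_near_entry smooth_near_hw)
  define N :: complex where "N = \<i> * of_nat (a + b + 1)"
  have N0: "N \<noteq> 0" unfolding N_def by (simp del: of_nat_add of_nat_Suc of_nat_1)
  have i: "i = 1 \<or> i = 2" using exhaust_2 by blast
  define a' b' where "a' = (if i = 1 then Suc a else a)" and "b' = (if i = 1 then b else Suc b)"
  \<comment> \<open>Minus the part of lower degree left by det = 1; the cases b = 0 and a = 0 keep
    the truncated exponents b - 1 and a - 1 out.\<close>
  define r where "r = (if i = 1 then (if b = 0 then (\<lambda>x. 0) else (\<lambda>x. (- \<i> * of_nat b) * hw a (b - 1) x))
      else (if a = 0 then (\<lambda>x. 0) else (\<lambda>x. (\<i> * of_nat a) * hw (a - 1) b x)))"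
  have g: "weight_poly (int a + int b - 1) (lower (hw a' b'))"
    using weight_poly.gen[of a' b' 1] by (simp add: a'_def b'_def split: if_splits)
  have r: "weight_poly (int a + int b - 1) r"
  proof -
    have "weight_poly (int a + int b - 1) (hw a (b - 1))" if "b \<noteq> 0" using that weight_poly.gen[of a "b - 1" 0] by (simp add: of_nat_diff algebra_simps)
    moreover have "weight_poly (int a + int b - 1) (hw (a - 1) b)" if "a \<noteq> 0" using that weight_poly.gen[of "a - 1" b 0] by (simp add: of_nat_diff algebra_simps)
    ultimately show ?thesis unfolding r_def
      by (simp only: split: if_split) (intro conjI impI weight_poly.zero weight_poly.cmult; blast)
  qed
  have "inverse N * (lower (hw a' b') x + r x) = x $ i $ 2 * hw a b x" if x: "x \<in> SU2" for x
  proof -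
    note d = SU2_det[OF x]
    have "lower (hw a' b') x + r x = N * (x $ i $ 2 * hw a b x)"
    proof (cases "i = 1")
      case True
      show ?thesis
      proof (cases b)
        case 0
        thus ?thesis using True by (simp add: lower_hw x a'_def b'_def r_def N_def hw_def algebra_simps)
      next
        case (Suc c)
        have "lower (hw a' b') x = \<i> * of_nat (Suc c) * (x $ 1 $ 1 * x $ 2 $ 2) * (x $ 1 $ 1 ^ a * x $ 2 $ 1 ^ c) + \<i> * of_nat (Suc a) * x $ 1 $ 2 * (x $ 1 $ 1 ^ a * x $ 2 $ 1 ^ Suc c)"
          using True Suc by (simp add: lower_hw x a'_def b'_def algebra_simps)
        thus ?thesis using True Suc unfolding d by (simp add: r_def N_def hw_def algebra_simps)
      qed
    next
      case False
      hence i2: "i = 2" using i by simp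
      show ?thesis
      proof (cases a)
        case 0
        thus ?thesis using i2 by (simp add: lower_hw x a'_def b'_def r_def N_def hw_def algebra_simps)
      next
        case (Suc c)
        have "lower (hw a' b') x = \<i> * of_nat (Suc b) * (x $ 1 $ 1 * x $ 2 $ 2) * (x $ 1 $ 1 ^ c * x $ 2 $ 1 ^ b) + \<i> * of_nat (Suc c) * (x $ 2 $ 1 * x $ 1 $ 2) * (x $ 1 $ 1 ^ c * x $ 2 $ 1 ^ b)"
          using i2 Suc by (simp add: lower_hw x a'_def b'_def algebra_simps)
        moreover have "x $ i $ 2 * hw a b x = (x $ 1 $ 1 * x $ 2 $ 2) * (x $ 1 $ 1 ^ c * x $ 2 $ 1 ^ b)"
          using i2 Suc by (simp add: hw_def algebra_simps)
        moreover have "r x = \<i> * of_nat (Suc c) * (x $ 1 $ 1 ^ c * x $ 2 $ 1 ^ b)" using i2 Suc by (simp add: r_def hw_def)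
        ultimately show ?thesis by (simp only: d) (simp add: N_def Suc algebra_simps)
      qed
    qed
    thus ?thesis using N0 by simp
  qed
  from weight_poly.cong[OF weight_poly.cmult[OF weight_poly.add[OF g r], of "inverse N"] s this] show ?thesis .
qed

lemma weight_poly_mult_induct:
  assumes e: "smooth_near e"
    and g: "\<And>a b k. weight_poly (int a + int b - 2 * int k + d) (\<lambda>x. e x * (lower ^^ k) (hw a b) x)"
  shows "weight_poly m f \<Longrightarrow> weight_poly (m + d) (\<lambda>x. e x * f x)"
proof (induction rule: weight_poly.induct)
  case (zero m)
  show ?case using weight_poly.zero by simp
next
  case (gen a b k)
  show ?case by (rule g)
next
  case (add m f g)
  show ?case using weight_poly.add[OF add.IH] by (simp add: distrib_left)
next
  case (cmult m f c)
  show ?case using weight_poly.cmult[OF cmult.IH, of c] by (simp add: mult.left_commute)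
next
  case (cong m f g)
  show ?case by (rule weight_poly.cong[OF cong.IH smooth_near_mult[OF e cong.hyps(2)]]) (simp add: cong.hyps(3))
qed

text \<open>\<open>lower\<close> annihilates x_i2, so multiplication by x_i2 commutes with it and
  the case k = 0 propagates to all k.\<close>

lemma weight_poly_column2: "weight_poly m f \<Longrightarrow> weight_poly (m - 1) (\<lambda>x. x $ i $ 2 * f x)"
proof -
  have "weight_poly (int a + int b - 2 * int k + - 1) (\<lambda>x. x $ i $ 2 * (lower ^^ k) (hw a b) x)" for a b k
  proof (induction k)
    case 0
    show ?case using weight_poly_column2_hw by simp
  next
    case (Suc k)
    note s = wt_smooth[OF wt_lower_hw]
    have "weight_poly (int a + int b - 2 * int k + - 1 - 2) (\<lambda>x. x $ i $ 2 * (lower ^^ Suc k) (hw a b) x)"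
      by (rule weight_poly.cong[OF weight_poly_lower[OF Suc]])
         (use wt_smooth[OF wt_lower_hw[of a b "Suc k"]] in \<open>auto intro!: smooth_near_mult smooth_near_entry smooth_intros s
            simp: lower_mult[OF smooth_near_entry s] lower_entry\<close>)
    thus ?case by (simp add: algebra_simps)
  qed
  from weight_poly_mult_induct[OF smooth_near_entry this] show "weight_poly m f \<Longrightarrow> weight_poly (m - 1) (\<lambda>x. x $ i $ 2 * f x)" by simp
qed

text \<open>Here \<open>lower\<close> maps x_i1 to i x_i2. The Leibniz rule is solved for x_i1 times
  the next lowered function, the extra term being covered by
  \<open>weight_poly_column2\<close>.\<close>

lemma weight_poly_column1: "weight_poly m f \<Longrightarrow> weight_poly (m + 1) (\<lambda>x. x $ i $ 1 * f x)"
proof -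
  have "weight_poly (int a + int b - 2 * int k + 1) (\<lambda>x. x $ i $ 1 * (lower ^^ k) (hw a b) x)" for a b k
  proof (induction k)
    case 0
    have i: "i = 1 \<or> i = 2" using exhaust_2 by blast
    have "(\<lambda>x. x $ i $ 1 * hw a b x) = (if i = 1 then hw (Suc a) b else hw a (Suc b))"
      using i by (auto simp: hw_def fun_eq_iff)
    thus ?case using weight_poly.gen[of "Suc a" b 0] weight_poly.gen[of a "Suc b" 0] by (simp add: algebra_simps split: if_splits)
  next
    case (Suc k)
    note s = wt_smooth[OF wt_lower_hw]
    have 1: "weight_poly (int a + int b - 2 * int k + 1 - 2) (lower (\<lambda>x. x $ i $ 1 * (lower ^^ k) (hw a b) x))"
      by (rule weight_poly_lower[OF Suc])
    have "weight_poly (int a + int b - 2 * int k - 1) (\<lambda>x. x $ i $ 2 * (lower ^^ k) (hw a b) x)"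
      by (rule weight_poly_column2[OF weight_poly.gen])
    moreover have "int a + int b - 2 * int k + 1 - 2 = int a + int b - 2 * int k - 1" by simp
    ultimately have 2: "weight_poly (int a + int b - 2 * int k + 1 - 2) (\<lambda>x. - \<i> * (x $ i $ 2 * (lower ^^ k) (hw a b) x))"
      by (simp only: weight_poly.cmult)
    have "weight_poly (int a + int b - 2 * int k + 1 - 2) (\<lambda>x. x $ i $ 1 * (lower ^^ Suc k) (hw a b) x)"
      by (rule weight_poly.cong[OF weight_poly.add[OF 1 2]])
         (use wt_smooth[OF wt_lower_hw[of a b "Suc k"]] in \<open>auto intro!: smooth_near_mult smooth_near_entry smooth_intros s
            simp: lower_mult[OF smooth_near_entry s] lower_entry\<close>)
    thus ?case by (simp add: algebra_simps)
  qed
  from weight_poly_mult_induct[OF smooth_near_entry this] show "weight_poly m f \<Longrightarrow> weight_poly (m + 1) (\<lambda>x. x $ i $ 1 * f x)" by simp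
qed

text \<open>The ladder computation for sl(2): the commutator adds the weight of each step to the
  coefficient, starting from \<open>raise (hw a b) = 0\<close>.\<close>

lemma raise_lower_hw:
  assumes x: "x \<in> SU2"
  shows "raise ((lower ^^ Suc k) (hw a b)) x = - (of_nat (Suc k) * (of_int (int a + int b - int k))) * (lower ^^ k) (hw a b) x"
  using x
proof (induction k arbitrary: x)
  case 0
  have z: "lower (raise (hw a b)) x = 0"
    using lower_cong[OF smooth_near_raise[OF smooth_near_hw] smooth_near_const raise_hw 0] by (simp add: lower_def)
  have "raise (lower (hw a b)) x = 2 * \<i> * lie 3 (hw a b) x"
    using raise_lower_commutator(1)[OF smooth_near_hw 0, of a b] by (simp add: z)
  thus ?case unfolding wt_lie[OF wt_hw 0] by (simp add: mult.assoc[symmetric])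
next
  case (Suc k)
  define g where "g = (lower ^^ k) (hw a b)"
  define h where "h = (lower ^^ Suc k) (hw a b)"
  define c :: complex where "c = - (of_nat (Suc k) * (of_int (int a + int b - int k)))"
  have hg: "h = lower g" by (simp add: h_def g_def)
  have sg: "smooth_near g" and sh: "smooth_near h" unfolding g_def h_def by (rule wt_smooth[OF wt_lower_hw])+
  have "lower (raise h) x = lower (\<lambda>x. c * g x) x"
    by (rule lower_cong[OF smooth_near_raise[OF sh] smooth_near_cmult[OF sg] _ Suc.prems])
       (unfold h_def g_def c_def, rule Suc.IH)
  also have "\<dots> = c * h x" unfolding hg by (rule lower_cmult[OF sg Suc.prems])
  finally have "raise (lower h) x = c * h x + 2 * \<i> * lie 3 h x"
    using raise_lower_commutator(1)[OF sh Suc.prems] by (simp add: algebra_simps)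
  also have "lie 3 h x = \<i> * (of_int (int a + int b - 2 * int (Suc k)) / 2) * h x"
    unfolding h_def by (rule wt_lie[OF wt_lower_hw Suc.prems])
  also have "c * h x + 2 * \<i> * (\<i> * (of_int (int a + int b - 2 * int (Suc k)) / 2) * h x)
     = - (of_nat (Suc (Suc k)) * (of_int (int a + int b - int (Suc k)))) * h x"
    unfolding c_def by (simp add: field_simps)
  finally show ?case by (simp add: h_def)
qed

text \<open>In weight 1/2 the coefficient of \<open>raise_lower_hw\<close> is \<open>- (k + 1)\<^sup>2\<close>, hence \<open>raise\<close> is onto.\<close>
lemma weight_poly_raise_surj: "weight_poly m f \<Longrightarrow> m = 1 \<Longrightarrow> \<exists>\<psi>. wt (- 1) \<psi> \<and> (\<forall>x\<in>SU2. f x = raise \<psi> x)"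
proof (induction rule: weight_poly.induct)
  case (zero m)
  show ?case by (rule exI[of _ "\<lambda>x. 0"]) (simp add: wt_zero raise_def)
next
  case (gen a b k)
  define c :: complex where "c = - inverse (of_nat (Suc k) * of_nat (Suc k))"
  define h where "h = (lower ^^ Suc k) (hw a b)"
  \<comment> \<open>Weight 1/2 means a + b - 2 k = 1.\<close>
  have ab: "int a + int b - int k = int (Suc k)" using gen by simp
  have h: "wt (- 1) h" using wt_lower_hw[of a b "Suc k"] gen unfolding h_def by (simp add: algebra_simps)
  have "(lower ^^ k) (hw a b) x = raise (\<lambda>x. c * h x) x" if x: "x \<in> SU2" for x
  proof -
    have "raise (\<lambda>x. c * h x) x = c * raise h x" by (rule raise_cmult[OF wt_smooth[OF h] x])
    also have "raise h x = - (of_nat (Suc k) * of_nat (Suc k)) * (lower ^^ k) (hw a b) x"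
      unfolding h_def raise_lower_hw[OF x] ab by simp
    finally have "raise (\<lambda>x. c * h x) x = (c * - (of_nat (Suc k) * of_nat (Suc k))) * (lower ^^ k) (hw a b) x"
      by (simp only: mult.assoc)
    moreover have "c * - (of_nat (Suc k) * of_nat (Suc k)) = 1"
    proof -
      have "(of_nat (Suc k) * of_nat (Suc k) :: complex) \<noteq> 0" by (simp del: of_nat_Suc)
      moreover have "- inverse z * - z = 1" if "z \<noteq> 0" for z :: complex using that by simp
      ultimately show ?thesis unfolding c_def by blast
    qed
    ultimately show ?thesis by (simp only: mult_1_left)
  qed
  thus ?case using wt_cmult[OF h] by blast
next
  case (add m f g)
  then obtain p q where "wt (- 1) p" "\<forall>x\<in>SU2. f x = raise p x" "wt (- 1) q" "\<forall>x\<in>SU2. g x = raise q x" by blast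
  thus ?case by (intro exI[of _ "\<lambda>x. p x + q x"]) (auto simp: raise_add wt_smooth intro: wt_add)
next
  case (cmult m f c)
  then obtain p where "wt (- 1) p" "\<forall>x\<in>SU2. f x = raise p x" by blast
  thus ?case by (intro exI[of _ "\<lambda>x. c * p x"]) (auto simp: raise_cmult wt_smooth intro: wt_cmult)
next
  case (cong m f g)
  thus ?case by auto
qed

section \<open>Decomposition of polynomials by weight\<close>

inductive poly_fun :: "(cmat2 \<Rightarrow> complex) \<Rightarrow> bool" where
  base: "weight_poly m f \<Longrightarrow> poly_fun f"
| sum: "poly_fun f \<Longrightarrow> poly_fun g \<Longrightarrow> poly_fun (\<lambda>x. f x + g x)"

lemma poly_fun_smooth: "poly_fun f \<Longrightarrow> smooth_near f"
  by (induction rule: poly_fun.induct) (auto intro: weight_poly_smooth smooth_near_add)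

lemma poly_fun_cmult: "poly_fun f \<Longrightarrow> poly_fun (\<lambda>x. c * f x)"
  by (induction rule: poly_fun.induct) (auto simp: distrib_left intro: poly_fun.intros weight_poly.cmult)

lemma poly_fun_column: "poly_fun f \<Longrightarrow> poly_fun (\<lambda>x. x $ i $ 1 * f x)" "poly_fun f \<Longrightarrow> poly_fun (\<lambda>x. x $ i $ 2 * f x)"
  by (induction rule: poly_fun.induct) (auto simp: distrib_left intro: poly_fun.intros weight_poly_column1 weight_poly_column2)

text \<open>\<open>F\<close> is defined for all m and zero outside \<open>M\<close>, so that two
  decompositions add over the union and the weights 1 and 3 may be adjoined to
  \<open>M\<close>.\<close>

lemma poly_fun_decomposition:
  "poly_fun f \<Longrightarrow> \<exists>M F. finite M \<and> (\<forall>m. weight_poly m (F m)) \<and> (\<forall>m. m \<notin> M \<longrightarrow> F m = (\<lambda>x. 0)) \<and> f = (\<lambda>x. \<Sum>m\<in>M. F m x)"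
proof (induction rule: poly_fun.induct)
  case (base m f)
  thus ?case by (intro exI[of _ "{m}"] exI[of _ "\<lambda>n. if n = m then f else (\<lambda>x. 0)"]) (auto intro: weight_poly.zero)
next
  case (sum f g)
  then obtain M F N G where F: "finite M" "\<forall>m. weight_poly m (F m)" "\<forall>m. m \<notin> M \<longrightarrow> F m = (\<lambda>x. 0)" "f = (\<lambda>x. \<Sum>m\<in>M. F m x)"
    and G: "finite N" "\<forall>m. weight_poly m (G m)" "\<forall>m. m \<notin> N \<longrightarrow> G m = (\<lambda>x. 0)" "g = (\<lambda>x. \<Sum>m\<in>N. G m x)" by blast
  have "f x = (\<Sum>m\<in>M \<union> N. F m x)" "g x = (\<Sum>m\<in>M \<union> N. G m x)" for x
    unfolding F(4) G(4) using F(1,3) G(1,3) by (auto intro!: sum.mono_neutral_left)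
  thus ?case using F G
    by (intro exI[of _ "M \<union> N"] exI[of _ "\<lambda>m x. F m x + G m x"]) (auto simp: sum.distrib intro: weight_poly.add)
qed

lemma hessq_poly_fun_nonneg:
  assumes "poly_fun f" "\<alpha> \<ge> 1" shows "hessq \<alpha> f \<ge> 0"
proof -
  obtain M F where F: "finite M" "\<And>m. weight_poly m (F m)" "\<And>m. m \<notin> M \<Longrightarrow> F m = (\<lambda>x. 0)" "f = (\<lambda>x. \<Sum>m\<in>M. F m x)"
    using poly_fun_decomposition[OF assms(1)] by blast
  obtain \<psi> where \<psi>: "wt (- 1) \<psi>" "\<And>x. x \<in> SU2 \<Longrightarrow> F 1 x = raise \<psi> x"
    using weight_poly_raise_surj[OF F(2) refl] by blast
  have "f x = (\<Sum>m\<in>M \<union> {1, 3}. F m x)" for x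
    unfolding F(4) using F(1,3) by (auto intro!: sum.mono_neutral_left)
  thus ?thesis
    by (intro hessq_weights_nonneg[of "M \<union> {1, 3}" F \<psi>] weight_poly_wt F(2) \<psi> poly_fun_smooth assms) (use F(1) in auto)
qed

section \<open>Polynomials of bounded degree\<close>

text \<open>The letter 1 makes the words of length \<open>N\<close> run through all monomials of degree at most \<open>N\<close>.\<close>
definition letters :: "(cmat2 \<Rightarrow> complex) list" where
  "letters = [\<lambda>x. 1, \<lambda>x. x $ 1 $ 1, \<lambda>x. x $ 2 $ 1, \<lambda>x. x $ 1 $ 2, \<lambda>x. x $ 2 $ 2]"

fun word :: "(cmat2 \<Rightarrow> complex) list \<Rightarrow> cmat2 \<Rightarrow> complex" where
  "word [] x = 1"
| "word (e # w) x = e x * word w x"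

text \<open>In contrast to \<open>poly_fun\<close>, each of these spaces has a finite spanning set,
  so an orthogonal projection onto it exists.\<close>

inductive poly_deg_le :: "nat \<Rightarrow> (cmat2 \<Rightarrow> complex) \<Rightarrow> bool" where
  zero: "poly_deg_le N (\<lambda>x. 0)"
| word: "set w \<subseteq> set letters \<Longrightarrow> length w = N \<Longrightarrow> poly_deg_le N (word w)"
| add: "poly_deg_le N f \<Longrightarrow> poly_deg_le N g \<Longrightarrow> poly_deg_le N (\<lambda>x. f x + g x)"
| cmult: "poly_deg_le N f \<Longrightarrow> poly_deg_le N (\<lambda>x. c * f x)"

lemma poly_fun_word: "set w \<subseteq> set letters \<Longrightarrow> poly_fun (word w)"
proof (induction w)
  case Nil
  have "(lower ^^ 0) (hw 0 0) = word []" by (simp add: fun_eq_iff hw_def)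
  moreover have "poly_fun ((lower ^^ 0) (hw 0 0))" by (rule poly_fun.base[OF weight_poly.gen])
  ultimately show ?case by (simp only:)
next
  case (Cons e w)
  hence "poly_fun (word w)" "e \<in> set letters" by auto
  moreover have "word (e # w) = (\<lambda>x. e x * word w x)" by (simp add: fun_eq_iff)
  ultimately show ?case using poly_fun_column[of "word w"] unfolding letters_def by auto
qed

lemma poly_deg_le_imp_poly_fun: "poly_deg_le N f \<Longrightarrow> poly_fun f"
  by (induction rule: poly_deg_le.induct) (auto intro: poly_fun_word poly_fun.sum poly_fun_cmult poly_fun.base[OF weight_poly.zero])

lemma poly_deg_le_smooth: "poly_deg_le N f \<Longrightarrow> smooth_near f" using poly_deg_le_imp_poly_fun poly_fun_smooth by blast

lemma word_append: "word (v @ w) x = word v x * word w x"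
  by (induction v) auto

lemma poly_deg_le_mult_word: "poly_deg_le M g \<Longrightarrow> set v \<subseteq> set letters \<Longrightarrow> poly_deg_le (length v + M) (\<lambda>x. word v x * g x)"
proof (induction rule: poly_deg_le.induct)
  case (word w N)
  have "(\<lambda>x. word v x * word w x) = word (v @ w)" by (simp add: fun_eq_iff word_append)
  thus ?case using word poly_deg_le.word[of "v @ w"] by simp
next
  case (add N f g)
  thus ?case using poly_deg_le.add[of "length v + N" "\<lambda>x. word v x * f x" "\<lambda>x. word v x * g x"] by (simp add: distrib_left)
next
  case (cmult N f c)
  thus ?case using poly_deg_le.cmult[of "length v + N" "\<lambda>x. word v x * f x" c] by (simp add: mult.left_commute)
qed (simp add: poly_deg_le.zero)

lemma poly_deg_le_mult: "poly_deg_le N f \<Longrightarrow> poly_deg_le M g \<Longrightarrow> poly_deg_le (N + M) (\<lambda>x. f x * g x)"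
proof (induction rule: poly_deg_le.induct)
  case (word w N)
  thus ?case using poly_deg_le_mult_word by blast
next
  case (add N f f')
  thus ?case using poly_deg_le.add[of "N + M" "\<lambda>x. f x * g x" "\<lambda>x. f' x * g x"] by (simp add: distrib_right)
next
  case (cmult N f c)
  thus ?case using poly_deg_le.cmult[of "N + M" "\<lambda>x. f x * g x" c] by (simp add: mult.assoc)
qed (simp add: poly_deg_le.zero)

lemma poly_deg_le_letter: assumes "e \<in> set letters" shows "poly_deg_le 1 e"
proof -
  have "word [e] = e" by (simp add: fun_eq_iff)
  moreover have "poly_deg_le 1 (word [e])" by (rule poly_deg_le.word) (use assms in auto)
  ultimately show ?thesis by (simp only:)
qed

lemma poly_deg_le_mono: "poly_deg_le N f \<Longrightarrow> N \<le> M \<Longrightarrow> poly_deg_le M f"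
proof (induction M)
  case (Suc M)
  show ?case
  proof (cases "N = Suc M")
    case False
    hence "poly_deg_le M f" using Suc by simp
    moreover have "poly_deg_le 1 (\<lambda>x. 1)" by (rule poly_deg_le_letter) (simp add: letters_def)
    ultimately show ?thesis using poly_deg_le_mult[of 1 "\<lambda>x. 1" M f] by simp
  qed (use Suc in simp)
qed auto

text \<open>The fields act on each row of the matrix by right multiplication with
  \<open>theta i\<close>, which has one nonzero entry per row and column. Hence the degree is not
  raised by differentiation.\<close>

lemma lie_letter:
  assumes "e \<in> set letters" shows "\<exists>c. \<exists>e'\<in>set letters. \<forall>x. lie i e x = c * e' x"
proof -
  have 2: "lie i (\<lambda>x. x $ j $ k) x = (if i = 1 then \<i> / 2 * x $ j $ (if k = 1 then 2 else 1)
     else if i = 2 then (if k = 1 then - 1/2 else 1/2) * x $ j $ (if k = 1 then 2 else 1)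
     else (if k = 1 then \<i> / 2 else - \<i> / 2) * x $ j $ k)" for j k x
    using exhaust_3[of i] exhaust_2[of k] by (auto simp: lie_entries)
  have 3: "(\<lambda>x. x $ j $ k) \<in> set letters" for j k
    using exhaust_2[of j] exhaust_2[of k] by (auto simp: letters_def)
  have 4: "\<exists>c. \<exists>e'\<in>set letters. \<forall>x. lie i (\<lambda>x. x $ j $ k) x = c * e' x" for j k
  proof -
    define d where "d = (if i = 1 then \<i> / 2 else if i = 2 then (if k = 1 then - 1/2 else 1/2) else (if k = 1 then \<i> / 2 else - \<i> / 2))"
    define l where "l = (if i = 1 \<or> i = 2 then (if k = 1 then 2 else 1) else k)"
    have "lie i (\<lambda>x. x $ j $ k) x = d * x $ j $ l" for x unfolding 2 d_def l_def by simp
    thus ?thesis using 3[of j l] by (intro exI[of _ d] bexI[of _ "\<lambda>x. x $ j $ l"]) auto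
  qed
  consider "e = (\<lambda>x. 1)" | j k where "e = (\<lambda>x. x $ j $ k)" using assms by (auto simp: letters_def)
  thus ?thesis
  proof cases
    case 1
    thus ?thesis by (intro exI[of _ 0] bexI[of _ "\<lambda>x. 1"]) (auto simp: letters_def)
  next
    case 2
    thus ?thesis using 4 by simp
  qed
qed

lemma poly_deg_le_lie_word: "set w \<subseteq> set letters \<Longrightarrow> \<exists>g. poly_deg_le (length w) g \<and> (\<forall>x\<in>SU2. lie i (word w) x = g x)"
proof (induction w)
  case Nil
  have "word [] = (\<lambda>x. 1)" by (simp add: fun_eq_iff)
  thus ?case by (intro exI[of _ "\<lambda>x. 0"]) (simp add: poly_deg_le.zero)
next
  case (Cons e w)
  then obtain g where g: "poly_deg_le (length w) g" "\<And>x. x \<in> SU2 \<Longrightarrow> lie i (word w) x = g x" by auto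
  have e: "e \<in> set letters" and w: "set w \<subseteq> set letters" using Cons.prems by auto
  obtain c e' where e': "e' \<in> set letters" "\<And>x. lie i e x = c * e' x" using lie_letter[OF e] by blast
  have "lie i (word (e # w)) x = e x * g x + c * (e' x * word w x)" if x: "x \<in> SU2" for x
  proof -
    have "word (e # w) = (\<lambda>x. e x * word w x)" by (simp add: fun_eq_iff)
    thus ?thesis
      using lie_mult[OF poly_deg_le_smooth[OF poly_deg_le_letter[OF e]] poly_deg_le_smooth[OF poly_deg_le.word[OF w refl]] x, of i] g(2)[OF x] e'(2) by simp
  qed
  moreover have "poly_deg_le (length (e # w)) (\<lambda>x. e x * g x + c * (e' x * word w x))"
    using poly_deg_le_mult[OF poly_deg_le_letter[OF e] g(1)] poly_deg_le_mult[OF poly_deg_le_letter[OF e'(1)] poly_deg_le.word[OF w refl]]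
    by (auto intro: poly_deg_le.add poly_deg_le.cmult)
  ultimately show ?case by blast
qed

lemma poly_deg_le_lie: "poly_deg_le N f \<Longrightarrow> \<exists>g. poly_deg_le N g \<and> (\<forall>x\<in>SU2. lie i f x = g x)"
proof (induction rule: poly_deg_le.induct)
  case (zero N)
  show ?case by (intro exI[of _ "\<lambda>x. 0"]) (simp add: poly_deg_le.zero)
next
  case (word w N)
  thus ?case using poly_deg_le_lie_word by blast
next
  case (add N f g)
  then obtain p q where "poly_deg_le N p" "\<forall>x\<in>SU2. lie i f x = p x" "poly_deg_le N q" "\<forall>x\<in>SU2. lie i g x = q x" by blast
  thus ?case using add.hyps[THEN poly_deg_le_smooth] by (intro exI[of _ "\<lambda>x. p x + q x"]) (auto simp: lie_add intro: poly_deg_le.add)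
next
  case (cmult N f c)
  then obtain p where "poly_deg_le N p" "\<forall>x\<in>SU2. lie i f x = p x" by blast
  thus ?case using cmult.hyps[THEN poly_deg_le_smooth] by (intro exI[of _ "\<lambda>x. c * p x"]) (auto simp: lie_cmult intro: poly_deg_le.cmult)
qed

section \<open>Orthogonal projection and density of polynomials\<close>

lemma ip_Cauchy_Schwarz_null:
  assumes f: "smooth_near f" and g: "smooth_near g" and z: "ip g g = 0" shows "ip f g = 0"
proof (rule ccontr)
  assume nz: "ip f g \<noteq> 0"
  \<comment> \<open>For null \<open>g\<close> the square of f - t g is affine in t; this t makes it
    - 1.\<close>
  define t where "t = (ip f f + 1) / (2 * ip f g)"
  have "0 \<le> ip (\<lambda>x. f x - of_real t * g x) (\<lambda>x. f x - of_real t * g x)" by (rule ip_nonneg)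
  also have "\<dots> = ip f f - 2 * t * ip f g"
    by (simp add: ip_diff ip_scale smooth_intros f g z ip_commute[of g f])
  also have "2 * t * ip f g = ip f f + 1" using nz by (simp add: t_def field_simps)
  finally show False by simp
qed

lemma ip_Cauchy_Schwarz:
  assumes f: "smooth_near f" and g: "smooth_near g" shows "(ip f g)\<^sup>2 \<le> ip f f * ip g g"
proof (cases "ip g g = 0")
  case True
  thus ?thesis using ip_Cauchy_Schwarz_null[OF f g] by simp
next
  case False
  hence pos: "ip g g > 0" using ip_nonneg[of g] by simp
  define t where "t = ip f g / ip g g"
  have "0 \<le> ip (\<lambda>x. f x - of_real t * g x) (\<lambda>x. f x - of_real t * g x)" by (rule ip_nonneg)
  also have "\<dots> = ip f f - 2 * t * ip f g + t * (t * ip g g)"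
    by (simp add: ip_diff ip_scale smooth_intros f g ip_commute[of g f] algebra_simps)
  also have "\<dots> = ip f f - (ip f g)\<^sup>2 / ip g g" using False by (simp add: t_def power2_eq_square)
  finally show ?thesis using pos by (simp add: pos_divide_le_eq)
qed

text \<open>\<open>ip\<close> is only semidefinite on functions of matrices, since values off SU(2)
  do not count. The projection is therefore built by recursion over a spanning list.\<close>

fun real_span_list :: "(cmat2 \<Rightarrow> complex) list \<Rightarrow> (cmat2 \<Rightarrow> complex) set" where
  "real_span_list [] = {\<lambda>x. 0}"
| "real_span_list (b # bs) = {\<lambda>x. of_real t * b x + v x | t v. v \<in> real_span_list bs}"

lemma real_span_list_zero: "(\<lambda>x. 0) \<in> real_span_list bs"
proof (induction bs)
  case (Cons b bs)
  thus ?case by (auto intro!: exI[of _ 0] bexI[of _ "\<lambda>x. 0"] simp: fun_eq_iff)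
qed simp

lemma real_span_list_add: "u \<in> real_span_list bs \<Longrightarrow> v \<in> real_span_list bs \<Longrightarrow> (\<lambda>x. u x + v x) \<in> real_span_list bs"
proof (induction bs arbitrary: u v)
  case (Cons b bs)
  then obtain s u' t v' where "u = (\<lambda>x. of_real s * b x + u' x)" "u' \<in> real_span_list bs" "v = (\<lambda>x. of_real t * b x + v' x)" "v' \<in> real_span_list bs" by auto
  thus ?case using Cons.IH[of u' v'] by (auto intro!: exI[of _ "s + t"] exI[of _ "\<lambda>x. u' x + v' x"] simp: fun_eq_iff algebra_simps)
qed simp

lemma real_span_list_scale: "u \<in> real_span_list bs \<Longrightarrow> (\<lambda>x. of_real c * u x) \<in> real_span_list bs"
proof (induction bs arbitrary: u)
  case (Cons b bs)
  then obtain s u' where "u = (\<lambda>x. of_real s * b x + u' x)" "u' \<in> real_span_list bs" by auto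
  thus ?case using Cons.IH[of u'] by (auto intro!: exI[of _ "c * s"] exI[of _ "\<lambda>x. of_real c * u' x"] simp: fun_eq_iff algebra_simps)
qed simp

lemma real_span_list_base: "b \<in> set bs \<Longrightarrow> b \<in> real_span_list bs"
proof (induction bs)
  case (Cons a bs)
  show ?case
  proof (cases "b = a")
    case True
    show ?thesis unfolding real_span_list.simps mem_Collect_eq
      by (rule exI[of _ 1], rule exI[of _ "\<lambda>x. 0"]) (simp add: True real_span_list_zero)
  next
    case False
    have "b = (\<lambda>x. of_real 0 * a x + b x)" by simp
    moreover have "b \<in> real_span_list bs" using Cons False by simp
    ultimately show ?thesis by (simp only: real_span_list.simps) blast
  qed
qed simp

lemma real_span_list_subset:
  assumes "P (\<lambda>x. 0)" "\<And>u v. P u \<Longrightarrow> P v \<Longrightarrow> P (\<lambda>x. u x + v x)" "\<And>u t. P u \<Longrightarrow> P (\<lambda>x. of_real t * u x)"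
    "\<And>b. b \<in> set bs \<Longrightarrow> P b"
  shows "v \<in> real_span_list bs \<Longrightarrow> P v"
  using assms(4)
proof (induction bs arbitrary: v)
  case (Cons b bs)
  then obtain t v' where "v = (\<lambda>x. of_real t * b x + v' x)" "v' \<in> real_span_list bs" by auto
  thus ?case using Cons assms(2)[of "\<lambda>x. of_real t * b x" v'] assms(3)[of b t] by simp
qed (use assms(1) in simp)

lemma real_span_list_smooth: "(\<And>b. b \<in> set bs \<Longrightarrow> smooth_near b) \<Longrightarrow> v \<in> real_span_list bs \<Longrightarrow> smooth_near v"
  by (rule real_span_list_subset[of smooth_near bs]) (auto intro: smooth_near_add smooth_near_cmult)

text \<open>One Gram-Schmidt step: \<open>b\<close> is replaced by its residual \<open>b'\<close>
  over the rest of the list, and the residual of \<open>f\<close> is corrected along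
  \<open>b'\<close>.\<close>

lemma real_span_list_projection:
  "(\<And>b. b \<in> set bs \<Longrightarrow> smooth_near b) \<Longrightarrow> smooth_near f \<Longrightarrow> \<exists>p\<in>real_span_list bs. \<forall>v\<in>real_span_list bs. ip (\<lambda>x. f x - p x) v = 0"
proof (induction bs arbitrary: f)
  case Nil
  have "ip g (\<lambda>x. 0) = 0" for g by (simp add: ip_def)
  thus ?case by simp
next
  case (Cons b bs)
  note sv = real_span_list_smooth[of bs, OF Cons.prems(1)]
  have b: "smooth_near b" using Cons.prems by simp
  obtain pf where pf: "pf \<in> real_span_list bs" "\<And>v. v \<in> real_span_list bs \<Longrightarrow> ip (\<lambda>x. f x - pf x) v = 0" using Cons.IH[of f] Cons.prems by auto
  obtain pb where pb: "pb \<in> real_span_list bs" "\<And>v. v \<in> real_span_list bs \<Longrightarrow> ip (\<lambda>x. b x - pb x) v = 0" using Cons.IH[OF _ b] Cons.prems by auto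
  define b' where "b' x = b x - pb x" for x
  define f' where "f' x = f x - pf x" for x
  have spf: "smooth_near pf" and spb: "smooth_near pb" using sv pf(1) pb(1) by auto
  have b': "smooth_near b'" and f': "smooth_near f'"
    unfolding b'_def[abs_def] f'_def[abs_def] using b Cons.prems(2) spf spb by (auto intro: smooth_near_diff)
  \<comment> \<open>If \<open>b'\<close> has norm zero, division by zero makes t = 0, which is still
    right because \<open>ip f' b' = 0\<close> by the null case of Cauchy-Schwarz.\<close>
  define t where "t = ip f' b' / ip b' b'"
  have tb: "t * ip b' b' = ip f' b'"
    using ip_Cauchy_Schwarz_null[OF f' b'] by (cases "ip b' b' = 0") (simp_all add: t_def)
  define p where "p x = of_real t * b x + (pf x + of_real (- t) * pb x)" for x
  have "p \<in> real_span_list (b # bs)"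
    using real_span_list_add[OF pf(1) real_span_list_scale[OF pb(1), of "- t"]] unfolding p_def[abs_def] by auto
  moreover have "ip (\<lambda>x. f x - p x) v = 0" if v: "v \<in> real_span_list (b # bs)" for v
  proof -
    obtain s v0 where v0: "v = (\<lambda>x. of_real s * b x + v0 x)" "v0 \<in> real_span_list bs" using v by auto
    define v1 where "v1 x = v0 x + of_real s * pb x" for x
    have v1: "v1 \<in> real_span_list bs" unfolding v1_def by (intro real_span_list_add real_span_list_scale v0 pb(1))
    have z: "ip f' v1 = 0" "ip b' v1 = 0" unfolding f'_def[abs_def] b'_def[abs_def] using pf(2) pb(2) v1 by auto
    have sv1: "smooth_near v1" using sv v1 by auto
    have "ip (\<lambda>x. f x - p x) v = ip (\<lambda>x. f' x - of_real t * b' x) (\<lambda>x. of_real s * b' x + v1 x)"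
      by (rule ip_cong) (simp_all add: f'_def b'_def v1_def v0(1) p_def algebra_simps)
    also have "\<dots> = s * ip f' b' - t * (s * ip b' b')"
      by (simp add: ip_diff ip_add ip_scale smooth_near_cmult smooth_near_add smooth_near_diff b' f' sv1 z)
    also have "\<dots> = s * (ip f' b' - t * ip b' b')" by (simp add: algebra_simps)
    finally show ?thesis by (simp add: tb)
  qed
  ultimately show ?case by blast
qed

lemma poly_deg_le_projection:
  assumes f: "smooth_near f"
  obtains p where "poly_deg_le N p" "\<And>v. poly_deg_le N v \<Longrightarrow> ip (\<lambda>x. f x - p x) v = 0"
proof -
  \<comment> \<open>Adding i times every word makes the real span equal to the complex span of the
    words.\<close>
  define bs where "bs = concat (map (\<lambda>w. [word w, \<lambda>x. \<i> * word w x]) (List.n_lists N letters))"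
  have set_bs: "b \<in> set bs \<longleftrightarrow> (\<exists>w. length w = N \<and> set w \<subseteq> set letters \<and> (b = word w \<or> b = (\<lambda>x. \<i> * word w x)))" for b
    unfolding bs_def by (auto simp: set_n_lists)
  have bV: "poly_deg_le N b" if "b \<in> set bs" for b using that unfolding set_bs by (auto intro: poly_deg_le.word poly_deg_le.cmult)
  have spV: "poly_deg_le N v" if "v \<in> real_span_list bs" for v
    using real_span_list_subset[of "poly_deg_le N" bs v] that bV by (auto intro: poly_deg_le.zero poly_deg_le.add poly_deg_le.cmult)
  have i: "(\<lambda>x. \<i> * v x) \<in> real_span_list bs" if "v \<in> real_span_list bs" for v
  proof (rule real_span_list_subset[of "\<lambda>v. (\<lambda>x. \<i> * v x) \<in> real_span_list bs", OF _ _ _ _ that])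
    show "(\<lambda>x. \<i> * 0) \<in> real_span_list bs" using real_span_list_zero by simp
    show "(\<lambda>x. \<i> * (u x + v x)) \<in> real_span_list bs" if "(\<lambda>x. \<i> * u x) \<in> real_span_list bs" "(\<lambda>x. \<i> * v x) \<in> real_span_list bs" for u v
      using real_span_list_add[OF that] by (simp add: distrib_left)
    show "(\<lambda>x. \<i> * (of_real t * u x)) \<in> real_span_list bs" if "(\<lambda>x. \<i> * u x) \<in> real_span_list bs" for u t
      using real_span_list_scale[OF that, of t] by (simp add: mult.left_commute)
    fix b assume "b \<in> set bs"
    then obtain w where w: "length w = N" "set w \<subseteq> set letters" "b = word w \<or> b = (\<lambda>x. \<i> * word w x)" unfolding set_bs by blast
    have 1: "word w \<in> real_span_list bs" "(\<lambda>x. \<i> * word w x) \<in> real_span_list bs" using w by (auto intro!: real_span_list_base simp: set_bs)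
    from w(3) show "(\<lambda>x. \<i> * b x) \<in> real_span_list bs"
    proof
      assume "b = (\<lambda>x. \<i> * word w x)"
      hence "(\<lambda>x. \<i> * b x) = (\<lambda>x. of_real (- 1) * word w x)" by (simp add: fun_eq_iff mult.assoc[symmetric])
      thus ?thesis using real_span_list_scale[OF 1(1), of "- 1"] by simp
    qed (use 1(2) in simp)
  qed
  have Vsp: "v \<in> real_span_list bs" if "poly_deg_le N v" for v
  proof -
    have "poly_deg_le K v \<Longrightarrow> K = N \<Longrightarrow> v \<in> real_span_list bs" for K
    proof (induction rule: poly_deg_le.induct)
      case (zero K)
      show ?case by (rule real_span_list_zero)
    next
      case (word w K)
      thus ?case by (intro real_span_list_base) (auto simp: set_bs)
    next
      case (add K f g)
      thus ?case by (intro real_span_list_add) auto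
    next
      case (cmult K f c)
      hence "f \<in> real_span_list bs" by simp
      from real_span_list_add[OF real_span_list_scale[OF this, of "Re c"] real_span_list_scale[OF i[OF this], of "Im c"]]
      have "(\<lambda>x. of_real (Re c) * f x + of_real (Im c) * (\<i> * f x)) \<in> real_span_list bs" .
      moreover have "of_real (Re c) * z + of_real (Im c) * (\<i> * z) = c * z" for z :: complex
        by (simp add: complex_eq_iff algebra_simps)
      ultimately show ?case by simp
    qed
    thus ?thesis using that by blast
  qed
  obtain p where "p \<in> real_span_list bs" "\<forall>v\<in>real_span_list bs. ip (\<lambda>x. f x - p x) v = 0"
    using real_span_list_projection[of bs f] bV poly_deg_le_smooth f by blast
  thus ?thesis using that[of p] spV Vsp by blast
qed

text \<open>The letters contain no conjugates, but on SU(2) the conjugate of an entry is again an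
  entry up to sign, so real coordinates are complex polynomials in the entries.\<close>

lemma poly_deg_le_real_polynomial:
  "real_polynomial_function p \<Longrightarrow> \<exists>N q. poly_deg_le N q \<and> (\<forall>x\<in>SU2. complex_of_real (p x) = q x)"
proof (induction rule: real_polynomial_function.induct)
  case (linear f)
  \<comment> \<open>Expands x in \<open>mat 1\<close> and the \<open>theta i\<close>; the real
    coefficients are written with 2 Re x_11 = x_11 + x_22, 2 i Im x_11 = x_11 - x_22, 2 Re x_21 =
    x_21 - x_12 and 2 i Im x_21 = x_21 + x_12.\<close>
  define q where "q = (\<lambda>x::cmat2. of_real (f (mat 1)) / 2 * x $ 1 $ 1 + of_real (f (mat 1)) / 2 * x $ 2 $ 2
     + (of_real (f (theta 3)) / \<i> * x $ 1 $ 1 + (- of_real (f (theta 3)) / \<i>) * x $ 2 $ 2)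
     + ((- of_real (f (theta 2))) * x $ 2 $ 1 + of_real (f (theta 2)) * x $ 1 $ 2)
     + (of_real (f (theta 1)) / \<i> * x $ 2 $ 1 + of_real (f (theta 1)) / \<i> * x $ 1 $ 2))"
  have l: "poly_deg_le 1 (\<lambda>x. x $ i $ j)" for i j
    by (rule poly_deg_le_letter) (use exhaust_2[of i] exhaust_2[of j] in \<open>auto simp: letters_def\<close>)
  have "poly_deg_le 1 q" unfolding q_def by (intro poly_deg_le.add poly_deg_le.cmult l)
  moreover have "complex_of_real (f x) = q x" if x: "x \<in> SU2" for x
  proof -
    note e = SU2_entries(1,2)[OF x]
    have lf: "linear f" using linear bounded_linear.linear by blast
    have "x = Re (x $ 1 $ 1) *\<^sub>R mat 1 + (2 * Im (x $ 1 $ 1)) *\<^sub>R theta 3 + (- 2 * Re (x $ 2 $ 1)) *\<^sub>R theta 2 + (2 * Im (x $ 2 $ 1)) *\<^sub>R theta 1"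
      using e by (simp add: cmat2_eq_iff complex_eq_iff theta_nth mat_def)
    hence "f x = Re (x $ 1 $ 1) * f (mat 1) + (2 * Im (x $ 1 $ 1)) * f (theta 3) + (- 2 * Re (x $ 2 $ 1)) * f (theta 2) + (2 * Im (x $ 2 $ 1)) * f (theta 1)"
      using linear_add[OF lf] linear_scale[OF lf] by (metis real_scaleR_def)
    thus ?thesis unfolding q_def e by (simp add: complex_eq_iff)
  qed
  ultimately show ?case by blast
next
  case (const c)
  have "poly_deg_le 0 (\<lambda>x. of_real c * word [] x)" by (intro poly_deg_le.cmult poly_deg_le.word) auto
  thus ?case by (intro exI[of _ 0] exI[of _ "\<lambda>x. of_real c * word [] x"]) simp
next
  case (add f g)
  then obtain N q M r where "poly_deg_le N q" "\<forall>x\<in>SU2. complex_of_real (f x) = q x" "poly_deg_le M r" "\<forall>x\<in>SU2. complex_of_real (g x) = r x" by blast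
  thus ?case using poly_deg_le_mono[of N q "max N M"] poly_deg_le_mono[of M r "max N M"]
    by (intro exI[of _ "max N M"] exI[of _ "\<lambda>x. q x + r x"]) (auto intro: poly_deg_le.add)
next
  case (mult f g)
  then obtain N q M r where "poly_deg_le N q" "\<forall>x\<in>SU2. complex_of_real (f x) = q x" "poly_deg_le M r" "\<forall>x\<in>SU2. complex_of_real (g x) = r x" by blast
  thus ?case by (intro exI[of _ "N + M"] exI[of _ "\<lambda>x. q x * r x"]) (auto intro: poly_deg_le_mult)
qed

lemma poly_deg_le_dense:
  fixes f :: "cmat2 \<Rightarrow> complex"
  assumes f: "continuous_on SU2 f" and e: "e > 0"
  obtains N q where "poly_deg_le N q" "\<And>x. x \<in> SU2 \<Longrightarrow> norm (f x - q x) < e"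
proof -
  obtain g where g: "polynomial_function g" "\<And>x. x \<in> SU2 \<Longrightarrow> norm (f x - g x) < e"
    using Stone_Weierstrass_polynomial_function[OF compact_SU2 f e] by blast
  have r: "real_polynomial_function (Re \<circ> g)" "real_polynomial_function (Im \<circ> g)"
    using g(1) bounded_linear_Re bounded_linear_Im unfolding polynomial_function_def by blast+
  obtain N q where q: "poly_deg_le N q" "\<forall>x\<in>SU2. complex_of_real ((Re \<circ> g) x) = q x" using poly_deg_le_real_polynomial[OF r(1)] by blast
  obtain M p where p: "poly_deg_le M p" "\<forall>x\<in>SU2. complex_of_real ((Im \<circ> g) x) = p x" using poly_deg_le_real_polynomial[OF r(2)] by blast
  have "poly_deg_le (max N M) (\<lambda>x. q x + \<i> * p x)"
    using poly_deg_le_mono[OF q(1), of "max N M"] poly_deg_le_mono[OF p(1), of "max N M"] by (intro poly_deg_le.add poly_deg_le.cmult) auto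
  moreover have "g x = q x + \<i> * p x" if "x \<in> SU2" for x
    using q(2) p(2) that by (metis comp_apply complex_eq)
  ultimately show ?thesis using that[of "max N M" "\<lambda>x. q x + \<i> * p x"] g(2) by simp
qed

lemma ip_le_sup:
  assumes "smooth_near g" "\<And>x. x \<in> SU2 \<Longrightarrow> norm (g x) \<le> e" shows "ip g g \<le> e\<^sup>2 * integral_SU2 (\<lambda>x. 1)"
proof -
  have "0 \<le> integral_SU2 (\<lambda>x. e\<^sup>2 * 1 - g x \<bullet> g x)"
  proof (rule integral_SU2_nonneg)
    fix x assume "x \<in> SU2"
    hence "(norm (g x))\<^sup>2 \<le> e\<^sup>2" using assms(2) by (intro power_mono) auto
    thus "0 \<le> e\<^sup>2 * 1 - g x \<bullet> g x" by (simp add: power2_norm_eq_inner)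
  qed
  also have "\<dots> = integral_SU2 (\<lambda>x. e\<^sup>2 * 1) - ip g g"
    unfolding ip_def by (rule integral_SU2_diff) (auto intro: continuous_ip assms)
  also have "integral_SU2 (\<lambda>x. e\<^sup>2 * 1) = e\<^sup>2 * integral_SU2 (\<lambda>x. 1)" by (rule integral_SU2_cmult)
  finally show ?thesis by simp
qed

lemma ip_best_approximation:
  assumes f: "smooth_near f" and p: "poly_deg_le N p" "\<And>v. poly_deg_le N v \<Longrightarrow> ip (\<lambda>x. f x - p x) v = 0" and q: "poly_deg_le N q"
  shows "ip (\<lambda>x. f x - p x) (\<lambda>x. f x - p x) \<le> ip (\<lambda>x. f x - q x) (\<lambda>x. f x - q x)"
proof -
  note s = poly_deg_le_smooth[OF p(1)] poly_deg_le_smooth[OF q]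
  define g where "g x = f x - p x" for x
  define v where "v x = p x + (- 1) * q x" for x
  have v: "poly_deg_le N v" unfolding v_def by (intro poly_deg_le.add poly_deg_le.cmult p q)
  have g: "smooth_near g" unfolding g_def[abs_def] by (intro smooth_near_diff f s)
  have gv: "ip g v = 0" unfolding g_def[abs_def] by (rule p(2)[OF v])
  have "ip (\<lambda>x. f x - q x) (\<lambda>x. f x - q x) = ip (\<lambda>x. g x + v x) (\<lambda>x. g x + v x)"
    by (rule ip_cong) (simp_all add: g_def v_def)
  also have "\<dots> = ip g g + ip v v"
    using poly_deg_le_smooth[OF v] by (simp add: ip_add g smooth_near_add gv ip_commute[of v g])
  finally show ?thesis using ip_nonneg[of v] by (simp add: g_def[abs_def])
qed

text \<open>The orthogonal projection onto \<open>poly_deg_le N\<close> commutes with the skew-adjoint fields, so it approximates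
  a function together with its derivatives.\<close>
lemma poly_deg_le_approximation:
  assumes f: "smooth_near f" and e: "e > 0"
  obtains N p where "poly_deg_le N p" "ip (\<lambda>x. f x - p x) (\<lambda>x. f x - p x) \<le> e\<^sup>2 * integral_SU2 (\<lambda>x. 1)"
    "\<And>i. ip (\<lambda>x. lie i f x - lie i p x) (\<lambda>x. lie i f x - lie i p x) \<le> e\<^sup>2 * integral_SU2 (\<lambda>x. 1)"
proof -
  obtain N0 q0 where q0: "poly_deg_le N0 q0" "\<And>x. x \<in> SU2 \<Longrightarrow> norm (f x - q0 x) < e"
    by (rule poly_deg_le_dense[OF smooth_near_continuous_on[OF f] e]) blast
  have "\<forall>i. \<exists>N q. poly_deg_le N q \<and> (\<forall>x\<in>SU2. norm (lie i f x - q x) < e)"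
    using poly_deg_le_dense[OF smooth_near_continuous_on[OF smooth_near_lie[OF f]] e] by metis
  then obtain K q where q: "\<And>i. poly_deg_le (K i) (q i)" "\<And>i x. x \<in> SU2 \<Longrightarrow> norm (lie i f x - q i x) < e" by metis
  \<comment> \<open>One degree that serves \<open>f\<close> and its three derivatives at
    once.\<close>
  define N where "N = N0 + K 1 + K 2 + K 3"
  have N: "poly_deg_le N q0" "poly_deg_le N (q i)" for i
    using poly_deg_le_mono[OF q0(1), of N] poly_deg_le_mono[OF q(1), of i N] exhaust_3[of i] by (auto simp: N_def)
  obtain p where p: "poly_deg_le N p" "\<And>v. poly_deg_le N v \<Longrightarrow> ip (\<lambda>x. f x - p x) v = 0" using poly_deg_le_projection[OF f] by blast
  have "ip (\<lambda>x. f x - p x) (\<lambda>x. f x - p x) \<le> ip (\<lambda>x. f x - q0 x) (\<lambda>x. f x - q0 x)"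
    by (rule ip_best_approximation[OF f p N(1)])
  also have "\<dots> \<le> e\<^sup>2 * integral_SU2 (\<lambda>x. 1)"
    by (rule ip_le_sup) (use q0 in \<open>auto intro: smooth_near_diff f poly_deg_le_smooth less_imp_le\<close>)
  finally have A: "ip (\<lambda>x. f x - p x) (\<lambda>x. f x - p x) \<le> e\<^sup>2 * integral_SU2 (\<lambda>x. 1)" .
  have B: "ip (\<lambda>x. lie i f x - lie i p x) (\<lambda>x. lie i f x - lie i p x) \<le> e\<^sup>2 * integral_SU2 (\<lambda>x. 1)" for i
  proof -
    obtain r where r: "poly_deg_le N r" "\<And>x. x \<in> SU2 \<Longrightarrow> lie i p x = r x" using poly_deg_le_lie[OF p(1)] by blast
    have fp: "smooth_near (\<lambda>x. f x - p x)" by (intro smooth_near_diff f poly_deg_le_smooth[OF p(1)])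
    \<comment> \<open>Skew-adjointness moves the derivative to \<open>v\<close>, which keeps its
      degree. Hence the derivative of the projection of \<open>f\<close> is the projection of its
      derivative, and best approximation applies to it.\<close>
    have "ip (\<lambda>x. lie i f x - r x) v = 0" if v: "poly_deg_le N v" for v
    proof -
      obtain v' where v': "poly_deg_le N v'" "\<And>x. x \<in> SU2 \<Longrightarrow> lie i v x = v' x" using poly_deg_le_lie[OF v] by blast
      have "ip (\<lambda>x. lie i f x - r x) v = ip (lie i (\<lambda>x. f x - p x)) v"
        by (rule ip_cong) (simp_all add: lie_diff f poly_deg_le_smooth[OF p(1)] r(2))
      also have "\<dots> = - ip (\<lambda>x. f x - p x) (lie i v)" by (rule ip_lie[OF fp poly_deg_le_smooth[OF v]])
      also have "ip (\<lambda>x. f x - p x) (lie i v) = ip (\<lambda>x. f x - p x) v'" by (rule ip_cong) (simp_all add: v'(2))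
      finally show ?thesis using p(2)[OF v'(1)] by simp
    qed
    from ip_best_approximation[OF smooth_near_lie[OF f] r(1) this N(2)]
    have "ip (\<lambda>x. lie i f x - r x) (\<lambda>x. lie i f x - r x) \<le> ip (\<lambda>x. lie i f x - q i x) (\<lambda>x. lie i f x - q i x)" .
    also have "\<dots> \<le> e\<^sup>2 * integral_SU2 (\<lambda>x. 1)"
      by (rule ip_le_sup) (use q N in \<open>auto intro: smooth_near_diff smooth_near_lie f poly_deg_le_smooth less_imp_le\<close>)
    also have "ip (\<lambda>x. lie i f x - r x) (\<lambda>x. lie i f x - r x) = ip (\<lambda>x. lie i f x - lie i p x) (\<lambda>x. lie i f x - lie i p x)"
      by (rule ip_cong) (simp_all add: r(2))
    finally show ?thesis .
  qed
  show ?thesis by (rule that[OF p(1) A B])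
qed

section \<open>Passage to the L2 limit\<close>

definition ip_lim :: "(nat \<Rightarrow> cmat2 \<Rightarrow> complex) \<Rightarrow> (cmat2 \<Rightarrow> complex) \<Rightarrow> bool" where
  "ip_lim F f \<longleftrightarrow> (\<forall>n. smooth_near (F n)) \<and> smooth_near f \<and> (\<lambda>n. ip (\<lambda>x. F n x - f x) (\<lambda>x. F n x - f x)) \<longlonglongrightarrow> 0"

text \<open>Expands both arguments around their limits; Cauchy-Schwarz sends the three error terms
  to zero.\<close>

lemma ip_lim_ip:
  assumes F: "ip_lim F f" and G: "ip_lim G g" shows "(\<lambda>n. ip (F n) (G n)) \<longlonglongrightarrow> ip f g"
proof -
  have s: "smooth_near (F n)" "smooth_near (G n)" "smooth_near f" "smooth_near g" for n using F G by (auto simp: ip_lim_def)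
  define a where "a n x = F n x - f x" for n x
  define b where "b n x = G n x - g x" for n x
  have sa: "smooth_near (a n)" and sb: "smooth_near (b n)" for n
    unfolding a_def[abs_def] b_def[abs_def] by (intro smooth_near_diff s)+
  have a0: "(\<lambda>n. ip (a n) (a n)) \<longlonglongrightarrow> 0" and b0: "(\<lambda>n. ip (b n) (b n)) \<longlonglongrightarrow> 0"
    using F G unfolding ip_lim_def a_def[abs_def] b_def[abs_def] by auto
  have z: "(\<lambda>n. ip (u n) (v n)) \<longlonglongrightarrow> 0"
    if "(\<lambda>n. ip (u n) (u n) * ip (v n) (v n)) \<longlonglongrightarrow> 0" "\<And>n. smooth_near (u n)" "\<And>n. smooth_near (v n)" for u v
  proof -
    have "(\<lambda>n. (ip (u n) (v n))\<^sup>2) \<longlonglongrightarrow> 0"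
      by (rule tendsto_sandwich[OF _ _ tendsto_const that(1)]) (use ip_Cauchy_Schwarz that in auto)
    from tendsto_real_sqrt[OF this] show ?thesis by (simp add: tendsto_rabs_zero_iff)
  qed
  have "(\<lambda>n. ip f g + ip (a n) g + ip f (b n) + ip (a n) (b n)) \<longlonglongrightarrow> ip f g + 0 + 0 + 0"
    by (intro tendsto_add tendsto_const z sa sb s tendsto_mult_left_zero[OF a0] tendsto_mult_right_zero[OF b0] tendsto_mult_zero[OF a0 b0])
  moreover have "ip (F n) (G n) = ip f g + ip (a n) g + ip f (b n) + ip (a n) (b n)" for n
  proof -
    have "ip (F n) (G n) = ip (\<lambda>x. f x + a n x) (\<lambda>x. g x + b n x)" by (rule ip_cong) (simp_all add: a_def b_def)
    thus ?thesis by (simp add: ip_add smooth_near_add s sa sb)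
  qed
  ultimately show ?thesis by simp
qed

lemma ip_lim_add:
  assumes F: "ip_lim F f" and G: "ip_lim G g" shows "ip_lim (\<lambda>n x. F n x + G n x) (\<lambda>x. f x + g x)"
proof -
  have s: "smooth_near (F n)" "smooth_near (G n)" "smooth_near f" "smooth_near g" for n using F G by (auto simp: ip_lim_def)
  define a where "a n x = F n x - f x" for n x
  define b where "b n x = G n x - g x" for n x
  have sa: "smooth_near (a n)" and sb: "smooth_near (b n)" for n
    unfolding a_def[abs_def] b_def[abs_def] by (intro smooth_near_diff s)+
  have a0: "(\<lambda>n. ip (a n) (a n)) \<longlonglongrightarrow> 0" and b0: "(\<lambda>n. ip (b n) (b n)) \<longlonglongrightarrow> 0"
    using F G unfolding ip_lim_def a_def[abs_def] b_def[abs_def] by auto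
  have "ip_lim a (\<lambda>x. 0)" "ip_lim b (\<lambda>x. 0)" using a0 b0 sa sb by (auto simp: ip_lim_def)
  note l = ip_lim_ip[OF this(1,1)] ip_lim_ip[OF this] ip_lim_ip[OF this(2,2)]
  have "ip (\<lambda>x. 0) (\<lambda>x. 0) = 0" by (simp add: ip_def)
  with l have "(\<lambda>n. ip (a n) (a n) + 2 * ip (a n) (b n) + ip (b n) (b n)) \<longlonglongrightarrow> 0 + 2 * 0 + 0"
    by (intro tendsto_add tendsto_mult_left) simp_all
  moreover have "ip (\<lambda>x. (F n x + G n x) - (f x + g x)) (\<lambda>x. (F n x + G n x) - (f x + g x)) = ip (a n) (a n) + 2 * ip (a n) (b n) + ip (b n) (b n)" for n
  proof -
    have "ip (\<lambda>x. (F n x + G n x) - (f x + g x)) (\<lambda>x. (F n x + G n x) - (f x + g x)) = ip (\<lambda>x. a n x + b n x) (\<lambda>x. a n x + b n x)"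
      by (rule ip_cong) (simp_all add: a_def b_def)
    thus ?thesis by (simp add: ip_add smooth_near_add sa sb ip_commute[of "b n" "a n"])
  qed
  ultimately show ?thesis by (simp add: ip_lim_def s smooth_near_add)
qed

lemma ip_lim_i: "ip_lim F f \<Longrightarrow> ip_lim (\<lambda>n x. \<i> * F n x) (\<lambda>x. \<i> * f x)"
  unfolding ip_lim_def by (simp add: smooth_near_cmult right_diff_distrib[symmetric] ip_mult_i(2))

lemma ip_lim_minus: "ip_lim F f \<Longrightarrow> ip_lim (\<lambda>n x. - F n x) (\<lambda>x. - f x)"
  using ip_lim_i[OF ip_lim_i, of F f] by (simp add: mult.assoc[symmetric])

lemma ip_lim_cnj: "ip_lim F f \<Longrightarrow> ip_lim (\<lambda>n x. cnj (F n x)) (\<lambda>x. cnj (f x))"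
  unfolding ip_lim_def by (simp add: smooth_near_cnj complex_cnj_diff[symmetric] ip_cnj(2) del: complex_cnj_diff)

text \<open>\<open>hessq\<close> is a combination of L2 products of \<open>f\<close>, its
  left-invariant derivatives and their conjugates, so it is continuous for the convergence given by
  \<open>poly_deg_le_approximation\<close>.\<close>

lemma hessq_nonneg:
  assumes f: "smooth_near f" and \<alpha>: "\<alpha> \<ge> 1" shows "hessq \<alpha> f \<ge> 0"
proof -
  define I where "I = integral_SU2 (\<lambda>x. 1)"
  have "\<forall>n. \<exists>p. poly_fun p \<and> ip (\<lambda>x. f x - p x) (\<lambda>x. f x - p x) \<le> (1 / real (Suc n))\<^sup>2 * I
      \<and> (\<forall>i. ip (\<lambda>x. lie i f x - lie i p x) (\<lambda>x. lie i f x - lie i p x) \<le> (1 / real (Suc n))\<^sup>2 * I)"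
  proof
    fix n
    have e: "1 / real (Suc n) > 0" by simp
    show "\<exists>p. poly_fun p \<and> ip (\<lambda>x. f x - p x) (\<lambda>x. f x - p x) \<le> (1 / real (Suc n))\<^sup>2 * I
      \<and> (\<forall>i. ip (\<lambda>x. lie i f x - lie i p x) (\<lambda>x. lie i f x - lie i p x) \<le> (1 / real (Suc n))\<^sup>2 * I)"
      unfolding I_def by (rule poly_deg_le_approximation[OF f e]) (use poly_deg_le_imp_poly_fun in blast)
  qed
  from choice[OF this] obtain p where "\<forall>n. poly_fun (p n) \<and> ip (\<lambda>x. f x - p n x) (\<lambda>x. f x - p n x) \<le> (1 / real (Suc n))\<^sup>2 * I
      \<and> (\<forall>i. ip (\<lambda>x. lie i f x - lie i (p n) x) (\<lambda>x. lie i f x - lie i (p n) x) \<le> (1 / real (Suc n))\<^sup>2 * I)" ..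
  hence p: "\<And>n. poly_fun (p n)" "\<And>n. ip (\<lambda>x. f x - p n x) (\<lambda>x. f x - p n x) \<le> (1 / real (Suc n))\<^sup>2 * I"
    "\<And>n i. ip (\<lambda>x. lie i f x - lie i (p n) x) (\<lambda>x. lie i f x - lie i (p n) x) \<le> (1 / real (Suc n))\<^sup>2 * I" by simp_all
  have e0: "(\<lambda>n. (1 / real (Suc n))\<^sup>2 * I) \<longlonglongrightarrow> 0"
  proof -
    have "(\<lambda>n. (1 / real (Suc n))\<^sup>2 * I) \<longlonglongrightarrow> 0\<^sup>2 * I"
      using LIMSEQ_inverse_real_of_nat by (intro tendsto_mult tendsto_power tendsto_const) (simp add: inverse_eq_divide)
    thus ?thesis by simp
  qed
  have sw: "ip (\<lambda>x. a x - b x) (\<lambda>x. a x - b x) = ip (\<lambda>x. b x - a x) (\<lambda>x. b x - a x)" for a b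
    unfolding ip_def by (rule integral_SU2_cong) (simp add: inner_diff_left inner_diff_right inner_commute)
  have lp: "ip_lim p f" unfolding ip_lim_def
    by (intro conjI allI poly_fun_smooth p f tendsto_sandwich[OF _ _ tendsto_const e0])
       (use p(2) in \<open>auto simp: ip_nonneg sw[of _ f]\<close>)
  have ll: "ip_lim (\<lambda>n. lie i (p n)) (lie i f)" for i unfolding ip_lim_def
    by (intro conjI allI smooth_near_lie poly_fun_smooth p f tendsto_sandwich[OF _ _ tendsto_const e0])
       (use p(3) in \<open>auto simp: ip_nonneg sw[of _ "lie i f"]\<close>)
  have lr: "ip_lim (\<lambda>n. raise (p n)) (raise f)"
    using ip_lim_add[OF ll ip_lim_i[OF ll], of 1 2] by (simp add: raise_def[abs_def])
  have lw: "ip_lim (\<lambda>n. lower (p n)) (lower f)"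
    using ip_lim_add[OF ll ip_lim_minus[OF ip_lim_i[OF ll]], of 1 2] by (simp add: lower_def[abs_def])
  \<comment> \<open>The square of Im is polarised by \<open>integral_Im_Im\<close>, which leaves L2
    products only.\<close>
  have h: "hessq \<alpha> g = ip (raise g) (raise g) + (1 + \<alpha>) * (ip (lie 3 g) (lie 3 g) + ip g (\<lambda>x. \<i> * lie 3 g x))
     + \<alpha> * (1/2 * (ip (lower g) (lower g) - ip (lower g) (\<lambda>x. cnj (lower g x))))" if g: "smooth_near g" for g
    unfolding hessq_ip[OF g] integral_Im_Im[OF smooth_near_lower[OF g] smooth_near_lower[OF g], symmetric]
    by (simp add: power2_eq_square)
  have "(\<lambda>n. hessq \<alpha> (p n)) \<longlonglongrightarrow> hessq \<alpha> f"
    unfolding h[OF f] h[OF poly_fun_smooth[OF p(1)]]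
    by (intro tendsto_add tendsto_mult tendsto_diff tendsto_const ip_lim_ip lr ll lp lw ip_lim_i ip_lim_cnj)
  thus ?thesis
    by (rule LIMSEQ_le_const) (use hessq_poly_fun_nonneg[OF p(1) \<alpha>] in auto)
qed


theorem theorem5p3:
  fixes \<alpha> :: real
  assumes "\<alpha> \<ge> 0"
  shows "(\<alpha> < 1 \<longrightarrow> critical_point \<alpha> hopf \<and> \<not> stable_map \<alpha> hopf) \<and>
         (\<alpha> \<ge> 1 \<longrightarrow> critical_point \<alpha> hopf \<and> stable_map \<alpha> hopf)"
proof -
  have "stable_map \<alpha> hopf" if "\<alpha> \<ge> 1"
    unfolding stable_map_def
  proof
    fix X assume "X \<in> sections hopf"
    then obtain f where "smooth_near f" "hessian \<alpha> hopf X X = hessq \<alpha> f"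
      by (rule hessian_hopf_hessq)
    thus "hessian \<alpha> hopf X X \<ge> 0" using hessq_nonneg that by simp
  qed
  thus ?thesis using critical_point_hopf hopf_unstable by blast
qed

end
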